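(* Let $I$ be a finite set. The map $\Delta:\mathsf{F}(I)\to\mathsf{F}(I)\otimes\mathsf{F}(I)$ given by $$\Delta(o\otimes F)=\sum_{N(F)=N_1\sqcup N_2}(o_1\otimes\gamma(F,N_1))\otimes(o_2\otimes\gamma(F,N_2)),$$ where the orientations satisfy $o=o_1\wedge r\wedge o_2$ modulo $R=R_1\wedge r\wedge R_2$, endows $\mathsf{F}(I)$ with the structure of a cocommutative coassociative counital coalgebra with coproduct $\Delta$ (in the category of $\mathbb{Z}$-graded abelian groups with Koszul sign rules).
   Context: A forest on $I$ is an acyclic graph with vertex set $I$ in which each connected component has a distinguished vertex called its root; so it is a partition $\pi(F)$ of $I$ together with a rooted tree on each part. Vertices that are not roots are called nodes, and $N(F)$ is the set of nodes of $F$. A forest is seen as a poset: $i\leq_F j$ if $i,j$ are in the same tree of $F$ and $i$ is on the path from $j$ to the root of this tree. For forests $F',F$ on $I$, $F'\subseteq F$ means: $\pi(F')$ is finer than (or equal to) $\pi(F)$, and each tree of $F'$ is induced by $F$ as a poset (on each part of $\pi(F')$ the order $\leq_{F'}$ is the restriction of $\leq_F$). For $N\subseteq N(F)$, put $\gamma(F,N)=\sum_{F'\subseteq F,\ N(F')=N}F'$. An orientation $o$ of a forest $F$ is a maximal exterior product of the set $N(F)\sqcup\{R_F\}$ (the wedge product of all its elements in some order, with the usual signs), where $R_F$ is an auxiliary element. $\mathsf{F}(I)$ is the free $\mathbb{Z}$-module on oriented forests $o\otimes F$ on $I$ modulo the relations $(-o)\otimes F=-(o\otimes F)$, graded by $\deg(o\otimes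 F)=\#N(F)$. In the formula for $\Delta$, the sum is over ordered pairs $(N_1,N_2)$ of disjoint subsets with union $N(F)$; $o_1,o_2$ are orientations on $N_1\sqcup\{R_1\}$ and $N_2\sqcup\{R_2\}$, with $R,R_1,R_2$ the auxiliary elements for $o,o_1,o_2$, and $o_a\otimes\gamma(F,N_a)$ is the sum of the $o_a\otimes F'$ over the terms $F'$ of $\gamma(F,N_a)$. The condition on orientations amounts to: if $o=\omega\wedge R$ and $o_a=\omega_a\wedge R_a$ with $\omega_a$ a maximal exterior product of $N_a$, then $\omega=\omega_1\wedge\omega_2$. Cocommutativity is with respect to the Koszul-signed exchange $u\otimes v\mapsto(-1)^{\deg u\deg v}v\otimes u$. *)

theory Defs
  imports "HOL-Algebra.Free_Abelian_Groups" "HOL-Combinatorics.Combinatorics"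
begin

section \<open>Abelian groups by generators and relations, tensor products\<close>

text \<open>Abelian groups are written multiplicatively, as in \<^theory>\<open>HOL-Algebra.Group\<close>.\<close>

definition relation_subgroup :: "'a set \<Rightarrow> ('a \<Rightarrow>\<^sub>0 int) set \<Rightarrow> ('a \<Rightarrow>\<^sub>0 int) set" where
  "relation_subgroup S R = generate (free_Abelian_group S) R"

definition presented_group :: "'a set \<Rightarrow> ('a \<Rightarrow>\<^sub>0 int) set \<Rightarrow> ('a \<Rightarrow>\<^sub>0 int) set monoid" where
  "presented_group S R = free_Abelian_group S Mod relation_subgroup S R"

definition presented_gen :: "'a set \<Rightarrow> ('a \<Rightarrow>\<^sub>0 int) set \<Rightarrow> 'a \<Rightarrow> ('a \<Rightarrow>\<^sub>0 int) set" where
  "presented_gen S R s = relation_subgroup S R #>\<^bsub>free_Abelian_group S\<^esub> frag_of s"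

definition tensor_relators :: "'a monoid \<Rightarrow> 'b monoid \<Rightarrow> ('a \<times> 'b \<Rightarrow>\<^sub>0 int) set" where
  "tensor_relators G H =
     {frag_of (x \<otimes>\<^bsub>G\<^esub> x', y) - frag_of (x, y) - frag_of (x', y) | x x' y.
        x \<in> carrier G \<and> x' \<in> carrier G \<and> y \<in> carrier H} \<union>
     {frag_of (x, y \<otimes>\<^bsub>H\<^esub> y') - frag_of (x, y) - frag_of (x, y') | x y y'.
        x \<in> carrier G \<and> y \<in> carrier H \<and> y' \<in> carrier H}"

text \<open>The tensor product over the integers of two abelian groups.\<close>

definition tensor_product :: "'a monoid \<Rightarrow> 'b monoid \<Rightarrow> ('a \<times> 'b \<Rightarrow>\<^sub>0 int) set monoid" where
  "tensor_product G H = presented_group (carrier G \<times> carrier H) (tensor_relators G H)"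

definition pure_tensor :: "'a monoid \<Rightarrow> 'b monoid \<Rightarrow> 'a \<Rightarrow> 'b \<Rightarrow> ('a \<times> 'b \<Rightarrow>\<^sub>0 int) set" where
  "pure_tensor G H x y = presented_gen (carrier G \<times> carrier H) (tensor_relators G H) (x, y)"

text \<open>
  The homomorphism from a tensor product to \<open>K\<close> that sends the pure tensor of \<open>x\<close> and \<open>y\<close>
  to \<open>b x y\<close>, for \<open>b\<close> biadditive. The product below then does not depend on the representative
  \<open>c\<close> of the coset \<open>T\<close>.
\<close>

definition tensor_lift :: "'c monoid \<Rightarrow> ('a \<Rightarrow> 'b \<Rightarrow> 'c) \<Rightarrow> ('a \<times> 'b \<Rightarrow>\<^sub>0 int) set \<Rightarrow> 'c" where
  "tensor_lift K b T =
     the_elem ((\<lambda>c. finprod K (\<lambda>(x, y). b x y [^]\<^bsub>K\<^esub> (Poly_Mapping.lookup c (x, y) :: int))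
                      (Poly_Mapping.keys c)) ` T)"

definition tensor_map ::
  "'c monoid \<Rightarrow> 'd monoid \<Rightarrow> ('a \<Rightarrow> 'c) \<Rightarrow> ('b \<Rightarrow> 'd) \<Rightarrow>
     ('a \<times> 'b \<Rightarrow>\<^sub>0 int) set \<Rightarrow> ('c \<times> 'd \<Rightarrow>\<^sub>0 int) set" where
  "tensor_map G H f g =
     tensor_lift (tensor_product G H) (\<lambda>x y. pure_tensor G H (f x) (g y))"

text \<open>The canonical map from \<open>(G \<otimes> H) \<otimes> K\<close> to \<open>G \<otimes> (H \<otimes> K)\<close>.\<close>

definition tensor_assoc ::
  "'a monoid \<Rightarrow> 'b monoid \<Rightarrow> 'c monoid \<Rightarrow>
     (('a \<times> 'b \<Rightarrow>\<^sub>0 int) set \<times> 'c \<Rightarrow>\<^sub>0 int) set \<Rightarrow>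
     ('a \<times> ('b \<times> 'c \<Rightarrow>\<^sub>0 int) set \<Rightarrow>\<^sub>0 int) set" where
  "tensor_assoc G H K =
     tensor_lift (tensor_product G (tensor_product H K))
       (\<lambda>t z. tensor_lift (tensor_product G (tensor_product H K))
          (\<lambda>x y. pure_tensor G (tensor_product H K) x (pure_tensor H K y z)) t)"

definition tensor_unit_left :: "'a monoid \<Rightarrow> (int \<times> 'a \<Rightarrow>\<^sub>0 int) set \<Rightarrow> 'a" where
  "tensor_unit_left G = tensor_lift G (\<lambda>n x. x [^]\<^bsub>G\<^esub> n)"

definition tensor_unit_right :: "'a monoid \<Rightarrow> ('a \<times> int \<Rightarrow>\<^sub>0 int) set \<Rightarrow> 'a" where
  "tensor_unit_right G = tensor_lift G (\<lambda>x n. x [^]\<^bsub>G\<^esub> n)"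


section \<open>Graded abelian groups and graded coalgebras\<close>

definition homogeneous_decomposition ::
  "'a monoid \<Rightarrow> (int \<Rightarrow> 'a set) \<Rightarrow> 'a \<Rightarrow> (int \<Rightarrow> 'a) \<Rightarrow> bool" where
  "homogeneous_decomposition G A x c \<longleftrightarrow>
     (\<forall>n. c n \<in> A n) \<and> finite {n. c n \<noteq> \<one>\<^bsub>G\<^esub>} \<and> x = finprod G c {n. c n \<noteq> \<one>\<^bsub>G\<^esub>}"

definition homogeneous_component :: "'a monoid \<Rightarrow> (int \<Rightarrow> 'a set) \<Rightarrow> 'a \<Rightarrow> int \<Rightarrow> 'a" where
  "homogeneous_component G A x = (THE c. homogeneous_decomposition G A x c)"

locale graded_abelian_group = comm_group G
  for G :: "'a monoid" (structure) +
  fixes A :: "int \<Rightarrow> 'a set"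
  assumes subgroup_homogeneous: "subgroup (A n) G"
    and unique_decomposition:
      "x \<in> carrier G \<Longrightarrow> \<exists>!c. homogeneous_decomposition G A x c"

definition tensor_grading ::
  "'a monoid \<Rightarrow> (int \<Rightarrow> 'a set) \<Rightarrow> 'b monoid \<Rightarrow> (int \<Rightarrow> 'b set) \<Rightarrow>
     int \<Rightarrow> ('a \<times> 'b \<Rightarrow>\<^sub>0 int) set set" where
  "tensor_grading G A H B n =
     generate (tensor_product G H)
       {pure_tensor G H u v | u v p q. u \<in> A p \<and> v \<in> B q \<and> p + q = n}"

text \<open>
  The bilinear extension to all of \<open>G \<otimes> G\<close> of \<open>u \<otimes> v \<mapsto> (-1) ^ (p * q) v \<otimes> u\<close>
  for \<open>u\<close> of degree \<open>p\<close> and \<open>v\<close> of degree \<open>q\<close>.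
\<close>

definition koszul_twist ::
  "'a monoid \<Rightarrow> (int \<Rightarrow> 'a set) \<Rightarrow> ('a \<times> 'a \<Rightarrow>\<^sub>0 int) set \<Rightarrow> ('a \<times> 'a \<Rightarrow>\<^sub>0 int) set" where
  "koszul_twist G A =
     tensor_lift (tensor_product G G)
       (\<lambda>u v. let cu = homogeneous_component G A u; cv = homogeneous_component G A v in
          finprod (tensor_product G G)
            (\<lambda>(p, q). pure_tensor G G (cv q) (cu p)
               [^]\<^bsub>tensor_product G G\<^esub> (if even (p * q) then 1 else - 1 :: int))
            ({p. cu p \<noteq> \<one>\<^bsub>G\<^esub>} \<times> {q. cv q \<noteq> \<one>\<^bsub>G\<^esub>}))"

text \<open>The ground ring \<open>integer_group\<close> is concentrated in degree \<open>0\<close>.\<close>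

locale cocommutative_graded_coalgebra = graded_abelian_group G A
  for G :: "'a monoid" (structure) and A :: "int \<Rightarrow> 'a set" +
  fixes \<Delta> :: "'a \<Rightarrow> ('a \<times> 'a \<Rightarrow>\<^sub>0 int) set"
    and \<epsilon> :: "'a \<Rightarrow> int"
  assumes comult_hom: "\<Delta> \<in> hom G (tensor_product G G)"
    and comult_degree: "x \<in> A n \<Longrightarrow> \<Delta> x \<in> tensor_grading G A G A n"
    and counit_hom: "\<epsilon> \<in> hom G integer_group"
    and counit_degree: "x \<in> A n \<Longrightarrow> n \<noteq> 0 \<Longrightarrow> \<epsilon> x = 0"
    and coassociative: "x \<in> carrier G \<Longrightarrow>
      tensor_assoc G G G (tensor_map (tensor_product G G) G \<Delta> id (\<Delta> x)) =
      tensor_map G (tensor_product G G) id \<Delta> (\<Delta> x)"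
    and counital_left: "x \<in> carrier G \<Longrightarrow>
      tensor_unit_left G (tensor_map integer_group G \<epsilon> id (\<Delta> x)) = x"
    and counital_right: "x \<in> carrier G \<Longrightarrow>
      tensor_unit_right G (tensor_map G integer_group id \<epsilon> (\<Delta> x)) = x"
    and cocommutative: "x \<in> carrier G \<Longrightarrow> koszul_twist G A (\<Delta> x) = \<Delta> x"


section \<open>Rooted forests\<close>

text \<open>
  The vertex set \<open>I\<close> is kept as a parameter; an edge is a two-element subset of \<open>I\<close>.
\<close>

datatype 'a forest = Forest (edges: "'a set set") (roots: "'a set")

definition simple_path :: "'a set set \<Rightarrow> 'a list \<Rightarrow> bool" where
  "simple_path E p \<longleftrightarrow> p \<noteq> [] \<and> distinct p \<and> successively (\<lambda>u v. {u, v} \<in> E) p"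

definition acyclic_edges :: "'a set set \<Rightarrow> bool" where
  "acyclic_edges E \<longleftrightarrow> \<not> (\<exists>p. simple_path E p \<and> length p \<ge> 3 \<and> {last p, hd p} \<in> E)"

text \<open>The vertex sets of the connected components.\<close>

definition forest_partition :: "'a set \<Rightarrow> 'a forest \<Rightarrow> 'a set set" where
  "forest_partition I F = I // {(u, v). {u, v} \<in> edges F}\<^sup>*"

definition forest_on :: "'a set \<Rightarrow> 'a forest \<Rightarrow> bool" where
  "forest_on I F \<longleftrightarrow>
     (\<forall>e\<in>edges F. e \<subseteq> I \<and> card e = 2) \<and> acyclic_edges (edges F) \<and>
     roots F \<subseteq> I \<and> (\<forall>P\<in>forest_partition I F. \<exists>!r. r \<in> P \<and> r \<in> roots F)"

definition nodes :: "'a set \<Rightarrow> 'a forest \<Rightarrow> 'a set" where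
  "nodes I F = I - roots F"

text \<open>\<open>i\<close> lies on the path from \<open>j\<close> to the root of the tree of \<open>j\<close>.\<close>

definition forest_le :: "'a forest \<Rightarrow> 'a \<Rightarrow> 'a \<Rightarrow> bool" where
  "forest_le F i j \<longleftrightarrow>
     (\<exists>p. simple_path (edges F) p \<and> hd p = j \<and> last p \<in> roots F \<and> i \<in> set p)"

definition subforest :: "'a set \<Rightarrow> 'a forest \<Rightarrow> 'a forest \<Rightarrow> bool" where
  "subforest I F' F \<longleftrightarrow>
     (\<forall>P'\<in>forest_partition I F'.
        (\<exists>P\<in>forest_partition I F. P' \<subseteq> P) \<and>
        (\<forall>i\<in>P'. \<forall>j\<in>P'. forest_le F' i j \<longleftrightarrow> forest_le F i j))"

text \<open>The set of terms of the formal sum \<open>\<gamma>(F,N)\<close>, all of whose coefficients are \<open>1\<close>.\<close>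

definition gamma_terms :: "'a set \<Rightarrow> 'a forest \<Rightarrow> 'a set \<Rightarrow> 'a forest set" where
  "gamma_terms I F N = {F'. forest_on I F' \<and> subforest I F' F \<and> nodes I F' = N}"


section \<open>Orientations\<close>

text \<open>
  A maximal exterior product of a finite set \<open>S\<close> is a class of signed orderings \<open>(s, xs)\<close> of \<open>S\<close>,
  standing for \<open>s\<close> times the wedge product of the entries of \<open>xs\<close>; reordering the entries
  costs the sign of the permutation.
\<close>

definition signed_orderings :: "'b set \<Rightarrow> (int \<times> 'b list) set" where
  "signed_orderings S = {1, - 1} \<times> permutations_of_set S"

definition wedge_rel :: "'b set \<Rightarrow> ((int \<times> 'b list) \<times> (int \<times> 'b list)) set" where
  "wedge_rel S =
     {((s, xs), (t, ys)). (s, xs) \<in> signed_orderings S \<and> (t, ys) \<in> signed_orderings S \<and>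
        (\<exists>\<pi>. \<pi> permutes {..<length xs} \<and> ys = permute_list \<pi> xs \<and> t = sign \<pi> * s)}"

definition maximal_exterior_products :: "'b set \<Rightarrow> (int \<times> 'b list) set set" where
  "maximal_exterior_products S = signed_orderings S // wedge_rel S"

definition wedge :: "int \<Rightarrow> 'b list \<Rightarrow> (int \<times> 'b list) set" where
  "wedge s xs = wedge_rel (set xs) `` {(s, xs)}"

definition neg_orientation :: "(int \<times> 'b list) set \<Rightarrow> (int \<times> 'b list) set" where
  "neg_orientation o1 = (\<lambda>(s, xs). (- s, xs)) ` o1"

text \<open>
  Orientations always use \<open>Aux\<close> for the auxiliary element. The letters \<open>Aux1\<close>, \<open>Sep\<close>, \<open>Aux2\<close>
  stand for \<open>R\<^sub>1\<close>, \<open>r\<close>, \<open>R\<^sub>2\<close> and occur only in the condition \<open>o = o\<^sub>1 \<and> r \<and> o\<^sub>2\<close> modulo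
  \<open>R = R\<^sub>1 \<and> r \<and> R\<^sub>2\<close>.
\<close>

datatype 'a letter = Node 'a | Aux | Aux1 | Sep | Aux2

type_synonym 'a orientation = "(int \<times> 'a letter list) set"

definition orientations :: "'a set \<Rightarrow> 'a orientation set" where
  "orientations N = maximal_exterior_products (insert Aux (Node ` N))"

definition expand_aux :: "'a letter \<Rightarrow> 'a letter list" where
  "expand_aux l = (if l = Aux then [Aux1, Sep, Aux2] else [l])"

definition rename_aux :: "'a letter \<Rightarrow> 'a letter \<Rightarrow> 'a letter" where
  "rename_aux R' l = (if l = Aux then R' else l)"

definition compatible_orientations ::
  "'a orientation \<Rightarrow> 'a orientation \<Rightarrow> 'a orientation \<Rightarrow> bool" where
  "compatible_orientations ori ori1 ori2 \<longleftrightarrow>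
     (\<exists>s xs s1 xs1 s2 xs2. (s, xs) \<in> ori \<and> (s1, xs1) \<in> ori1 \<and> (s2, xs2) \<in> ori2 \<and>
        wedge s (concat (map expand_aux xs)) =
        wedge (s1 * s2) (map (rename_aux Aux1) xs1 @ [Sep] @ map (rename_aux Aux2) xs2))"


section \<open>The graded abelian group of oriented forests and its coproduct\<close>

definition oriented_forests :: "'a set \<Rightarrow> ('a orientation \<times> 'a forest) set" where
  "oriented_forests I = {(ori, F). forest_on I F \<and> ori \<in> orientations (nodes I F)}"

definition forest_relators :: "'a set \<Rightarrow> ('a orientation \<times> 'a forest \<Rightarrow>\<^sub>0 int) set" where
  "forest_relators I =
     {frag_of (neg_orientation ori, F) - (- frag_of (ori, F)) | ori F.
        (ori, F) \<in> oriented_forests I}"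

type_synonym 'a forest_element = "('a orientation \<times> 'a forest \<Rightarrow>\<^sub>0 int) set"

definition forest_group :: "'a set \<Rightarrow> 'a forest_element monoid" where
  "forest_group I = presented_group (oriented_forests I) (forest_relators I)"

definition forest_gen :: "'a set \<Rightarrow> 'a orientation \<Rightarrow> 'a forest \<Rightarrow> 'a forest_element" where
  "forest_gen I ori F = presented_gen (oriented_forests I) (forest_relators I) (ori, F)"

definition forest_grading :: "'a set \<Rightarrow> int \<Rightarrow> 'a forest_element set" where
  "forest_grading I n =
     generate (forest_group I)
       {forest_gen I ori F | ori F. (ori, F) \<in> oriented_forests I \<and> int (card (nodes I F)) = n}"

definition oriented_gamma ::
  "'a set \<Rightarrow> 'a orientation \<Rightarrow> 'a forest \<Rightarrow> 'a set \<Rightarrow> 'a forest_element" where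
  "oriented_gamma I ori F N = finprod (forest_group I) (forest_gen I ori) (gamma_terms I F N)"

text \<open>
  The functions \<open>O1\<close> and \<open>O2\<close> choose the orientations \<open>o\<^sub>1\<close>, \<open>o\<^sub>2\<close> in the summand of \<open>(N1, N2)\<close>;
  the formula is required for every admissible choice.
\<close>

definition forest_coproduct ::
  "'a set \<Rightarrow> ('a forest_element \<Rightarrow> ('a forest_element \<times> 'a forest_element \<Rightarrow>\<^sub>0 int) set)
     \<Rightarrow> bool" where
  "forest_coproduct I \<Delta> \<longleftrightarrow>
     \<Delta> \<in> hom (forest_group I) (tensor_product (forest_group I) (forest_group I)) \<and>
     (\<forall>ori F O1 O2.
        (ori, F) \<in> oriented_forests I \<and>
        (\<forall>N1 N2. N1 \<union> N2 = nodes I F \<and> N1 \<inter> N2 = {} \<longrightarrow>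
           O1 (N1, N2) \<in> orientations N1 \<and> O2 (N1, N2) \<in> orientations N2 \<and>
           compatible_orientations ori (O1 (N1, N2)) (O2 (N1, N2))) \<longrightarrow>
        \<Delta> (forest_gen I ori F) =
          finprod (tensor_product (forest_group I) (forest_group I))
            (\<lambda>(N1, N2). pure_tensor (forest_group I) (forest_group I)
               (oriented_gamma I (O1 (N1, N2)) F N1) (oriented_gamma I (O2 (N1, N2)) F N2))
            {(N1, N2). N1 \<union> N2 = nodes I F \<and> N1 \<inter> N2 = {}})"

end

theory Submission
  imports Defs
begin

text \<open>
  A subforest of \<open>F\<close> with node set \<open>N\<close> is the same as a map \<open>\<rho>\<close> that fixes the complement of \<open>N\<close>
  and sends each element of \<open>N\<close> to a vertex outside \<open>N\<close> that lies strictly below it for the order of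
  \<open>F\<close>, namely to its new root. For disjoint \<open>M\<^sub>1\<close>, \<open>M\<^sub>2\<close>, iterating two such maps gives, for all terms \<open>F\<^sub>1\<close> of
  \<open>\<gamma>(F,M\<^sub>1)\<close> and \<open>F\<^sub>2\<close> of \<open>\<gamma>(F,M\<^sub>2)\<close>, exactly one term \<open>F'\<close> of \<open>\<gamma>(F,M\<^sub>1 \<union> M\<^sub>2)\<close> that contains both. Hence
  the sum of the tensors \<open>\<gamma>(F',M\<^sub>1) \<otimes> \<gamma>(F',M\<^sub>2)\<close> over the terms \<open>F'\<close> of \<open>\<gamma>(F,M\<^sub>1 \<union> M\<^sub>2)\<close> is
  \<open>\<gamma>(F,M\<^sub>1) \<otimes> \<gamma>(F,M\<^sub>2)\<close>: on the elements \<open>\<gamma>(F,N)\<close> the coproduct is the shuffle coproduct of an exterior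
  algebra. Once an enumeration of every node set is chosen, forests form a basis, and all signs are
  shuffle signs, whose cocycle and symmetry identities give coassociativity and cocommutativity.
\<close>

section \<open>Signs of reorderings\<close>

text \<open>Relative to the enumerations, compatibility of orientations fixes only the product of
  the signs of \<open>o1\<close> and \<open>o2\<close>. A tensor sees only that product, so all
  admissible choices agree. Replacing \<open>R\<close> by three letters is harmless because a block
  of odd length moves like one letter, and nodes pass the pair \<open>R1\<close>, \<open>r\<close>
  without a sign.

  The obstacle to coassociativity is that it applies \<open>\<Delta>\<close> to the factors
  \<open>\<gamma>(F,N)\<close>, sums of different forests, each with a formula of its own. The join
  brings them all back to the one forest \<open>F\<close>, and both iterates become sums over
  ordered triples of disjoint sets.

  The counit is the coefficient of the discrete forest. It works because
  \<open>\<gamma>(F,{})\<close> is the discrete forest and \<open>\<gamma>(F,N(F))\<close> is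
  \<open>F\<close>.

  Paths and cycles occur only in passing from forests to parent functions with a decreasing rank.
  Afterwards a forest is handled through its order, in which the vertices below a given one form a
  chain. That is what lets a choice of roots be filled in to a subforest: a node takes as parent the
  largest vertex strictly below it with the same new root.\<close>

lemma equiv_wedge_rel: "equiv (signed_orderings S) (wedge_rel S)"
proof (rule equivI)
  show "wedge_rel S \<subseteq> signed_orderings S \<times> signed_orderings S"
    by (auto simp: wedge_rel_def)
  show "refl_on (signed_orderings S) (wedge_rel S)"
    by (rule refl_onI) (auto simp: wedge_rel_def intro!: exI[of _ id] permutes_id)
  show "sym (wedge_rel S)"
  proof (rule symI)
    fix u v assume "(u, v) \<in> wedge_rel S"
    then obtain s xs \<pi> where u: "u = (s, xs)" "v = (sign \<pi> * s, permute_list \<pi> xs)"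
      and S: "u \<in> signed_orderings S" "v \<in> signed_orderings S" and p: "\<pi> permutes {..<length xs}"
      by (auto simp: wedge_rel_def)
    let ?q = "inv_into UNIV \<pi>"
    have "permute_list ?q (permute_list \<pi> xs) = xs"
      using permute_list_compose[OF permutes_inv[OF p], of \<pi>] permutes_inv_o(1)[OF p] by simp
    moreover have "sign ?q = sign \<pi>"
      using p by (intro sign_inverse permutes_imp_permutation) auto
    ultimately have "?q permutes {..<length (permute_list \<pi> xs)} \<and> xs = permute_list ?q (permute_list \<pi> xs)
        \<and> s = sign ?q * (sign \<pi> * s)"
      using permutes_inv[OF p] by simp
    then show "(v, u) \<in> wedge_rel S" using S unfolding u wedge_rel_def by blast
  qed
  show "trans (wedge_rel S)"
  proof (rule transI)
    fix u v w assume uv: "(u, v) \<in> wedge_rel S" and vw: "(v, w) \<in> wedge_rel S"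
    obtain s xs \<pi> where u: "u = (s, xs)" "v = (sign \<pi> * s, permute_list \<pi> xs)"
      and S: "u \<in> signed_orderings S" and p: "\<pi> permutes {..<length xs}"
      using uv by (auto simp: wedge_rel_def)
    obtain \<rho> where w: "w = (sign \<rho> * (sign \<pi> * s), permute_list \<rho> (permute_list \<pi> xs))"
      and S': "w \<in> signed_orderings S" and q: "\<rho> permutes {..<length xs}"
      using vw unfolding u by (auto simp: wedge_rel_def)
    have "sign (\<pi> \<circ> \<rho>) = sign \<pi> * sign \<rho>"
      using p q by (intro sign_compose permutes_imp_permutation) auto
    then have "w = (sign (\<pi> \<circ> \<rho>) * s, permute_list (\<pi> \<circ> \<rho>) xs)"
      using permute_list_compose[OF q, of \<pi>] w by simp
    then show "(u, w) \<in> wedge_rel S"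
      using S S' permutes_compose[OF q p] unfolding u wedge_rel_def by blast
  qed
qed

lemma signed_orderings_iff:
  "(s, xs) \<in> signed_orderings S \<longleftrightarrow> (s = 1 \<or> s = -1) \<and> set xs = S \<and> distinct xs"
  by (auto simp: signed_orderings_def permutations_of_set_def)

lemma wedge_eq_iff:
  assumes "set xs = set ys" "distinct xs" "distinct ys" "s \<in> {1, -1}" "t \<in> {1, -1}"
  shows "wedge s xs = wedge t ys \<longleftrightarrow> ((s, xs), (t, ys)) \<in> wedge_rel (set xs)"
proof -
  have "(s, xs) \<in> signed_orderings (set xs)" "(t, ys) \<in> signed_orderings (set xs)"
    using assms by (auto simp: signed_orderings_iff)
  from eq_equiv_class_iff[OF equiv_wedge_rel this] show ?thesis
    using assms(1) by (simp add: wedge_def)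
qed

text \<open>Degenerate words have empty classes, and an exchange of letters keeps a word degenerate.
  This is what makes \<open>wedge_swap\<close> and its consequences valid for all words and
  coefficients.\<close>

lemma wedge_empty: "\<not> distinct xs \<or> s \<notin> {1, -1} \<Longrightarrow> wedge s xs = {}"
  by (auto simp: wedge_def wedge_rel_def signed_orderings_iff)

lemma wedge_swap: "wedge s (us @ a # b # vs) = wedge (- s) (us @ b # a # vs)"
proof (cases "distinct (us @ a # b # vs) \<and> s \<in> {1, -1}")
  case True
  let ?xs = "us @ a # b # vs" and ?p = "Transposition.transpose (length us) (Suc (length us))"
  have p: "?p permutes {..<length ?xs}"
    by (rule permutes_swap_id) auto
  have "us @ b # a # vs = permute_list ?p ?xs"
  proof (rule nth_equalityI)
    fix i assume "i < length (us @ b # a # vs)"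
    then show "(us @ b # a # vs) ! i = permute_list ?p ?xs ! i"
      by (subst permute_list_nth[OF p])
        (auto simp: nth_append Transposition.transpose_def nth_Cons split: nat.splits)
  qed auto
  moreover have "- s = sign ?p * s"
    by (simp add: sign_swap_id)
  ultimately show ?thesis
    using True p
    by (subst wedge_eq_iff) (auto simp: wedge_rel_def signed_orderings_iff simp del: permute_list_map)
next
  case False
  then have "\<not> distinct (us @ b # a # vs) \<or> - s \<notin> {1, -1}" by auto
  with False show ?thesis by (metis wedge_empty)
qed

lemma wedge_move: "wedge s (us @ a # xs @ vs) = wedge ((-1) ^ length xs * s) (us @ xs @ a # vs)"
proof (induction xs arbitrary: us s)
  case (Cons x xs)
  have "wedge s (us @ a # (x # xs) @ vs) = wedge (- s) ((us @ [x]) @ a # xs @ vs)"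
    using wedge_swap[of s us a x] by simp
  then show ?case using Cons[of "- s" "us @ [x]"] by simp
qed simp

lemma wedge_move_block:
  "wedge s (us @ xs @ ys @ vs) = wedge ((-1) ^ (length xs * length ys) * s) (us @ ys @ xs @ vs)"
proof (induction xs arbitrary: us s)
  case (Cons x xs)
  have "wedge s (us @ (x # xs) @ ys @ vs)
      = wedge ((-1) ^ (length xs * length ys) * s) ((us @ [x]) @ ys @ xs @ vs)"
    using Cons[of s "us @ [x]"] by simp
  also have "\<dots> = wedge ((-1) ^ (length (x # xs) * length ys) * s) (us @ ys @ (x # xs) @ vs)"
    using wedge_move[of _ us x ys "xs @ vs"] by (simp add: power_add ac_simps)
  finally show ?case .
qed simp

text \<open>A reordering that fixes a word of distinct letters is the identity, so its sign cannot
  be \<open>-1\<close>. Hence signs can be read off from equations between classes.\<close>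

lemma wedge_neq:
  assumes "distinct xs" shows "wedge 1 xs \<noteq> wedge (-1) xs"
proof
  assume "wedge 1 xs = wedge (-1) xs"
  then obtain \<pi> where p: "\<pi> permutes {..<length xs}" and e: "xs = permute_list \<pi> xs"
    and s: "sign \<pi> = -1"
    using assms by (subst (asm) wedge_eq_iff) (auto simp: wedge_rel_def)
  have "\<pi> i = i" for i
  proof (cases "i < length xs")
    case True
    then have "xs ! i = xs ! \<pi> i" using permute_list_nth[OF p] e by metis
    then show ?thesis using True assms nth_eq_iff_index_eq permutes_in_image[OF p] by fastforce
  qed (use p in \<open>auto simp: permutes_def\<close>)
  then have "\<pi> = id" by auto
  with s show False by simp
qed

lemma wedge_sign_inject:
  assumes "distinct xs" "s \<in> {1, -1}" "t \<in> {1, -1}" "wedge s xs = wedge t xs"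
  shows "s = t"
  using assms wedge_neq[of xs] by auto

text \<open>
  A word of odd length behaves like a single letter under exchanges. This covers at once the
  substitution of the three letters \<open>Aux1\<close>, \<open>Sep\<close>, \<open>Aux2\<close> for \<open>Aux\<close> and the renamings.
\<close>

lemma wedge_subst_aux:
  fixes \<phi> :: "'b \<Rightarrow> 'c list"
  assumes "mset xs = mset ys" "\<And>x. x \<in> set xs \<Longrightarrow> odd (length (\<phi> x))"
  shows "\<exists>t\<in>{1, -1}.
    (\<forall>s us vs. wedge s (us @ xs @ vs) = wedge (t * s) (us @ ys @ vs)) \<and>
    (\<forall>s us vs. wedge s (us @ concat (map \<phi> xs) @ vs) = wedge (t * s) (us @ concat (map \<phi> ys) @ vs))"
  using assms
proof (induction ys arbitrary: xs)
  case (Cons y ys)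
  then have "y \<in> set xs" by (metis list.set_intros(1) set_mset_mset)
  then obtain as bs where xs: "xs = as @ y # bs" by (meson split_list)
  with Cons.prems have "mset (as @ bs) = mset ys" by simp
  moreover have "odd (length (\<phi> x))" if "x \<in> set (as @ bs)" for x
    using Cons.prems(2) that xs by auto
  ultimately obtain t where t: "t \<in> {1, -1}"
    "\<And>s us vs. wedge s (us @ (as @ bs) @ vs) = wedge (t * s) (us @ ys @ vs)"
    "\<And>s us vs. wedge s (us @ concat (map \<phi> (as @ bs)) @ vs)
      = wedge (t * s) (us @ concat (map \<phi> ys) @ vs)"
    using Cons.IH[of "as @ bs"] by blast
  let ?u = "(-1) ^ length as * t"
  \<comment> \<open>Only parities of lengths enter. A concatenation of odd words has the parity of
    their number, so moving the image of \<open>y\<close> to the front costs the same sign as moving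
    \<open>y\<close>.\<close>
  have par: "(-1 :: int) ^ (length (concat (map \<phi> as)) * length (\<phi> y)) = (-1) ^ length as"
  proof -
    have "odd (length (concat (map \<phi> as))) \<longleftrightarrow> odd (length as)"
      using Cons.prems(2) unfolding xs by (induction as) auto
    moreover have "odd (length (\<phi> y))" using Cons.prems(2) xs by auto
    ultimately show ?thesis by (auto simp: uminus_power_if)
  qed
  have "wedge s (us @ xs @ vs) = wedge (?u * s) (us @ (y # ys) @ vs)" for s us vs
    using wedge_move_block[of s us as "[y]" "bs @ vs"] t(2)[of _ "us @ [y]" vs] xs
    by (simp add: ac_simps)
  moreover have "wedge s (us @ concat (map \<phi> xs) @ vs)
      = wedge (?u * s) (us @ concat (map \<phi> (y # ys)) @ vs)" for s us vs
    using wedge_move_block[of s us "concat (map \<phi> as)" "\<phi> y" "concat (map \<phi> bs) @ vs"]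
      t(3)[of _ "us @ \<phi> y" vs] xs par
    by (simp add: ac_simps)
  moreover have "?u \<in> {1, -1}" using t(1) by (auto simp: uminus_power_if)
  ultimately show ?case by blast
qed auto

text \<open>Comparing classes avoids naming a permutation; \<open>reorder_sign_unique\<close>
  recovers the sign from any equation between two wedge products.\<close>

definition reorder_sign :: "'b list \<Rightarrow> 'b list \<Rightarrow> int" where
  "reorder_sign xs ys = (if wedge 1 xs = wedge 1 ys then 1 else -1)"

lemma reorder_sign_cases: "reorder_sign xs ys \<in> {1, -1}"
  by (simp add: reorder_sign_def)

lemma mset_eq_distinct: "distinct xs \<Longrightarrow> distinct ys \<Longrightarrow> set xs = set ys \<Longrightarrow> mset xs = mset ys"
  by (simp add: set_eq_iff_mset_eq_distinct)

text \<open>The sign supplied by \<open>wedge_subst_aux\<close> is the same for the words and for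
  their substitutes, and the empty context identifies it as the sign of the words.\<close>

lemma wedge_subst:
  fixes \<phi> :: "'b \<Rightarrow> 'c list"
  assumes "distinct xs" "distinct ys" "set xs = set ys"
    and "\<And>x. x \<in> set xs \<Longrightarrow> odd (length (\<phi> x))"
  shows "wedge s (us @ concat (map \<phi> xs) @ vs)
    = wedge (reorder_sign xs ys * s) (us @ concat (map \<phi> ys) @ vs)"
proof -
  obtain t where t: "t \<in> {1, -1}"
    "\<And>s us vs. wedge s (us @ xs @ vs) = wedge (t * s) (us @ ys @ vs)"
    "\<And>s us vs. wedge s (us @ concat (map \<phi> xs) @ vs) = wedge (t * s) (us @ concat (map \<phi> ys) @ vs)"
    using wedge_subst_aux[of xs ys \<phi>, OF mset_eq_distinct] assms by blast
  have "wedge 1 xs = wedge t ys" using t(2)[of 1 "[]" "[]"] by simp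
  then have "t = reorder_sign xs ys"
    using t(1) wedge_neq[OF assms(2)] by (auto simp: reorder_sign_def)
  then show ?thesis using t(3) by simp
qed

lemma wedge_reorder:
  assumes "distinct xs" "distinct ys" "set xs = set ys"
  shows "wedge s (us @ xs @ vs) = wedge (reorder_sign xs ys * s) (us @ ys @ vs)"
  using wedge_subst[of xs ys "\<lambda>x. [x]" s us vs] assms by simp

lemma reorder_sign_unique:
  assumes "distinct ys" "t \<in> {1, -1}" "wedge 1 xs = wedge t ys"
  shows "reorder_sign xs ys = t"
  using assms wedge_neq[of ys] by (auto simp: reorder_sign_def)

lemma reorder_sign_refl [simp]: "reorder_sign xs xs = 1"
  by (simp add: reorder_sign_def)

lemma reorder_sign_trans:
  assumes "distinct xs" "distinct ys" "distinct zs" "set xs = set ys" "set ys = set zs"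
  shows "reorder_sign xs ys * reorder_sign ys zs = reorder_sign xs zs"
proof -
  have "wedge 1 xs = wedge (reorder_sign ys zs * reorder_sign xs ys) zs"
    using wedge_reorder[of xs ys 1 "[]" "[]"] wedge_reorder[of ys zs _ "[]" "[]"] assms by simp
  from reorder_sign_unique[OF _ _ this] assms show ?thesis
    using reorder_sign_cases[of xs ys] reorder_sign_cases[of ys zs] by auto
qed

lemma reorder_sign_context:
  assumes "distinct xs" "distinct ys" "set xs = set ys" "distinct (us @ ys @ vs)"
  shows "reorder_sign (us @ xs @ vs) (us @ ys @ vs) = reorder_sign xs ys"
  by (rule reorder_sign_unique[OF assms(4) reorder_sign_cases])
    (use wedge_reorder[OF assms(1-3), of 1] in simp)

lemma reorder_sign_exchange:
  assumes "distinct (xs @ ys)"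
  shows "reorder_sign (xs @ ys) (ys @ xs) = (-1) ^ (length xs * length ys)"
  by (rule reorder_sign_unique)
    (use assms wedge_move_block[of 1 "[]" xs ys "[]"] in \<open>auto simp: uminus_power_if\<close>)

section \<open>Listings of finite sets and shuffle signs\<close>

definition enum :: "'b set \<Rightarrow> 'b list" where
  "enum N = (SOME xs. set xs = N \<and> distinct xs)"

lemma enum: "finite N \<Longrightarrow> set (enum N) = N \<and> distinct (enum N)"
  unfolding enum_def by (rule someI_ex) (rule finite_distinct_list)

lemma enum_empty [simp]: "enum {} = []"
  using enum[of "{}"] by auto

lemma length_enum: "finite N \<Longrightarrow> length (enum N) = card N"
  using enum distinct_card by metis

text \<open>A structure constant of the exterior algebra: with one basis element per finite set,
  given by its listing, the product for disjoint \<open>M\<close> and \<open>N\<close> is this sign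
  times the basis element of \<open>M \<union> N\<close>. The laws below express associativity and
  graded commutativity.\<close>

definition shuffle_sign :: "'b set \<Rightarrow> 'b set \<Rightarrow> int" where
  "shuffle_sign M N = reorder_sign (enum M @ enum N) (enum (M \<union> N))"

lemma shuffle_sign_cases: "shuffle_sign M N \<in> {1, -1}"
  unfolding shuffle_sign_def by (rule reorder_sign_cases)

lemma shuffle_sign_empty [simp]: "shuffle_sign {} N = 1" "shuffle_sign N {} = 1"
  by (simp_all add: shuffle_sign_def)

text \<open>Both sides are the sign that carries the concatenation of the three listings to the
  listing of the union; they differ only in which two neighbours are merged first.\<close>

lemma shuffle_sign_assoc:
  assumes fin: "finite L" "finite M" "finite N" and dis: "L \<inter> M = {}" "L \<inter> N = {}" "M \<inter> N = {}"
  shows "shuffle_sign L M * shuffle_sign (L \<union> M) N = shuffle_sign M N * shuffle_sign L (M \<union> N)"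
proof -
  let ?t = "enum L @ enum M @ enum N" and ?e = "enum (L \<union> M \<union> N)"
  have LMN: "L \<union> (M \<union> N) = L \<union> M \<union> N" by auto
  have e: "set (enum L) = L" "set (enum M) = M" "set (enum N) = N"
      "set (enum (L \<union> M)) = L \<union> M" "set (enum (M \<union> N)) = M \<union> N" "set ?e = L \<union> M \<union> N"
      "distinct (enum L)" "distinct (enum M)" "distinct (enum N)"
      "distinct (enum (L \<union> M))" "distinct (enum (M \<union> N))" "distinct ?e"
    using enum fin by (metis finite_UnI)+
  have "shuffle_sign L M = reorder_sign ?t (enum (L \<union> M) @ enum N)"
    using reorder_sign_context[of "enum L @ enum M" "enum (L \<union> M)" "[]" "enum N"] e dis
    by (auto simp: shuffle_sign_def Int_Un_distrib Int_Un_distrib2)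
  then have "shuffle_sign L M * shuffle_sign (L \<union> M) N = reorder_sign ?t ?e"
    using reorder_sign_trans[of ?t "enum (L \<union> M) @ enum N" ?e] e dis
    by (auto simp: shuffle_sign_def Int_Un_distrib Int_Un_distrib2)
  moreover have "shuffle_sign M N = reorder_sign ?t (enum L @ enum (M \<union> N))"
    using reorder_sign_context[of "enum M @ enum N" "enum (M \<union> N)" "enum L" "[]"] e dis
    by (auto simp: shuffle_sign_def Int_Un_distrib Int_Un_distrib2)
  then have "shuffle_sign M N * shuffle_sign L (M \<union> N) = reorder_sign ?t ?e"
    using reorder_sign_trans[of ?t "enum L @ enum (M \<union> N)" ?e] e dis LMN
    by (auto simp: shuffle_sign_def Int_Un_distrib Int_Un_distrib2)
  ultimately show ?thesis by simp
qed

lemma shuffle_sign_commute: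
  assumes "finite M" "finite N" "M \<inter> N = {}"
  shows "shuffle_sign M N = (-1) ^ (card M * card N) * shuffle_sign N M"
proof -
  have "reorder_sign (enum M @ enum N) (enum N @ enum M) * reorder_sign (enum N @ enum M) (enum (M \<union> N))
      = reorder_sign (enum M @ enum N) (enum (M \<union> N))"
    using assms enum by (intro reorder_sign_trans) (auto simp: enum Un_commute)
  moreover have "reorder_sign (enum M @ enum N) (enum N @ enum M) = (-1) ^ (card M * card N)"
    using reorder_sign_exchange[of "enum M" "enum N"] assms enum[of M] enum[of N]
    by (auto simp: length_enum)
  ultimately show ?thesis by (simp add: shuffle_sign_def Un_commute)
qed

section \<open>Orientations relative to enumerations\<close>

text \<open>Keeping \<open>Aux\<close> last gives the normal form of an orientation as a product of
  nodes followed by the auxiliary element; what remains of the orientation is the sign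
  \<open>s\<close>.\<close>

definition enum_orientation :: "int \<Rightarrow> 'a set \<Rightarrow> 'a orientation" where
  "enum_orientation s N = wedge s (map Node (enum N) @ [Aux])"

lemma inj_Node: "inj_on Node A"
  by (simp add: inj_on_def)

lemma enum_aux:
  assumes "finite N"
  shows "set (map Node (enum N) @ [Aux]) = insert Aux (Node ` N)" "distinct (map Node (enum N) @ [Aux])"
  using enum[OF assms] by (auto simp: distinct_map inj_Node)

lemma orientations_eq:
  assumes "finite N"
  shows "orientations N = {enum_orientation 1 N, enum_orientation (-1) N}"
proof -
  let ?S = "insert Aux (Node ` N)" and ?e = "map Node (enum N) @ [Aux]"
  note e = enum_aux[OF assms]
  have "wedge s ?e \<in> orientations N" if "s \<in> {1, -1}" for s
  proof -
    have "(s, ?e) \<in> signed_orderings ?S" using that e by (simp add: signed_orderings_iff)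
    then show ?thesis unfolding orientations_def maximal_exterior_products_def wedge_def e(1)
      by (rule quotientI)
  qed
  moreover have "ori \<in> {enum_orientation 1 N, enum_orientation (-1) N}" if ori: "ori \<in> orientations N" for ori
  proof -
    obtain s xs where x: "(s, xs) \<in> signed_orderings ?S" "ori = wedge_rel ?S `` {(s, xs)}"
      using ori unfolding orientations_def maximal_exterior_products_def by (auto elim!: quotientE)
    then have xs: "set xs = ?S" "distinct xs" "s \<in> {1, -1}" by (auto simp: signed_orderings_iff)
    then have "ori = wedge s xs" using x by (simp add: wedge_def)
    also have "\<dots> = wedge (reorder_sign xs ?e * s) ?e"
      using wedge_reorder[of xs ?e s "[]" "[]"] xs e by simp
    finally show ?thesis
      using xs(3) reorder_sign_cases[of xs ?e] by (auto simp: enum_orientation_def)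
  qed
  ultimately show ?thesis by (auto simp: enum_orientation_def)
qed

lemma enum_orientation_neq: "finite N \<Longrightarrow> enum_orientation 1 N \<noteq> enum_orientation (-1) N"
  unfolding enum_orientation_def by (rule wedge_neq) (rule enum_aux)

lemma neg_wedge: "neg_orientation (wedge s xs) = wedge (- s) xs"
proof -
  have *: "((- s, xs), (- t, ys)) \<in> wedge_rel S \<longleftrightarrow> ((s, xs), (t, ys)) \<in> wedge_rel S" for s t ys S
    by (auto simp: wedge_rel_def signed_orderings_iff)
  have "neg_orientation (wedge s xs) \<subseteq> wedge (- s) xs" for s
    using *[of s] by (auto simp: neg_orientation_def wedge_def)
  moreover from this[of "- s"] have "wedge (- s) xs \<subseteq> neg_orientation (wedge s xs)"
    by (force simp: neg_orientation_def image_iff)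
  ultimately show ?thesis by blast
qed

lemma neg_enum_orientation [simp]:
  "neg_orientation (enum_orientation s N) = enum_orientation (- s) N"
  by (simp add: enum_orientation_def neg_wedge)

lemma enum_orientation_mem:
  assumes "finite N" "s \<in> {1, -1}"
  shows "(t, xs) \<in> enum_orientation s N \<longleftrightarrow> t \<in> {1, -1} \<and> set xs = insert Aux (Node ` N) \<and> distinct xs \<and>
    wedge t xs = enum_orientation s N"
proof -
  let ?e = "map Node (enum N) @ [Aux]"
  note e = enum_aux[OF assms(1)]
  have "(t, xs) \<in> enum_orientation s N \<longleftrightarrow>
      (t, xs) \<in> signed_orderings (set ?e) \<and> ((s, ?e), (t, xs)) \<in> wedge_rel (set ?e)"
    by (auto simp: enum_orientation_def wedge_def wedge_rel_def)
  also have "\<dots> \<longleftrightarrow> (t, xs) \<in> signed_orderings (set ?e) \<and> wedge s ?e = wedge t xs"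
    using wedge_eq_iff[of ?e xs s t] e(2) assms(2) by (auto simp: signed_orderings_iff simp del: set_append set_map)
  also have "\<dots> \<longleftrightarrow> t \<in> {1, -1} \<and> set xs = insert Aux (Node ` N) \<and> distinct xs \<and> wedge t xs = wedge s ?e"
    unfolding signed_orderings_iff e(1) by blast
  finally show ?thesis unfolding enum_orientation_def .
qed

text \<open>Both words are brought to the nodes followed by \<open>Aux1\<close>, \<open>Sep\<close>,
  \<open>Aux2\<close>. The nodes of \<open>N\<close> pass the pair \<open>Aux1\<close>,
  \<open>Sep\<close> without a sign because its length is even, so only the shuffle of
  \<open>M\<close> and \<open>N\<close> contributes.\<close>

lemma compatible_enum_orientations_iff:
  assumes fin: "finite M" "finite N" and dis: "M \<inter> N = {}"
    and s: "s \<in> {1, -1}" "s1 \<in> {1, -1}" "s2 \<in> {1, -1}"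
  shows "compatible_orientations (enum_orientation s (M \<union> N)) (enum_orientation s1 M) (enum_orientation s2 N)
    \<longleftrightarrow> s = shuffle_sign M N * (s1 * s2)"
proof -
  let ?m = "enum M" and ?n = "enum N" and ?u = "enum (M \<union> N)"
  let ?e = "map Node ?u @ [Aux1, Sep, Aux2]"
  have finU: "finite (M \<union> N)" using fin by simp
  have en: "set ?m = M" "set ?n = N" "set ?u = M \<union> N" "distinct ?m" "distinct ?n" "distinct ?u"
    using enum fin by (metis finite_UnI)+
  \<comment> \<open>Compatibility asks for some representatives. This fact and the two after it show
    that neither side depends on which ones are taken.\<close>
  have left: "wedge t (concat (map expand_aux xs)) = wedge s ?e"
    if "(t, xs) \<in> enum_orientation s (M \<union> N)" for t xs
  proof -
    let ?f = "map Node ?u @ [Aux]"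
    have xs: "t \<in> {1, -1}" "set xs = set ?f" "distinct xs" "wedge t xs = wedge s ?f"
      using that unfolding enum_orientation_mem[OF finU s(1)] enum_aux(1)[OF finU]
      by (simp_all add: enum_orientation_def)
    note f = enum_aux(2)[OF finU]
    have "wedge t xs = wedge (reorder_sign xs ?f * t) ?f"
      using wedge_reorder[OF xs(3) f xs(2), of t "[]" "[]"] by simp
    moreover have "reorder_sign xs ?f * t \<in> {1, -1}" using xs(1) reorder_sign_cases[of xs ?f] by auto
    ultimately have "reorder_sign xs ?f * t = s"
      using wedge_sign_inject[OF f _ s(1)] xs(4) by metis
    moreover have "wedge t (concat (map expand_aux xs))
        = wedge (reorder_sign xs ?f * t) (concat (map expand_aux ?f))"
      using wedge_subst[OF xs(3) f xs(2), of expand_aux t "[]" "[]"] by (simp add: expand_aux_def)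
    moreover have "concat (map expand_aux ?f) = ?e"
      by (simp add: expand_aux_def comp_def)
    ultimately show ?thesis by simp
  qed
  have rename: "wedge r (us @ map (rename_aux R) xs @ vs)
      = wedge (t * (a * r)) (us @ (map Node (enum K) @ [R]) @ vs)"
    if "(t, xs) \<in> enum_orientation a K" "finite K" "a \<in> {1, -1}" for t a r xs K us vs and R :: "'a letter"
  proof -
    let ?f = "map Node (enum K) @ [Aux]"
    have xs: "t \<in> {1, -1}" "set xs = set ?f" "distinct xs" "wedge t xs = wedge a ?f"
      using that(1) unfolding enum_orientation_mem[OF that(2,3)] enum_aux(1)[OF that(2)]
      by (simp_all add: enum_orientation_def)
    note f = enum_aux(2)[OF that(2)]
    have "wedge t xs = wedge (reorder_sign xs ?f * t) ?f"
      using wedge_reorder[OF xs(3) f xs(2), of t "[]" "[]"] by simp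
    moreover have "reorder_sign xs ?f * t \<in> {1, -1}" using xs(1) reorder_sign_cases[of xs ?f] by auto
    ultimately have "reorder_sign xs ?f * t = a"
      using wedge_sign_inject[OF f _ that(3)] xs(4) by metis
    then have "reorder_sign xs ?f = t * a" using xs(1) by auto
    then show ?thesis
      using wedge_subst[OF xs(3) f xs(2), of "\<lambda>l. [rename_aux R l]" r us vs]
      by (simp add: rename_aux_def[abs_def] comp_def ac_simps)
  qed
  have right: "wedge (t1 * t2) (map (rename_aux Aux1) xs @ [Sep] @ map (rename_aux Aux2) ys)
      = wedge (shuffle_sign M N * (s1 * s2)) ?e"
    if x: "(t1, xs) \<in> enum_orientation s1 M" and y: "(t2, ys) \<in> enum_orientation s2 N" for t1 xs t2 ys
  proof -
    have t: "t1 \<in> {1, -1}" "t2 \<in> {1, -1}"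
      using x y enum_orientation_mem[OF fin(1) s(2)] enum_orientation_mem[OF fin(2) s(3)] by auto
    have "wedge (t1 * t2) (map (rename_aux Aux1) xs @ [Sep] @ map (rename_aux Aux2) ys)
        = wedge (t1 * (s1 * (t1 * t2))) ((map Node ?m @ [Aux1]) @ [Sep] @ map (rename_aux Aux2) ys)"
      using rename[OF x fin(1) s(2), of _ "[]"] by simp
    also have "\<dots> = wedge (s1 * t2) ((map Node ?m @ [Aux1, Sep]) @ map (rename_aux Aux2) ys @ [])"
      using t by auto
    also have "\<dots> = wedge (t2 * (s2 * (s1 * t2))) ((map Node ?m @ [Aux1, Sep]) @ (map Node ?n @ [Aux2]) @ [])"
      by (rule rename[OF y fin(2) s(3)])
    also have "\<dots> = wedge (s1 * s2) (map Node ?m @ [Aux1, Sep] @ map Node ?n @ [Aux2])"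
      using t by (auto simp: ac_simps)
    also have "\<dots> = wedge (s1 * s2) (map Node ?m @ map Node ?n @ [Aux1, Sep] @ [Aux2])"
      by (subst wedge_move_block) simp
    also have "\<dots> = wedge (s1 * s2) ([] @ concat (map (\<lambda>v. [Node v]) (?m @ ?n)) @ [Aux1, Sep, Aux2])"
      by simp
    also have "\<dots> = wedge (shuffle_sign M N * (s1 * s2)) ([] @ concat (map (\<lambda>v. [Node v]) ?u) @ [Aux1, Sep, Aux2])"
      unfolding shuffle_sign_def by (rule wedge_subst) (use en dis in auto)
    finally show ?thesis by simp
  qed
  have ne: "\<exists>t xs. (t, xs) \<in> enum_orientation a K" if "finite K" "a \<in> {1, -1}" for a and K :: "'a set"
    using that enum_aux[OF that(1)]
    by (intro exI[of _ a] exI[of _ "map Node (enum K) @ [Aux]"])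
      (simp add: enum_orientation_mem[OF that], simp add: enum_orientation_def)
  have "distinct ?e" using en by (auto simp: distinct_map inj_Node)
  then have inj: "wedge s ?e = wedge (shuffle_sign M N * (s1 * s2)) ?e \<longleftrightarrow> s = shuffle_sign M N * (s1 * s2)"
  proof -
    have "shuffle_sign M N * (s1 * s2) \<in> {1, -1}" using s(2,3) shuffle_sign_cases[of M N] by auto
    with wedge_sign_inject[OF \<open>distinct ?e\<close> s(1)] show ?thesis by blast
  qed
  show ?thesis
  proof
    assume "compatible_orientations (enum_orientation s (M \<union> N)) (enum_orientation s1 M) (enum_orientation s2 N)"
    then obtain t xs t1 xs1 t2 xs2 where
      "(t, xs) \<in> enum_orientation s (M \<union> N)" "(t1, xs1) \<in> enum_orientation s1 M"
      "(t2, xs2) \<in> enum_orientation s2 N"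
      "wedge t (concat (map expand_aux xs)) =
        wedge (t1 * t2) (map (rename_aux Aux1) xs1 @ [Sep] @ map (rename_aux Aux2) xs2)"
      unfolding compatible_orientations_def by blast
    then show "s = shuffle_sign M N * (s1 * s2)" using left right inj by simp
  next
    assume eq: "s = shuffle_sign M N * (s1 * s2)"
    obtain t xs t1 xs1 t2 xs2 where mem:
      "(t, xs) \<in> enum_orientation s (M \<union> N)" "(t1, xs1) \<in> enum_orientation s1 M"
      "(t2, xs2) \<in> enum_orientation s2 N"
      using ne[OF finU s(1)] ne[OF fin(1) s(2)] ne[OF fin(2) s(3)] by blast
    have "wedge t (concat (map expand_aux xs)) =
        wedge (t1 * t2) (map (rename_aux Aux1) xs1 @ [Sep] @ map (rename_aux Aux2) xs2)"
      using left[OF mem(1)] right[OF mem(2,3)] eq by simp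
    then show "compatible_orientations (enum_orientation s (M \<union> N)) (enum_orientation s1 M) (enum_orientation s2 N)"
      unfolding compatible_orientations_def using mem by blast
  qed
qed

section \<open>Forests and parent functions\<close>

text \<open>A model of forests: \<open>N\<close> holds the nodes, \<open>p\<close> their parents,
  and the rest of \<open>I\<close> consists of roots. The rank only has to drop from a node to its
  parent; it excludes cycles and supports induction towards the root.\<close>

locale parent_function =
  fixes I N :: "'a set" and p :: "'a \<Rightarrow> 'a" and r :: "'a \<Rightarrow> nat"
  assumes N_subset: "N \<subseteq> I"
    and parent: "n \<in> N \<Longrightarrow> p n \<in> I"
    and rank: "n \<in> N \<Longrightarrow> r (p n) < r n"
begin

definition E :: "'a set set" where "E = (\<lambda>n. {n, p n}) ` N"

definition par :: "('a \<times> 'a) set" where "par = {(n, p n) | n. n \<in> N}"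

definition F :: "'a forest" where "F = Forest E (I - N)"

lemma nodes_F: "nodes I F = N"
  using N_subset by (auto simp: nodes_def F_def)

lemma edge_cases: "{u, v} \<in> E \<longleftrightarrow> u \<in> N \<and> v = p u \<or> v \<in> N \<and> u = p v"
  by (auto simp: E_def doubleton_eq_iff)

lemma E_subset:
  assumes "e \<in> E" shows "e \<subseteq> I \<and> card e = 2"
proof -
  obtain n where n: "n \<in> N" "e = {n, p n}" using assms by (auto simp: E_def)
  with rank[OF n(1)] have "n \<noteq> p n" by auto
  with n parent N_subset show ?thesis by auto
qed

lemma edge_in_I: "{u, v} \<in> E \<Longrightarrow> u \<in> I \<and> v \<in> I"
  using E_subset by blast

text \<open>On a cycle, a vertex of maximal rank is not the parent of a neighbour, so each of its
  two neighbours is its parent. They coincide, which a cycle with at least three vertices does not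
  allow.\<close>

lemma acyclic_E: "acyclic_edges E"
  unfolding acyclic_edges_def
proof clarify
  fix xs assume path: "simple_path E xs" and len: "length xs \<ge> 3" and cyc: "{last xs, hd xs} \<in> E"
  let ?n = "length xs"
  have edge: "{xs ! i, xs ! (Suc i mod ?n)} \<in> E" if "i < ?n" for i
  proof (cases "Suc i < ?n")
    case True
    with path show ?thesis by (simp add: simple_path_def successively_conv_nth)
  next
    case False
    with that have i: "i = ?n - 1" by simp
    have "xs \<noteq> []" using len by auto
    with cyc i False that show ?thesis by (simp add: last_conv_nth hd_conv_nth Suc_diff_1)
  qed
  obtain k where k: "k < ?n" "\<And>j. j < ?n \<Longrightarrow> r (xs ! j) \<le> r (xs ! k)"
  proof -
    let ?R = "(\<lambda>j. r (xs ! j)) ` {..<?n}"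
    have "0 \<in> {..<?n}" using len by auto
    then have R: "finite ?R" "?R \<noteq> {}" by (blast, blast)
    obtain k where "k < ?n" "r (xs ! k) = Max ?R" using Max_in[OF R] by auto
    with that Max_ge[OF R(1)] show ?thesis by fastforce
  qed
  \<comment> \<open>The predecessor of \<open>k\<close> on the cycle; for \<open>k = 0\<close> it
    wraps around to the last vertex.\<close>
  define i where "i = (if k = 0 then ?n - 1 else k - 1)"
  have i: "i < ?n" "Suc i mod ?n = k" using k len by (auto simp: i_def)
  let ?j = "Suc k mod ?n"
  have j: "?j < ?n" using len by (intro mod_less_divisor) linarith
  have "xs ! ?j = p (xs ! k)"
    using edge[OF k(1)] k(2)[OF j] rank unfolding edge_cases by fastforce
  moreover have "xs ! i = p (xs ! k)"
    using edge[OF i(1)] k(2)[OF i(1)] rank unfolding edge_cases i(2) by fastforce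
  ultimately have "?j = i" using path i(1) j nth_eq_iff_index_eq[of xs ?j i] by (simp add: simple_path_def)
  then show False using len k(1) by (cases "Suc k = ?n") (auto simp: i_def split: if_splits)
qed

text \<open>After a step from a parent to a child the only unvisited neighbours are children again,
  so the path keeps moving away from the root. A path that ends at a root therefore follows parents
  all the way.\<close>

lemma path_descends:
  assumes "simple_path E (u # w # xs)" "w \<in> N" "p w = u" shows "last (w # xs) \<in> N"
  using assms
proof (induction xs arbitrary: u w)
  case (Cons x xs)
  then have "{w, x} \<in> E" "x \<noteq> u" and s: "simple_path E (w # x # xs)" by (auto simp: simple_path_def)
  with Cons.prems have "x \<in> N" "p x = w" by (auto simp: edge_cases)
  from Cons.IH[OF s this] show ?case by simp
qed simp

lemma par_root: "(u, i) \<in> par\<^sup>* \<Longrightarrow> u \<notin> N \<Longrightarrow> i = u"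
  by (auto simp: par_def elim: converse_rtranclE)

lemma par_node: "u \<in> N \<Longrightarrow> (u, i) \<in> par\<^sup>* \<longleftrightarrow> i = u \<or> (p u, i) \<in> par\<^sup>*"
proof -
  assume u: "u \<in> N"
  then have "(u, p u) \<in> par" by (auto simp: par_def)
  then show ?thesis by (auto simp: par_def elim: converse_rtranclE intro: converse_rtrancl_into_rtrancl)
qed

lemma path_to_root:
  assumes "simple_path E (u # xs)" "last (u # xs) \<notin> N"
  shows "set (u # xs) = {i. (u, i) \<in> par\<^sup>*}"
  using assms
proof (induction xs arbitrary: u)
  case Nil
  then show ?case by (auto dest: par_root)
next
  case (Cons w xs)
  then have "{u, w} \<in> E" by (simp add: simple_path_def)
  moreover have "\<not> (w \<in> N \<and> p w = u)"
    using path_descends[OF Cons.prems(1)] Cons.prems(2) by auto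
  ultimately have "u \<in> N" "w = p u" by (auto simp: edge_cases)
  moreover have "simple_path E (w # xs)" using Cons.prems by (simp add: simple_path_def)
  ultimately show ?case using Cons.IH[of w] Cons.prems(2) by (auto simp: par_node)
qed

text \<open>The bound on the ranks is carried through the induction because it keeps
  \<open>u\<close> off the path from its parent, so that the extended path stays simple.\<close>

lemma ex_path_to_root:
  assumes "u \<in> I"
  shows "\<exists>xs. simple_path E (u # xs) \<and> last (u # xs) \<in> I - N \<and> (\<forall>y\<in>set xs. r y < r u)"
  using assms
proof (induction "r u" arbitrary: u rule: less_induct)
  case less
  show ?case
  proof (cases "u \<in> N")
    case True
    then obtain xs where xs: "simple_path E (p u # xs)" "last (p u # xs) \<in> I - N" "\<forall>y\<in>set xs. r y < r (p u)"
      using less.hyps[of "p u"] parent rank True by blast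
    then have "\<forall>y\<in>set (p u # xs). r y < r u" using rank[OF True] by auto
    moreover from this have "simple_path E (u # p u # xs)"
      using xs(1) True by (auto simp: simple_path_def edge_cases)
    ultimately show ?thesis using xs(2) by (intro exI[of _ "p u # xs"]) auto
  next
    case False
    with less.prems show ?thesis by (intro exI[of _ "[]"]) (auto simp: simple_path_def)
  qed
qed

text \<open>This removes paths from the order: a path that reaches a root visits exactly the
  iterated parents, so from here on the order is reachability under \<open>p\<close>.\<close>

lemma forest_le_iff: "forest_le F i j \<longleftrightarrow> j \<in> I \<and> (j, i) \<in> par\<^sup>*"
proof
  assume "forest_le F i j"
  then obtain xs where xs: "simple_path E (j # xs)" "last (j # xs) \<in> I - N" "i \<in> set (j # xs)"
    unfolding forest_le_def F_def by (metis forest.sel list.collapse simple_path_def)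
  have "j \<in> I"
  proof (cases xs)
    case (Cons w ys)
    with xs(1) have "{j, w} \<in> E" by (simp add: simple_path_def)
    then show ?thesis using edge_in_I by blast
  qed (use xs in auto)
  then show "j \<in> I \<and> (j, i) \<in> par\<^sup>*" using path_to_root[OF xs(1)] xs by blast
next
  assume j: "j \<in> I \<and> (j, i) \<in> par\<^sup>*"
  then obtain xs where xs: "simple_path E (j # xs)" "last (j # xs) \<in> I - N" using ex_path_to_root by blast
  then have "i \<in> set (j # xs)" using path_to_root[OF xs(1)] j by blast
  then show "forest_le F i j" using xs unfolding forest_le_def F_def by (metis forest.sel list.sel(1))
qed

lemma par_edge: "(u, v) \<in> par \<Longrightarrow> {u, v} \<in> E"
  by (auto simp: par_def E_def)

text \<open>Adding an edge to a connection keeps the common ancestor, unless that ancestor is the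
  child end of the edge; then the parent end replaces it.\<close>

lemma connected_iff: "(u, v) \<in> {(u, v). {u, v} \<in> E}\<^sup>* \<longleftrightarrow> (\<exists>w. (u, w) \<in> par\<^sup>* \<and> (v, w) \<in> par\<^sup>*)"
proof
  assume "(u, v) \<in> {(u, v). {u, v} \<in> E}\<^sup>*"
  then show "\<exists>w. (u, w) \<in> par\<^sup>* \<and> (v, w) \<in> par\<^sup>*"
  proof induction
    case (step y z)
    then obtain w where w: "(u, w) \<in> par\<^sup>*" "(y, w) \<in> par\<^sup>*" by blast
    consider "y \<in> N" "z = p y" | "z \<in> N" "y = p z" using step(2) edge_cases by auto
    then show ?case
    proof cases
      case 1
      then have "(y, z) \<in> par" by (auto simp: par_def)
      show ?thesis
      proof (cases "w = y")
        case True
        then show ?thesis using w(1) \<open>(y, z) \<in> par\<close> by (intro exI[of _ z]) auto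
      next
        case False
        then show ?thesis using w 1 par_node[of y w] by auto
      qed
    next
      case 2
      then show ?thesis using w par_node by blast
    qed
  qed auto
next
  have sub: "(x, w) \<in> {(u, v). {u, v} \<in> E}\<^sup>*" if "(x, w) \<in> par\<^sup>*" for x w
  proof -
    have "par \<subseteq> {(u, v). {u, v} \<in> E}" using par_edge by auto
    then show ?thesis using that rtrancl_mono by blast
  qed
  have "sym {(u, v). {u, v} \<in> E}" by (auto simp: sym_def insert_commute)
  then have sy: "sym ({(u, v). {u, v} \<in> E}\<^sup>*)" by (rule sym_rtrancl)
  assume "\<exists>w. (u, w) \<in> par\<^sup>* \<and> (v, w) \<in> par\<^sup>*"
  then show "(u, v) \<in> {(u, v). {u, v} \<in> E}\<^sup>*"
    using sub symD[OF sy, of v] by (blast intro: rtrancl_trans)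
qed

lemma par_in_I: "(u, i) \<in> par\<^sup>* \<Longrightarrow> u \<in> I \<Longrightarrow> i \<in> I"
  by (induction rule: rtrancl_induct) (auto simp: par_def parent)

lemma ex_root: "u \<in> I \<Longrightarrow> \<exists>w \<in> I - N. (u, w) \<in> par\<^sup>*"
  using ex_path_to_root path_to_root by (metis DiffD2 last_in_set list.distinct(1) mem_Collect_eq)

lemma forest_partition_F:
  "forest_partition I F = (\<lambda>v. {u \<in> I. \<exists>w. (u, w) \<in> par\<^sup>* \<and> (v, w) \<in> par\<^sup>*}) ` I"
proof -
  have "{(u, v). {u, v} \<in> E}\<^sup>* `` {v} = {u \<in> I. \<exists>w. (u, w) \<in> par\<^sup>* \<and> (v, w) \<in> par\<^sup>*}" if "v \<in> I" for v
  proof -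
    have "u \<in> I" if "(v, u) \<in> {(u, v). {u, v} \<in> E}\<^sup>*" for u
      using that \<open>v \<in> I\<close> by induction (use edge_in_I in auto)
    then show ?thesis using connected_iff by auto
  qed
  then show ?thesis by (auto simp: forest_partition_def quotient_def F_def)
qed

lemma forest_on_F: "forest_on I F"
proof -
  have "\<exists>!x. x \<in> P \<and> x \<in> roots F" if P: "P \<in> forest_partition I F" for P
  proof -
    obtain v where v: "v \<in> I" "P = {u \<in> I. \<exists>w. (u, w) \<in> par\<^sup>* \<and> (v, w) \<in> par\<^sup>*}"
      using P unfolding forest_partition_F by blast
    obtain x where x: "x \<in> I - N" "(v, x) \<in> par\<^sup>*" using ex_root v by blast
    have sv: "single_valued par" by (auto simp: single_valued_def par_def)
    have "y = x" if y: "y \<in> P" "y \<in> I - N" for y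
    proof -
      obtain w where "(y, w) \<in> par\<^sup>*" "(v, w) \<in> par\<^sup>*" using v y by auto
      then have "(v, y) \<in> par\<^sup>*" using par_root[of y w] y by auto
      then show ?thesis using single_valued_confluent[OF sv _ x(2)] par_root x(1) y(2) by blast
    qed
    moreover have "x \<in> P" using v x by auto
    moreover have "roots F = I - N" by (simp add: F_def)
    ultimately show ?thesis using x(1) by (metis (no_types))
  qed
  then show ?thesis
    using E_subset acyclic_E by (auto simp: forest_on_def F_def)
qed

lemma rank_less: "(j, i) \<in> par\<^sup>* \<Longrightarrow> i \<noteq> j \<Longrightarrow> r i < r j"
proof (induction rule: converse_rtrancl_induct)
  case (step y z)
  then have "y \<in> N" "z = p y" by (auto simp: par_def)
  with step rank[of y] show ?case by (cases "i = z") auto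
qed simp

text \<open>Edges are the covering pairs of the order and roots its minimal elements. Thus a forest
  can be recovered from its order, which is the content of \<open>forest_eqI\<close>.\<close>

lemma edges_F: "edges F = {{i, j} | i j. i \<noteq> j \<and> forest_le F i j \<and>
    (\<forall>k. forest_le F i k \<longrightarrow> forest_le F k j \<longrightarrow> k = i \<or> k = j)}" (is "_ = ?R")
proof
  show "edges F \<subseteq> ?R"
  proof
    fix e assume "e \<in> edges F"
    then obtain n where n: "n \<in> N" "e = {p n, n}" by (auto simp: F_def E_def)
    have "(n, p n) \<in> par\<^sup>*" using n by (auto simp: par_def)
    moreover have "k = p n \<or> k = n" if "(n, k) \<in> par\<^sup>*" "(k, p n) \<in> par\<^sup>*" for k
      using that par_node[OF n(1), of k] rank_less[of "p n" k] rank_less[of k "p n"] by fastforce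
    moreover have "p n \<noteq> n" using rank[OF n(1)] by auto
    moreover have "n \<in> I" using n N_subset by blast
    ultimately show "e \<in> ?R" unfolding n(2) forest_le_iff by blast
  qed
  show "?R \<subseteq> edges F"
  proof
    fix e assume "e \<in> ?R"
    then obtain i j where e: "e = {i, j}" "i \<noteq> j" "j \<in> I" "(j, i) \<in> par\<^sup>*"
      "\<And>k. k \<in> I \<Longrightarrow> (k, i) \<in> par\<^sup>* \<Longrightarrow> (j, k) \<in> par\<^sup>* \<Longrightarrow> k = i \<or> k = j"
      unfolding forest_le_iff by blast
    have j: "j \<in> N" using e par_root by blast
    have "(p j, i) \<in> par\<^sup>*" using par_node[OF j] e by blast
    moreover have "(j, p j) \<in> par\<^sup>*" using par_node[OF j] by blast
    ultimately have "p j = i" using e(5)[of "p j"] rank[OF j] parent[OF j] by auto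
    then show "e \<in> edges F" using e j by (auto simp: F_def E_def)
  qed
qed

lemma roots_F: "roots F = {j \<in> I. \<forall>i. forest_le F i j \<longrightarrow> i = j}"
proof -
  have "\<exists>i. (j, i) \<in> par\<^sup>* \<and> i \<noteq> j" if "j \<in> N" for j
    using that rank[OF that] par_node[OF that, of "p j"] by (intro exI[of _ "p j"]) auto
  then have "j \<in> roots F \<longleftrightarrow> j \<in> I \<and> (\<forall>i. forest_le F i j \<longrightarrow> i = j)" for j
    unfolding forest_le_iff using par_root by (auto simp: F_def)
  then show ?thesis by blast
qed

end

section \<open>From forests to parent functions\<close>

lemma ex_simple_path:
  assumes "(u, v) \<in> {(u, v). {u, v} \<in> E}\<^sup>*"
  shows "\<exists>xs. simple_path E xs \<and> hd xs = u \<and> last xs = v"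
  using assms
proof (induction rule: converse_rtrancl_induct)
  case base
  show ?case by (intro exI[of _ "[v]"]) (simp add: simple_path_def)
next
  case (step x y)
  then obtain xs where xs: "simple_path E xs" "hd xs = y" "last xs = v" by blast
  show ?case
  proof (cases "x \<in> set xs")
    case True
    then obtain as bs where "xs = as @ x # bs" by (meson split_list)
    with xs show ?thesis
      by (intro exI[of _ "x # bs"]) (auto simp: simple_path_def successively_append_iff)
  next
    case False
    with xs step(1) show ?thesis
      by (intro exI[of _ "x # xs"]) (auto simp: simple_path_def successively_Cons)
  qed
qed

text \<open>
  Every vertex is sent to a neighbour closer to the root. An edge not of this form would close a
  cycle with the two ascending paths from its endpoints.
\<close>

lemma forest_on_imp_parent_function:
  assumes F: "forest_on I F"
  obtains p r where "parent_function I (nodes I F) p r" "parent_function.F I (nodes I F) p = F"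
proof -
  let ?R = "{(u, v). {u, v} \<in> edges F}"
  have E: "e \<subseteq> I \<and> card e = 2" if "e \<in> edges F" for e using F that by (auto simp: forest_on_def)
  have ac: "acyclic_edges (edges F)" and rt: "roots F \<subseteq> I" using F by (auto simp: forest_on_def)
  have "\<forall>P\<in>I // ?R\<^sup>*. \<exists>!x. x \<in> P \<and> x \<in> roots F"
    using F by (simp add: forest_on_def forest_partition_def)
  then have uniq: "\<exists>!x. x \<in> ?R\<^sup>* `` {v} \<and> x \<in> roots F" if "v \<in> I" for v
    using quotientI[OF that, of "?R\<^sup>*"] by (rule bspec)
  \<comment> \<open>\<open>r v\<close> will be the distance from \<open>v\<close> to a root. It
    serves as the rank, and a neighbour one step nearer serves as the parent.\<close>
  define d where "d v n \<longleftrightarrow> (\<exists>x\<in>roots F. (v, x) \<in> ?R ^^ n)" for v n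
  define r where "r v = (LEAST n. d v n)" for v
  have dr: "d v (r v)" if "v \<in> I" for v
  proof -
    have "\<exists>n. d v n" using uniq[OF that] unfolding d_def by (metis ImageE rtrancl_imp_relpow singletonD)
    then show ?thesis unfolding r_def by (rule LeastI_ex)
  qed
  have "\<exists>w. {v, w} \<in> edges F \<and> r w < r v" if v: "v \<in> nodes I F" for v
  proof -
    have vI: "v \<in> I" "v \<notin> roots F" using v by (auto simp: nodes_def)
    from dr[OF vI(1)] obtain x where x: "x \<in> roots F" "(v, x) \<in> ?R ^^ r v" by (auto simp: d_def)
    have "r v \<noteq> 0"
    proof
      assume "r v = 0"
      with x(2) have "v = x" by simp
      with x(1) vI(2) show False by simp
    qed
    then obtain m where m: "r v = Suc m" using not0_implies_Suc by blast
    have "(v, x) \<in> ?R ^^ Suc m" using x(2) m by simp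
    from relpow_Suc_D2[OF this] obtain w where w: "{v, w} \<in> edges F" "(w, x) \<in> ?R ^^ m" by auto
    then have "d w m" using x by (auto simp: d_def)
    then have "r w \<le> m" unfolding r_def by (rule Least_le)
    with m w show ?thesis by auto
  qed
  then obtain p where p: "{v, p v} \<in> edges F \<and> r (p v) < r v" if "v \<in> nodes I F" for v by metis
  interpret pf: parent_function I "nodes I F" p r
    using p E by unfold_locales (auto simp: nodes_def)
  have sub: "pf.E \<subseteq> edges F" using p by (auto simp: pf.E_def)
  have edges: "{u, v} \<in> pf.E" if uv: "{u, v} \<in> edges F" for u v
  proof (rule ccontr)
    assume no: "{u, v} \<notin> pf.E"
    have I: "u \<in> I" "v \<in> I" "u \<noteq> v" using E[OF uv] by auto
    have up: "(x, w) \<in> ?R\<^sup>*" if "(x, w) \<in> pf.par\<^sup>*" for x w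
    proof -
      have "pf.par \<subseteq> ?R" using pf.par_edge sub by auto
      then show ?thesis using that rtrancl_mono by blast
    qed
    obtain x where x: "x \<in> roots F" "(u, x) \<in> pf.par\<^sup>*"
      using pf.ex_root[OF I(1)] by (auto simp: nodes_def)
    obtain y where y: "y \<in> roots F" "(v, y) \<in> pf.par\<^sup>*"
      using pf.ex_root[OF I(2)] by (auto simp: nodes_def)
    have "(u, v) \<in> ?R" using uv by simp
    then have "(u, y) \<in> ?R\<^sup>*" using up[OF y(2)] by (meson converse_rtrancl_into_rtrancl)
    \<comment> \<open>Both roots lie in the component of \<open>u\<close>, which contains only
      one.\<close>
    then have "x = y" using uniq[OF I(1)] x y up[OF x(2)] by blast
    then have "(u, v) \<in> {(u, v). {u, v} \<in> pf.E}\<^sup>*" using x y pf.connected_iff by blast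
    then obtain xs where xs: "simple_path pf.E xs" "hd xs = u" "last xs = v" using ex_simple_path by metis
    \<comment> \<open>A path with one vertex would force \<open>u = v\<close>, and with two vertices
      it would consist of the edge that is assumed to be missing.\<close>
    have "length xs \<ge> 3"
    proof (rule ccontr)
      assume "\<not> length xs \<ge> 3"
      then consider "xs = []" | "xs = [u]" | "xs = [u, v]"
        using xs(2,3) by (cases xs rule: list.exhaust; cases "tl xs"; cases "tl (tl xs)") auto
      then show False by cases (use xs I no in \<open>auto simp: simple_path_def\<close>)
    qed
    moreover have "simple_path (edges F) xs"
      using xs(1) sub by (auto simp: simple_path_def intro: successively_mono)
    moreover have "{last xs, hd xs} \<in> edges F" using xs uv by (simp add: insert_commute)
    ultimately show False using ac by (auto simp: acyclic_edges_def)
  qed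
  have "edges F = pf.E"
  proof
    show "edges F \<subseteq> pf.E" using edges E by (metis card_2_iff subsetI)
  qed (rule sub)
  moreover have "I - nodes I F = roots F" using rt by (auto simp: nodes_def)
  ultimately have "pf.F = F" unfolding pf.F_def by (metis forest.collapse)
  with that pf.parent_function_axioms show ?thesis by blast
qed

section \<open>The order of a forest\<close>

definition forest_root :: "'a forest \<Rightarrow> 'a \<Rightarrow> 'a" where
  "forest_root F i = (THE x. x \<in> roots F \<and> forest_le F x i)"

context
  fixes I :: "'a set" and F :: "'a forest"
  assumes F: "forest_on I F"
begin

lemma forest_le_in: "forest_le F i j \<Longrightarrow> i \<in> I \<and> j \<in> I"
  using F by (elim forest_on_imp_parent_function) (metis parent_function.forest_le_iff parent_function.par_in_I)

lemma forest_le_refl: "j \<in> I \<Longrightarrow> forest_le F j j"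
  using F by (elim forest_on_imp_parent_function) (metis parent_function.forest_le_iff rtrancl.rtrancl_refl)

lemma forest_le_trans: "forest_le F i j \<Longrightarrow> forest_le F j k \<Longrightarrow> forest_le F i k"
  using F by (elim forest_on_imp_parent_function) (metis parent_function.forest_le_iff rtrancl_trans)

text \<open>The rank of the model, expressed for the order alone; later inductions along the order
  run over it.\<close>

lemma ex_forest_rank: "\<exists>r :: 'a \<Rightarrow> nat. \<forall>i j. forest_le F i j \<longrightarrow> i \<noteq> j \<longrightarrow> r i < r j"
  using F by (elim forest_on_imp_parent_function) (metis parent_function.forest_le_iff parent_function.rank_less)

lemma forest_le_antisym: "forest_le F i j \<Longrightarrow> forest_le F j i \<Longrightarrow> i = j"
  using ex_forest_rank by (metis less_asym)

text \<open>Both vertices lie on the one path from \<open>k\<close> to its root. This property sets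
  forests apart from general posets and provides the largest candidate parent in
  \<open>ex_gamma_term\<close>.\<close>

lemma forest_le_chain:
  assumes "forest_le F i k" "forest_le F j k" shows "forest_le F i j \<or> forest_le F j i"
proof -
  obtain p r where pf: "parent_function I (nodes I F) p r" and e: "parent_function.F I (nodes I F) p = F"
    using F forest_on_imp_parent_function by blast
  interpret pf: parent_function I "nodes I F" p r by fact
  have "single_valued pf.par" by (auto simp: single_valued_def pf.par_def)
  from single_valued_confluent[OF this, of k i j] show ?thesis
    using assms forest_le_in pf.forest_le_iff unfolding e by blast
qed

lemma roots_eq: "roots F = {j \<in> I. \<forall>i. forest_le F i j \<longrightarrow> i = j}"
proof -
  obtain p r where pf: "parent_function I (nodes I F) p r" and e: "parent_function.F I (nodes I F) p = F"
    using F forest_on_imp_parent_function by blast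
  interpret pf: parent_function I "nodes I F" p r by fact
  show ?thesis using pf.roots_F unfolding e .
qed

lemma edges_eq: "edges F = {{i, j} | i j. i \<noteq> j \<and> forest_le F i j \<and>
    (\<forall>k. forest_le F i k \<longrightarrow> forest_le F k j \<longrightarrow> k = i \<or> k = j)}"
proof -
  obtain p r where pf: "parent_function I (nodes I F) p r" and e: "parent_function.F I (nodes I F) p = F"
    using F forest_on_imp_parent_function by blast
  interpret pf: parent_function I "nodes I F" p r by fact
  show ?thesis using pf.edges_F unfolding e .
qed

lemma ex_forest_root: "i \<in> I \<Longrightarrow> \<exists>x\<in>roots F. forest_le F x i"
proof -
  assume i: "i \<in> I"
  obtain p r where pf: "parent_function I (nodes I F) p r" and e: "parent_function.F I (nodes I F) p = F"
    using F forest_on_imp_parent_function by blast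
  interpret pf: parent_function I "nodes I F" p r by fact
  show ?thesis using pf.ex_root[OF i] i pf.forest_le_iff unfolding e by (auto simp: nodes_def)
qed

lemma forest_root_eq: "x \<in> roots F \<Longrightarrow> forest_le F x i \<Longrightarrow> forest_root F i = x"
  unfolding forest_root_def using forest_le_chain[of x i] roots_eq by (intro the_equality) auto

lemma forest_root:
  assumes "i \<in> I"
  shows "forest_root F i \<in> roots F" "forest_le F (forest_root F i) i" "forest_root F i \<in> I"
  using assms ex_forest_root forest_root_eq roots_eq by force+

lemma forest_root_le: "forest_le F i j \<Longrightarrow> forest_root F i = forest_root F j"
  using forest_root forest_root_eq forest_le_in forest_le_trans by metis

lemma forest_root_root: "x \<in> roots F \<Longrightarrow> forest_root F x = x"
  using forest_root_eq forest_le_refl roots_eq by auto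

text \<open>A common ancestor shares its root with both vertices, so the trees are the fibres of the
  root map.\<close>

lemma forest_partition_eq: "forest_partition I F = (\<lambda>v. {u \<in> I. forest_root F u = forest_root F v}) ` I"
proof -
  obtain p r where pf: "parent_function I (nodes I F) p r" and e: "parent_function.F I (nodes I F) p = F"
    using F forest_on_imp_parent_function by blast
  interpret pf: parent_function I "nodes I F" p r by fact
  have "(\<exists>w. (u, w) \<in> pf.par\<^sup>* \<and> (v, w) \<in> pf.par\<^sup>*) \<longleftrightarrow> forest_root F u = forest_root F v"
    if "u \<in> I" "v \<in> I" for u v
    using that forest_root forest_root_le pf.forest_le_iff unfolding e by metis
  then show ?thesis using pf.forest_partition_F unfolding e by (auto intro!: image_cong)
qed

end

lemma forest_eqI:
  assumes "forest_on I F" "forest_on I F'" "\<And>i j. forest_le F i j \<longleftrightarrow> forest_le F' i j"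
  shows "F = F'"
proof (rule forest.expand)
  have "forest_le F = forest_le F'" using assms(3) by blast
  then show "edges F = edges F' \<and> roots F = roots F'"
    using edges_eq[OF assms(1)] edges_eq[OF assms(2)] roots_eq[OF assms(1)] roots_eq[OF assms(2)] by simp
qed

lemma nodes_iff_forest_root:
  assumes "forest_on I F" "i \<in> I"
  shows "i \<in> nodes I F \<longleftrightarrow> forest_root F i \<noteq> i"
  using assms forest_root(1)[OF assms] forest_root_root[OF assms(1)] by (auto simp: nodes_def)

text \<open>The parts of \<open>F'\<close> are the fibres of its root map, so the order of
  \<open>F'\<close> is that of \<open>F\<close> cut down to these fibres. Refinement follows from
  new roots lying below their vertices: vertices with a common new root have a common old
  root.\<close>

lemma subforest_iff:
  assumes F': "forest_on I F'" and F: "forest_on I F"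
  shows "subforest I F' F \<longleftrightarrow> (\<forall>i\<in>I. forest_le F (forest_root F' i) i) \<and>
    (\<forall>i j. forest_le F' i j \<longleftrightarrow> i \<in> I \<and> j \<in> I \<and> forest_root F' i = forest_root F' j \<and> forest_le F i j)"
    (is "?L \<longleftrightarrow> ?R")
proof
  assume L: ?L
  have *: "forest_le F' i j \<longleftrightarrow> forest_le F i j" if "i \<in> I" "j \<in> I" "forest_root F' i = forest_root F' j" for i j
  proof -
    let ?P = "{u \<in> I. forest_root F' u = forest_root F' j}"
    have "?P \<in> forest_partition I F'" using that unfolding forest_partition_eq[OF F'] by blast
    from bspec[OF L[unfolded subforest_def] this]
    have "\<forall>i\<in>?P. \<forall>j\<in>?P. forest_le F' i j \<longleftrightarrow> forest_le F i j" by (rule conjunct2)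
    with that show ?thesis by simp
  qed
  have "forest_le F (forest_root F' i) i" if "i \<in> I" for i
    using *[of "forest_root F' i" i] forest_root[OF F' that] forest_root_root[OF F'] that by simp
  moreover have "forest_le F' i j \<longleftrightarrow> i \<in> I \<and> j \<in> I \<and> forest_root F' i = forest_root F' j \<and> forest_le F i j" for i j
    using *[of i j] forest_le_in[OF F', of i j] forest_root_le[OF F', of i j] by blast
  ultimately show ?R by blast
next
  assume R: ?R
  have root: "forest_root F i = forest_root F j" if "i \<in> I" "j \<in> I" "forest_root F' i = forest_root F' j" for i j
    using that R forest_root_le[OF F] by metis
  have le: "forest_le F' i j \<longleftrightarrow> forest_le F i j" if "i \<in> I" "j \<in> I" "forest_root F' i = forest_root F' j" for i j
    using R that by blast
  have *: "(\<exists>P\<in>forest_partition I F. P' \<subseteq> P) \<and> (\<forall>i\<in>P'. \<forall>j\<in>P'. forest_le F' i j \<longleftrightarrow> forest_le F i j)"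
    if v: "v \<in> I" "P' = {u \<in> I. forest_root F' u = forest_root F' v}" for P' v
  proof -
    let ?P = "{u \<in> I. forest_root F u = forest_root F v}"
    have "?P \<in> forest_partition I F" using v(1) forest_partition_eq[OF F] by blast
    moreover have "P' \<subseteq> ?P" using v root by blast
    moreover have "forest_le F' i j \<longleftrightarrow> forest_le F i j" if "i \<in> P'" "j \<in> P'" for i j
      using that le unfolding v(2) by simp
    ultimately show ?thesis by blast
  qed
  show ?L
    unfolding subforest_def
  proof
    fix P' assume "P' \<in> forest_partition I F'"
    then obtain v where "v \<in> I" "P' = {u \<in> I. forest_root F' u = forest_root F' v}"
      unfolding forest_partition_eq[OF F'] by (elim imageE)
    then show "(\<exists>P\<in>forest_partition I F. P' \<subseteq> P) \<and> (\<forall>i\<in>P'. \<forall>j\<in>P'. forest_le F' i j \<longleftrightarrow> forest_le F i j)"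
      by (rule *)
  qed
qed

section \<open>Subforests\<close>

lemma gamma_terms_iff:
  assumes "forest_on I F"
  shows "F' \<in> gamma_terms I F N \<longleftrightarrow> forest_on I F' \<and> nodes I F' = N \<and>
    (\<forall>i\<in>I. forest_le F (forest_root F' i) i) \<and>
    (\<forall>i j. forest_le F' i j \<longleftrightarrow> i \<in> I \<and> j \<in> I \<and> forest_root F' i = forest_root F' j \<and> forest_le F i j)"
  using subforest_iff[of I F' F] assms by (auto simp: gamma_terms_def)

lemma gamma_terms_eqI:
  assumes "forest_on I F" "F1 \<in> gamma_terms I F N1" "F2 \<in> gamma_terms I F N2"
    and "\<And>i. i \<in> I \<Longrightarrow> forest_root F1 i = forest_root F2 i"
  shows "F1 = F2"
  using assms(2-4) unfolding gamma_terms_iff[OF assms(1)] by (intro forest_eqI[of I]) auto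

lemma gamma_terms_self:
  assumes "forest_on I F" shows "F \<in> gamma_terms I F (nodes I F)"
  using assms forest_root[OF assms] forest_root_le[OF assms] forest_le_in[OF assms]
  by (auto simp: gamma_terms_iff)

lemma finite_gamma_terms:
  assumes "finite I" shows "finite (gamma_terms I F N)"
proof (rule finite_subset)
  show "gamma_terms I F N \<subseteq> case_prod Forest ` (Pow (Pow I) \<times> Pow I)"
  proof
    fix F' assume "F' \<in> gamma_terms I F N"
    then show "F' \<in> case_prod Forest ` (Pow (Pow I) \<times> Pow I)"
      by (cases F') (auto simp: gamma_terms_def forest_on_def)
  qed
qed (use assms in simp)

text \<open>A subforest amounts to the choice of the root above each of its nodes.\<close>

lemma ex_gamma_term:
  assumes fin: "finite I" and F: "forest_on I F" and N: "N \<subseteq> I"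
    and root: "\<And>i. i \<in> I \<Longrightarrow> \<rho> i \<in> I - N" and fix_off: "\<And>i. i \<in> I - N \<Longrightarrow> \<rho> i = i"
    and le: "\<And>i. i \<in> I \<Longrightarrow> forest_le F (\<rho> i) i"
  shows "\<exists>F'\<in>gamma_terms I F N. \<forall>i\<in>I. forest_root F' i = \<rho> i"
proof -
  obtain r :: "'a \<Rightarrow> nat" where r: "\<And>i j. forest_le F i j \<Longrightarrow> i \<noteq> j \<Longrightarrow> r i < r j"
    using ex_forest_rank[OF F] by blast
  \<comment> \<open>The candidates for the parent of \<open>n\<close>. The new root of
    \<open>n\<close> is one of them, since it is fixed by \<open>\<rho>\<close>. They form a chain,
    so one of maximal rank is the largest.\<close>
  define A where "A n = {m \<in> I. m \<noteq> n \<and> forest_le F m n \<and> \<rho> m = \<rho> n}" for n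
  have "\<exists>m\<in>A n. \<forall>k\<in>A n. forest_le F k m" if n: "n \<in> N" for n
  proof -
    have nI: "n \<in> I" using n N by blast
    have "\<rho> n \<in> A n" using root[OF nI] le[OF nI] fix_off[OF root[OF nI]] n by (auto simp: A_def)
    moreover have "finite (A n)" using fin by (auto simp: A_def)
    ultimately have fin': "finite (r ` A n)" "r ` A n \<noteq> {}" by (blast, blast)
    obtain m where "m \<in> A n" "r m = Max (r ` A n)" using Max_in[OF fin'] by auto
    with Max_ge[OF fin'(1)] have m: "m \<in> A n" "\<And>k. k \<in> A n \<Longrightarrow> r k \<le> r m" by auto
    have "forest_le F k m" if "k \<in> A n" for k
    proof -
      have "forest_le F k m \<or> forest_le F m k"
        using that m(1) forest_le_chain[OF F] by (auto simp: A_def)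
      then show ?thesis using m(2)[OF that] r by (metis leD)
    qed
    with m(1) show ?thesis by blast
  qed
  then obtain p where p: "\<And>n. n \<in> N \<Longrightarrow> p n \<in> A n" "\<And>n k. n \<in> N \<Longrightarrow> k \<in> A n \<Longrightarrow> forest_le F k (p n)"
    by metis
  interpret pf: parent_function I N p r
    using p(1) N r by unfold_locales (auto simp: A_def)
  have le1: "\<rho> i = \<rho> j \<and> forest_le F i j" if "(j, i) \<in> pf.par\<^sup>*" "j \<in> I" for i j
    using that
  proof (induction rule: converse_rtrancl_induct)
    case base
    then show ?case using forest_le_refl[OF F] by simp
  next
    case (step y z)
    then have "y \<in> N" "z = p y" by (auto simp: pf.par_def)
    then show ?case using step p(1)[of y] forest_le_trans[OF F] by (auto simp: A_def)
  qed
  \<comment> \<open>By induction on the rank of \<open>j\<close>: a vertex strictly below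
    \<open>j\<close> with the same new root is a candidate parent of \<open>j\<close>, hence lies
    below the chosen one.\<close>
  have le2: "(j, i) \<in> pf.par\<^sup>*" if "\<rho> i = \<rho> j" "forest_le F i j" for i j
    using that
  proof (induction "r j" arbitrary: j rule: less_induct)
    case less
    show ?case
    proof (cases "i = j")
      case False
      have ij: "i \<in> I" "j \<in> I" using forest_le_in[OF F] less.prems by auto
      \<comment> \<open>Otherwise \<open>j\<close> is its own new root, hence also that of
        \<open>i\<close>, and would lie below \<open>i\<close>.\<close>
      have j: "j \<in> N"
      proof (rule ccontr)
        assume "j \<notin> N"
        then have "\<rho> i = j" using fix_off ij less.prems by simp
        then show False using False le[OF ij(1)] less.prems forest_le_antisym[OF F] by auto
      qed
      have "i \<in> A j" using ij less.prems False by (auto simp: A_def)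
      then have "forest_le F i (p j)" using p(2)[OF j] by blast
      then have "(p j, i) \<in> pf.par\<^sup>*"
        using less.hyps[of "p j"] pf.rank[OF j] p(1)[OF j] less.prems by (auto simp: A_def)
      then show ?thesis using pf.par_node[OF j] by blast
    qed simp
  qed
  note F' = pf.forest_on_F
  have le': "forest_le pf.F i j \<longleftrightarrow> i \<in> I \<and> j \<in> I \<and> \<rho> i = \<rho> j \<and> forest_le F i j" for i j
    unfolding pf.forest_le_iff using le1 le2 forest_le_in[OF F] by blast
  have root': "forest_root pf.F i = \<rho> i" if "i \<in> I" for i
    using that root[OF that] le[OF that] fix_off[OF root[OF that]]
    by (intro forest_root_eq[OF F']) (simp add: pf.F_def, simp add: le')
  then have "pf.F \<in> gamma_terms I F N"
    unfolding gamma_terms_iff[OF F] using F' le' le pf.nodes_F by auto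
  with root' show ?thesis by blast
qed

text \<open>Equal node sets give equal sets of roots, and only one root of \<open>F\<close> lies
  below a given vertex, so the root maps agree. This yields the term that survives in each counit
  law.\<close>

lemma gamma_terms_nodes:
  assumes F: "forest_on I F" shows "gamma_terms I F (nodes I F) = {F}"
proof -
  have "F' = F" if F': "F' \<in> gamma_terms I F (nodes I F)" for F'
  proof (rule gamma_terms_eqI[OF F F' gamma_terms_self[OF F]])
    fix i assume i: "i \<in> I"
    have f': "forest_on I F'" "nodes I F' = nodes I F" "forest_le F (forest_root F' i) i"
      using F' i unfolding gamma_terms_iff[OF F] by auto
    then have "roots F' = roots F" using roots_eq[OF f'(1)] roots_eq[OF F] by (auto simp: nodes_def)
    then have "forest_root F' i \<in> roots F" using forest_root(1)[OF f'(1) i] by simp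
    then show "forest_root F' i = forest_root F i" using forest_root_eq[OF F] f'(3) by simp
  qed
  then show ?thesis using gamma_terms_self[OF F] by auto
qed

lemma forest_on_discrete: "forest_on I (Forest {} I)" "nodes I (Forest {} I) = {}"
proof -
  interpret pf: parent_function I "{}" id "\<lambda>_. 0" by unfold_locales auto
  show "forest_on I (Forest {} I)" "nodes I (Forest {} I) = {}"
    using pf.forest_on_F pf.nodes_F by (auto simp: pf.F_def pf.E_def)
qed

lemma forest_without_nodes:
  assumes F: "forest_on I F" "nodes I F = {}" shows "F = Forest {} I"
proof -
  have "forest_le F i j \<longleftrightarrow> i = j \<and> j \<in> I" if "forest_on I F" "nodes I F = {}" for F i j
    using that roots_eq[OF that(1)] forest_le_in[OF that(1)] forest_le_refl[OF that(1)]
    unfolding nodes_def by blast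
  from this[OF F] this[OF forest_on_discrete] show ?thesis
    using F(1) forest_on_discrete(1) by (intro forest_eqI) auto
qed

text \<open>A forest without nodes has only roots, so distinct vertices are incomparable and the
  forest is discrete. The identity as root map shows that such a term exists.\<close>

lemma gamma_terms_empty:
  assumes "finite I" "forest_on I F" shows "gamma_terms I F {} = {Forest {} I}"
proof -
  have "gamma_terms I F {} \<noteq> {}"
    using ex_gamma_term[OF assms, of "{}" id] forest_le_refl[OF assms(2)] by auto
  moreover have "gamma_terms I F {} \<subseteq> {Forest {} I}"
    using forest_without_nodes by (auto simp: gamma_terms_def)
  ultimately show ?thesis by blast
qed

lemma gamma_terms_trans:
  assumes "F1 \<in> gamma_terms I F' M" "F' \<in> gamma_terms I F N" shows "F1 \<in> gamma_terms I F M"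
proof -
  have "subforest I F1 F" if s: "subforest I F1 F'" "subforest I F' F"
    unfolding subforest_def
  proof
    fix P assume P: "P \<in> forest_partition I F1"
    obtain Q where Q: "Q \<in> forest_partition I F'" "P \<subseteq> Q"
      and le: "\<forall>i\<in>P. \<forall>j\<in>P. forest_le F1 i j \<longleftrightarrow> forest_le F' i j"
      using bspec[OF s(1)[unfolded subforest_def] P] by (elim conjE bexE)
    have "(\<exists>P'\<in>forest_partition I F. Q \<subseteq> P') \<and> (\<forall>i\<in>Q. \<forall>j\<in>Q. forest_le F' i j \<longleftrightarrow> forest_le F i j)"
      by (rule bspec[OF s(2)[unfolded subforest_def] Q(1)])
    with Q(2) le show "(\<exists>P'\<in>forest_partition I F. P \<subseteq> P') \<and>
        (\<forall>i\<in>P. \<forall>j\<in>P. forest_le F1 i j \<longleftrightarrow> forest_le F i j)"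
      by (meson subset_iff)
  qed
  with assms show ?thesis by (auto simp: gamma_terms_def)
qed

text \<open>
  Iterating the two choices of roots until a vertex outside \<open>M1 \<union> M2\<close> is reached yields the
  choice of roots of the unique common superforest.
\<close>

lemma ex1_gamma_join:
  assumes fin: "finite I" and F: "forest_on I F" and dis: "M1 \<inter> M2 = {}"
    and F1: "F1 \<in> gamma_terms I F M1" and F2: "F2 \<in> gamma_terms I F M2"
  shows "\<exists>!F'. F' \<in> gamma_terms I F (M1 \<union> M2) \<and> F1 \<in> gamma_terms I F' M1 \<and> F2 \<in> gamma_terms I F' M2"
proof -
  obtain r :: "'a \<Rightarrow> nat" where r: "\<And>i j. forest_le F i j \<Longrightarrow> i \<noteq> j \<Longrightarrow> r i < r j"
    using ex_forest_rank[OF F] by blast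
  let ?M = "M1 \<union> M2"
  \<comment> \<open>On a node, \<open>q\<close> makes the move belonging to the set that contains
    it; a vertex outside \<open>M1 \<union> M2\<close> stays in place. Iterating \<open>q\<close>
    leads to the root in the join.\<close>
  define q where "q i = (if i \<in> M1 then forest_root F1 i else forest_root F2 i)" for i
  have sub: "M \<subseteq> I" and moves: "\<And>i. i \<in> M \<Longrightarrow> forest_root G i \<noteq> i"
    and fixes_off: "\<And>i. i \<in> I - M \<Longrightarrow> forest_root G i = i"
    and le: "\<And>i. i \<in> I \<Longrightarrow> forest_le F (forest_root G i) i"
    and forest: "forest_on I G"
    if "G \<in> gamma_terms I F M" for G M
    using that nodes_iff_forest_root[of I G] unfolding gamma_terms_iff[OF F] by (auto simp: nodes_def)
  have qle: "forest_le F (q i) i" if "i \<in> I" for i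
    using le[OF F1 that] le[OF F2 that] by (simp add: q_def)
  \<comment> \<open>Between subforests of \<open>F\<close>, inclusion is a condition on root maps
    alone: passing first to the root in the smaller forest does not change the root in the larger
    one.\<close>
  have below: "F0 \<in> gamma_terms I F' M0 \<longleftrightarrow> (\<forall>i\<in>I. forest_root F' (forest_root F0 i) = forest_root F' i)"
    if F': "F' \<in> gamma_terms I F N" and F0: "F0 \<in> gamma_terms I F M0" for F' F0 N M0
  proof -
    have f: "forest_on I F'" "forest_on I F0" using F' F0 by (auto simp: gamma_terms_def)
    have le': "forest_le F' i j \<longleftrightarrow> i \<in> I \<and> j \<in> I \<and> forest_root F' i = forest_root F' j \<and> forest_le F i j" for i j
      using F' unfolding gamma_terms_iff[OF F] by blast
    have le0: "forest_le F0 i j \<longleftrightarrow> i \<in> I \<and> j \<in> I \<and> forest_root F0 i = forest_root F0 j \<and> forest_le F i j"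
        "i \<in> I \<Longrightarrow> forest_le F (forest_root F0 i) i" for i j
      using F0 unfolding gamma_terms_iff[OF F] by blast+
    have "nodes I F0 = M0" using F0 by (auto simp: gamma_terms_def)
    then have "F0 \<in> gamma_terms I F' M0 \<longleftrightarrow> (\<forall>i\<in>I. forest_le F' (forest_root F0 i) i) \<and>
        (\<forall>i j. forest_le F0 i j \<longleftrightarrow> i \<in> I \<and> j \<in> I \<and> forest_root F0 i = forest_root F0 j \<and> forest_le F' i j)"
      unfolding gamma_terms_iff[OF f(1)] using f(2) by simp
    also have "\<dots> \<longleftrightarrow> (\<forall>i\<in>I. forest_root F' (forest_root F0 i) = forest_root F' i)" (is "?l \<longleftrightarrow> ?r")
    proof
      assume ?l then show ?r using le' by blast
    next
      assume r: ?r
      have "forest_le F' (forest_root F0 i) i" if "i \<in> I" for i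
        unfolding le' using r that le0(2)[OF that] forest_root(3)[OF f(2) that] by blast
      moreover have "forest_root F' i = forest_root F' j"
        if "i \<in> I" "j \<in> I" "forest_root F0 i = forest_root F0 j" for i j
        using r that by metis
      ultimately show ?l using le' le0(1) by blast
    qed
    finally show ?thesis .
  qed
  interpret pf: parent_function I ?M q r
  proof
    show "?M \<subseteq> I" using sub[OF F1] sub[OF F2] by blast
    fix n assume n: "n \<in> ?M"
    then have nI: "n \<in> I" using sub[OF F1] sub[OF F2] by blast
    show "q n \<in> I" using qle[OF nI] forest_le_in[OF F] by blast
    have "q n \<noteq> n" using n moves[OF F1] moves[OF F2] by (auto simp: q_def)
    then show "r (q n) < r n" using r[OF qle[OF nI]] by blast
  qed
  \<comment> \<open>The forest \<open>pf.F\<close> with parent map \<open>q\<close> need not be a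
    subforest of \<open>F\<close>: two comparable nodes of \<open>F\<close> may become siblings.
    Only its root map is kept, and \<open>ex_gamma_term\<close> builds the join from it.\<close>
  let ?\<rho> = "forest_root pf.F"
  note Q = pf.forest_on_F
  have Qroots: "roots pf.F = I - ?M" by (simp add: pf.F_def)
  have par_le: "forest_le F i j" if "(j, i) \<in> pf.par\<^sup>*" "j \<in> I" for i j
    using that
  proof (induction rule: converse_rtrancl_induct)
    case base
    then show ?case using forest_le_refl[OF F] by simp
  next
    case (step y z)
    then have "z = q y" by (auto simp: pf.par_def)
    then show ?case using step qle[of y] forest_le_trans[OF F] forest_le_in[OF F] by blast
  qed
  have \<rho>q: "?\<rho> (q i) = ?\<rho> i" if "i \<in> ?M" for i
    using that pf.par_node[OF that, of "q i"] pf.N_subset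
    by (intro forest_root_le[OF Q]) (auto simp: pf.forest_le_iff)
  obtain F' where F': "F' \<in> gamma_terms I F ?M" "\<And>i. i \<in> I \<Longrightarrow> forest_root F' i = ?\<rho> i"
  proof -
    have "\<exists>F'\<in>gamma_terms I F ?M. \<forall>i\<in>I. forest_root F' i = ?\<rho> i"
    proof (rule ex_gamma_term[OF fin F pf.N_subset])
      show "?\<rho> i \<in> I - ?M" if "i \<in> I" for i using forest_root(1)[OF Q that] Qroots by simp
      show "?\<rho> i = i" if "i \<in> I - ?M" for i using forest_root_root[OF Q] Qroots that by simp
      show "forest_le F (?\<rho> i) i" if "i \<in> I" for i
        using forest_root(2)[OF Q that] par_le pf.forest_le_iff by blast
    qed
    then show ?thesis using that by blast
  qed
  have inI: "forest_root F1 i \<in> I" "forest_root F2 i \<in> I" if "i \<in> I" for i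
    using forest_root(3)[OF forest[OF F1] that] forest_root(3)[OF forest[OF F2] that] by auto
  show ?thesis
  proof (intro ex1I conjI)
    show "F' \<in> gamma_terms I F ?M" by fact
    show "F1 \<in> gamma_terms I F' M1"
      unfolding below[OF F'(1) F1]
    proof
      fix i assume i: "i \<in> I"
      show "forest_root F' (forest_root F1 i) = forest_root F' i"
        using F'(2) inI i \<rho>q[of i] fixes_off[OF F1, of i] by (cases "i \<in> M1") (auto simp: q_def)
    qed
    show "F2 \<in> gamma_terms I F' M2"
      unfolding below[OF F'(1) F2]
    proof
      fix i assume i: "i \<in> I"
      have "i \<notin> M1" if "i \<in> M2" using that dis by auto
      then show "forest_root F' (forest_root F2 i) = forest_root F' i"
        using F'(2) inI i \<rho>q[of i] fixes_off[OF F2, of i] by (cases "i \<in> M2") (auto simp: q_def)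
    qed
  next
    fix G assume G: "G \<in> gamma_terms I F ?M \<and> F1 \<in> gamma_terms I G M1 \<and> F2 \<in> gamma_terms I G M2"
    \<comment> \<open>Roots in any join \<open>G\<close> are constant along \<open>q\<close>, so
      following \<open>q\<close> down to a vertex outside \<open>M1 \<union> M2\<close>, where every
      root map is the identity, determines \<open>G\<close>.\<close>
    then have Gq: "forest_root G (q i) = forest_root G i" if "i \<in> I" for i
      using that below[of G ?M F1 M1] below[of G ?M F2 M2] F1 F2 by (auto simp: q_def)
    show "G = F'"
    proof (rule gamma_terms_eqI[OF F _ F'(1)])
      show "G \<in> gamma_terms I F ?M" using G by blast
      show "forest_root G i = forest_root F' i" if "i \<in> I" for i
        using that
      proof (induction "r i" arbitrary: i rule: less_induct)
        case less
        show ?case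
        proof (cases "i \<in> ?M")
          case True
          then show ?thesis
            using less.hyps[of "q i"] pf.rank[OF True] pf.parent[OF True] Gq[OF less.prems] \<rho>q[OF True] F'(2) less.prems
            by metis
        next
          case False
          then show ?thesis using fixes_off[of G ?M i] fixes_off[OF F'(1), of i] G less.prems by auto
        qed
      qed
    qed
  qed
qed

section \<open>Homomorphisms of abelian groups\<close>

lemma group_homI: "group G \<Longrightarrow> group H \<Longrightarrow> h \<in> hom G H \<Longrightarrow> group_hom G H h"
  by (simp add: group_hom_def group_hom_axioms_def)

lemma hom_int_pow: "group G \<Longrightarrow> group H \<Longrightarrow> h \<in> hom G H \<Longrightarrow> x \<in> carrier G \<Longrightarrow>
    h (x [^]\<^bsub>G\<^esub> (n :: int)) = h x [^]\<^bsub>H\<^esub> n"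
  using group_hom.hom_int_pow[OF group_homI] by metis

lemma hom_finprod:
  assumes "comm_group G" "comm_group H" "h \<in> hom G H" "f \<in> A \<rightarrow> carrier G"
  shows "h (finprod G f A) = finprod H (\<lambda>a. h (f a)) A"
proof -
  interpret G: comm_group G by fact
  interpret H: comm_group H by fact
  interpret h: group_hom G H h using assms by (intro group_homI) unfold_locales
  show ?thesis using assms(4)
  proof (induction A rule: infinite_finite_induct)
    case (insert a A)
    then have "f a \<in> carrier G" "f \<in> A \<rightarrow> carrier G" by auto
    moreover from this have "(\<lambda>a. h (f a)) \<in> A \<rightarrow> carrier H" "h (f a) \<in> carrier H"
      using h.hom_closed by blast+
    ultimately show ?case using insert by simp
  qed simp_all
qed

lemma hom_eq_on_generate:
  assumes "group G" "group H" "f \<in> hom G H" "g \<in> hom G H" "S \<subseteq> carrier G"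
    and "\<And>s. s \<in> S \<Longrightarrow> f s = g s" and x: "x \<in> generate G S"
  shows "f x = g x"
proof -
  interpret f: group_hom G H f using assms by (intro group_homI)
  interpret g: group_hom G H g using assms by (intro group_homI)
  from x show ?thesis
  proof (induction x rule: generate.induct)
    case (eng h1 h2)
    then have "h1 \<in> carrier G" "h2 \<in> carrier G" using f.G.generate_in_carrier[OF assms(5)] by auto
    with eng show ?case by simp
  qed (use assms in auto)
qed

lemma (in comm_group) finprod_hom_mult:
  assumes "\<And>a. a \<in> A \<Longrightarrow> h a \<in> hom H G"
  shows "(\<lambda>x. finprod G (\<lambda>a. h a x) A) \<in> hom H G"
proof (rule homI)
  have h: "h a x \<in> carrier G" if "a \<in> A" "x \<in> carrier H" for a x
    using hom_in_carrier[OF assms[OF that(1)] that(2)] .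
  then show "finprod G (\<lambda>a. h a x) A \<in> carrier G" if "x \<in> carrier H" for x
    using that by (intro finprod_closed) auto
  fix x y assume xy: "x \<in> carrier H" "y \<in> carrier H"
  have "finprod G (\<lambda>a. h a (x \<otimes>\<^bsub>H\<^esub> y)) A = finprod G (\<lambda>a. h a x \<otimes> h a y) A"
    using xy h hom_mult[OF assms] by (intro finprod_cong') auto
  also have "\<dots> = finprod G (\<lambda>a. h a x) A \<otimes> finprod G (\<lambda>a. h a y) A"
    using xy h by (intro finprod_multf) auto
  finally show "finprod G (\<lambda>a. h a (x \<otimes>\<^bsub>H\<^esub> y)) A = finprod G (\<lambda>a. h a x) A \<otimes> finprod G (\<lambda>a. h a y) A" .
qed

lemma (in comm_group) int_pow_hom:
  assumes "h \<in> hom H G" shows "(\<lambda>x. h x [^] (n :: int)) \<in> hom H G"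
  using assms by (intro homI) (auto simp: hom_mult hom_in_carrier int_pow_distrib)

lemma (in comm_group) finprod_int_pow:
  assumes "f \<in> A \<rightarrow> carrier G"
  shows "finprod G f A [^] (n :: int) = finprod G (\<lambda>a. f a [^] n) A"
proof -
  have "(\<lambda>x. x [^] n) \<in> hom G G" by (rule int_pow_hom) (auto intro: homI)
  from hom_finprod[OF _ _ this assms] show ?thesis using comm_group_axioms by blast
qed

lemma (in comm_group) finprod_in_subgroup:
  assumes "subgroup H G" "\<And>a. a \<in> A \<Longrightarrow> f a \<in> H"
  shows "finprod G f A \<in> H"
  using assms(2)
proof (induction A rule: infinite_finite_induct)
  case (insert a A)
  then have "f \<in> A \<rightarrow> carrier G" "f a \<in> carrier G" using subgroup.mem_carrier[OF assms(1)] by auto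
  then show ?case using insert subgroup.m_closed[OF assms(1)] by simp
qed (use subgroup.one_closed[OF assms(1)] in auto)

lemma (in comm_monoid) finprod_Sigma:
  assumes "finite A" "\<And>a. a \<in> A \<Longrightarrow> finite (B a)"
    and "\<And>a b. a \<in> A \<Longrightarrow> b \<in> B a \<Longrightarrow> f a b \<in> carrier G"
  shows "finprod G (\<lambda>a. finprod G (f a) (B a)) A = finprod G (\<lambda>(a, b). f a b) (Sigma A B)"
proof -
  have "finprod G (\<lambda>(a, b). f a b) (\<Union>a\<in>A. {a} \<times> B a) = finprod G (\<lambda>a. finprod G (\<lambda>(a, b). f a b) ({a} \<times> B a)) A"
    by (rule finprod_UN_disjoint) (use assms in \<open>auto simp: pairwise_def disjnt_def\<close>)
  moreover have "finprod G (\<lambda>(a, b). f a b) ({a} \<times> B a) = finprod G (f a) (B a)" if "a \<in> A" for a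
  proof -
    have "finprod G (\<lambda>(a, b). f a b) (Pair a ` B a) = finprod G (\<lambda>b. case (a, b) of (a, b) \<Rightarrow> f a b) (B a)"
      by (rule finprod_reindex) (use assms that in \<open>auto simp: inj_on_def\<close>)
    moreover have "{a} \<times> B a = Pair a ` B a" by auto
    ultimately show ?thesis by simp
  qed
  moreover have "(\<Union>a\<in>A. {a} \<times> B a) = Sigma A B" by auto
  moreover have "finprod G (\<lambda>a. finprod G (\<lambda>(a, b). f a b) ({a} \<times> B a)) A = finprod G (\<lambda>a. finprod G (f a) (B a)) A"
    using calculation(2) assms(3) by (intro finprod_cong') (auto intro!: finprod_closed)
  ultimately show ?thesis by metis
qed

lemma (in comm_monoid) finprod_bij:
  assumes "bij_betw g A B" "\<And>a. a \<in> A \<Longrightarrow> f' a = f (g a)" "f \<in> B \<rightarrow> carrier G"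
  shows "finprod G f' A = finprod G f B"
proof -
  have B: "B = g ` A" "inj_on g A" using assms(1) by (auto simp: bij_betw_def)
  then have "finprod G f B = finprod G (\<lambda>a. f (g a)) A" using finprod_reindex[of f g A] assms(3) by simp
  also have "\<dots> = finprod G f' A" using assms B by (intro finprod_cong') auto
  finally show ?thesis by simp
qed

lemma (in comm_monoid) finprod_swap:
  assumes "finite A" "finite B" "\<And>a b. a \<in> A \<Longrightarrow> b \<in> B \<Longrightarrow> f a b \<in> carrier G"
  shows "finprod G (\<lambda>a. finprod G (f a) B) A = finprod G (\<lambda>b. finprod G (\<lambda>a. f a b) A) B"
proof -
  have "finprod G (\<lambda>(a, b). f a b) (A \<times> B) = finprod G (\<lambda>(b, a). f a b) (B \<times> A)"
    by (rule finprod_bij[of prod.swap]) (use assms in \<open>auto simp: bij_betw_def\<close>)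
  then show ?thesis
    using finprod_Sigma[of A "\<lambda>_. B" f] finprod_Sigma[of B "\<lambda>_. A" "\<lambda>b a. f a b"] assms by simp
qed

lemma hom_cong:
  assumes "group G" "f \<in> hom G K" "\<And>x. x \<in> carrier G \<Longrightarrow> f x = g x" shows "g \<in> hom G K"
proof -
  interpret group G by fact
  show ?thesis using assms(2,3) by (auto simp: hom_def Pi_iff)
qed

lemma hom_generate_in_subgroup:
  assumes "group G" "group K" "h \<in> hom G K" "subgroup B K" "S \<subseteq> carrier G" "\<And>s. s \<in> S \<Longrightarrow> h s \<in> B"
    and x: "x \<in> generate G S"
  shows "h x \<in> B"
proof -
  interpret h: group_hom G K h using assms by (intro group_homI)
  interpret B: subgroup B K by fact
  from x show ?thesis
  proof (induction x rule: generate.induct)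
    case (eng h1 h2)
    then have "h1 \<in> carrier G" "h2 \<in> carrier G" using h.G.generate_in_carrier[OF assms(5)] by auto
    with eng show ?case by simp
  qed (use assms in auto)
qed

text \<open>Tensor relators have the shape \<open>a - b - c\<close>. This turns their vanishing into
  additivity and back, both in the tensor product and in the target of a lift.\<close>

lemma (in comm_group) mult_inv_inv_eq_one_iff:
  assumes "x \<in> carrier G" "y \<in> carrier G" "z \<in> carrier G"
  shows "(x \<otimes> inv y) \<otimes> inv z = \<one> \<longleftrightarrow> x = y \<otimes> z"
proof -
  have "(x \<otimes> inv y) \<otimes> inv z = x \<otimes> inv (y \<otimes> z)"
    using assms by (simp add: m_assoc inv_mult)
  moreover have "x \<otimes> inv w = \<one> \<longleftrightarrow> x = w" if "w \<in> carrier G" for w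
    using assms that by (metis inv_closed inv_equality inv_inv r_inv)
  ultimately show ?thesis using assms by simp
qed

section \<open>Presented groups\<close>

text \<open>The body is the one inside \<open>tensor_lift\<close>, so that the latter is
  \<open>presented_lift\<close> of the uncurried map.\<close>

definition frag_lift :: "'c monoid \<Rightarrow> ('a \<Rightarrow> 'c) \<Rightarrow> ('a \<Rightarrow>\<^sub>0 int) \<Rightarrow> 'c" where
  "frag_lift K f c = finprod K (\<lambda>s. f s [^]\<^bsub>K\<^esub> Poly_Mapping.lookup c s) (Poly_Mapping.keys c)"

definition presented_lift :: "'c monoid \<Rightarrow> ('a \<Rightarrow> 'c) \<Rightarrow> ('a \<Rightarrow>\<^sub>0 int) set \<Rightarrow> 'c" where
  "presented_lift K f T = the_elem (frag_lift K f ` T)"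

text \<open>Two formal sums can be evaluated over a common finite support, which makes additivity a
  termwise check.\<close>

lemma frag_lift_superset:
  assumes "comm_group K" "f \<in> A \<rightarrow> carrier K" "Poly_Mapping.keys c \<subseteq> A" "finite A"
  shows "frag_lift K f c = finprod K (\<lambda>s. f s [^]\<^bsub>K\<^esub> Poly_Mapping.lookup c s) A"
proof -
  interpret comm_group K by fact
  show ?thesis unfolding frag_lift_def
    by (rule finprod_mono_neutral_cong_left) (use assms in \<open>auto simp: in_keys_iff\<close>)
qed

lemma frag_lift_hom:
  assumes "comm_group K" "f \<in> S \<rightarrow> carrier K"
  shows "frag_lift K f \<in> hom (free_Abelian_group S) K"
proof (rule homI)
  interpret comm_group K by fact
  show "frag_lift K f c \<in> carrier K" if "c \<in> carrier (free_Abelian_group S)" for c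
    using that assms(2) unfolding frag_lift_def by (intro finprod_closed) auto
  fix c d assume cd: "c \<in> carrier (free_Abelian_group S)" "d \<in> carrier (free_Abelian_group S)"
  let ?A = "Poly_Mapping.keys c \<union> Poly_Mapping.keys d"
  have f: "f \<in> ?A \<rightarrow> carrier K" using cd assms(2) by auto
  have "frag_lift K f (c + d) = finprod K (\<lambda>s. f s [^]\<^bsub>K\<^esub> Poly_Mapping.lookup (c + d) s) ?A"
    using f keys_add[of c d] by (intro frag_lift_superset[OF assms(1)]) auto
  also have "\<dots> = finprod K (\<lambda>s. f s [^]\<^bsub>K\<^esub> Poly_Mapping.lookup c s \<otimes>\<^bsub>K\<^esub> f s [^]\<^bsub>K\<^esub> Poly_Mapping.lookup d s) ?A"
    using f by (intro finprod_cong') (auto simp: lookup_add int_pow_mult Pi_iff)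
  also have "\<dots> = finprod K (\<lambda>s. f s [^]\<^bsub>K\<^esub> Poly_Mapping.lookup c s) ?A
      \<otimes>\<^bsub>K\<^esub> finprod K (\<lambda>s. f s [^]\<^bsub>K\<^esub> Poly_Mapping.lookup d s) ?A"
    using f by (intro finprod_multf) auto
  also have "\<dots> = frag_lift K f c \<otimes>\<^bsub>K\<^esub> frag_lift K f d"
    using f by (simp add: frag_lift_superset[OF assms(1), of _ ?A])
  finally show "frag_lift K f (c \<otimes>\<^bsub>free_Abelian_group S\<^esub> d) = frag_lift K f c \<otimes>\<^bsub>K\<^esub> frag_lift K f d"
    by simp
qed

lemma frag_lift_of:
  assumes "comm_group K" "f s \<in> carrier K" shows "frag_lift K f (frag_of s) = f s"
proof -
  interpret comm_group K by fact
  show ?thesis using assms(2) by (simp add: frag_lift_def)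
qed

lemma frag_lift_diff:
  assumes "comm_group K" "f \<in> S \<rightarrow> carrier K" "Poly_Mapping.keys c \<subseteq> S" "Poly_Mapping.keys d \<subseteq> S"
  shows "frag_lift K f (c - d) = frag_lift K f c \<otimes>\<^bsub>K\<^esub> inv\<^bsub>K\<^esub> frag_lift K f d"
proof -
  interpret K: comm_group K by fact
  interpret h: group_hom "free_Abelian_group S" K "frag_lift K f"
    using frag_lift_hom[OF assms(1,2)] by (intro group_homI) (auto intro: K.is_group)
  have e: "c - d = c \<otimes>\<^bsub>free_Abelian_group S\<^esub> inv\<^bsub>free_Abelian_group S\<^esub> d"
    and cd: "c \<in> carrier (free_Abelian_group S)" "d \<in> carrier (free_Abelian_group S)"
    using assms(3,4) by simp_all
  show ?thesis
    unfolding e using h.hom_mult[OF cd(1) h.G.inv_closed[OF cd(2)]] h.hom_inv[OF cd(2)] by simp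
qed

text \<open>Tensor products and the group of oriented forests are both given by generators and
  relations; their universal properties are obtained here once for both.\<close>

locale presentation =
  fixes S :: "'a set" and R :: "('a \<Rightarrow>\<^sub>0 int) set"
  assumes relators: "R \<subseteq> carrier (free_Abelian_group S)"
begin

abbreviation "Fr \<equiv> free_Abelian_group S"
abbreviation "H \<equiv> relation_subgroup S R"
abbreviation "P \<equiv> presented_group S R"

sublocale Fr: comm_group Fr
  by (rule abelian_free_Abelian_group)

lemma subgroup_H: "subgroup H Fr"
  unfolding relation_subgroup_def by (rule Fr.generate_is_subgroup[OF relators])

sublocale H: normal H Fr
  using Fr.subgroup_imp_normal[OF subgroup_H] .

sublocale P: comm_group P
  unfolding presented_group_def
  using Fr.abelian_FactGroup[OF subgroup_H] .

abbreviation "cls c \<equiv> H #>\<^bsub>Fr\<^esub> c"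

lemma cls_hom: "cls \<in> hom Fr P"
  unfolding presented_group_def by (rule H.r_coset_hom_Mod)

lemma cls_relator:
  assumes "c \<in> R" shows "cls c = \<one>\<^bsub>P\<^esub>"
proof -
  have "c \<in> carrier Fr" "c \<in> H"
    using assms relators unfolding relation_subgroup_def by (blast, blast intro: generate.incl)
  then have "cls c = H" using Fr.coset_join2[OF _ subgroup_H] by blast
  then show ?thesis by (simp add: presented_group_def FactGroup_def)
qed

lemma carrier_P: "carrier P = cls ` carrier Fr"
  by (auto simp: presented_group_def FactGroup_def RCOSETS_def)

lemma gen_eq: "presented_gen S R s = cls (frag_of s)"
  by (simp add: presented_gen_def)

lemma gen_closed: "s \<in> S \<Longrightarrow> presented_gen S R s \<in> carrier P"
  unfolding gen_eq carrier_P by (intro imageI) simp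

lemma hom_eqI:
  assumes K: "group K" and f: "f \<in> hom P K" and g: "g \<in> hom P K"
    and eq: "\<And>s. s \<in> S \<Longrightarrow> f (presented_gen S R s) = g (presented_gen S R s)"
    and x: "x \<in> carrier P"
  shows "f x = g x"
proof -
  obtain c where c: "Poly_Mapping.keys c \<subseteq> S" "x = cls c" using x unfolding carrier_P by auto
  interpret f: group_hom Fr K "\<lambda>c. f (cls c)"
    using hom_compose[OF cls_hom f] K by (intro group_homI) (auto simp: comp_def)
  interpret g: group_hom Fr K "\<lambda>c. g (cls c)"
    using hom_compose[OF cls_hom g] K by (intro group_homI) (auto simp: comp_def)
  have "f (cls c) = g (cls c)"
  proof (rule free_Abelian_group_induct[OF c(1)])
    show "f (cls 0) = g (cls 0)" using f.hom_one g.hom_one by simp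
  next
    fix c d assume "Poly_Mapping.keys c \<subseteq> S" "Poly_Mapping.keys d \<subseteq> S"
      and eq: "f (cls c) = g (cls c)" "f (cls d) = g (cls d)"
    then have e: "c - d = c \<otimes>\<^bsub>Fr\<^esub> inv\<^bsub>Fr\<^esub> d" and cd: "c \<in> carrier Fr" "d \<in> carrier Fr" by simp_all
    show "f (cls (c - d)) = g (cls (c - d))" unfolding e
      using eq f.hom_mult[OF cd(1) Fr.inv_closed[OF cd(2)]] g.hom_mult[OF cd(1) Fr.inv_closed[OF cd(2)]]
        f.hom_inv[OF cd(2)] g.hom_inv[OF cd(2)] by simp
  next
    show "f (cls (frag_of a)) = g (cls (frag_of a))" if "a \<in> S" for a
      using eq[OF that] unfolding gen_eq .
  qed
  with c show ?thesis by simp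
qed

lemma generate_gens: "carrier P = generate P (presented_gen S R ` S)"
proof
  interpret c: group_hom Fr P cls using cls_hom by (intro group_homI) (auto intro: P.is_group)
  show "generate P (presented_gen S R ` S) \<subseteq> carrier P"
    using gen_closed by (intro P.generate_incl) auto
  have "cls c \<in> generate P (presented_gen S R ` S)" if "Poly_Mapping.keys c \<subseteq> S" for c
  proof (rule free_Abelian_group_induct[OF that])
    have "cls 0 = \<one>\<^bsub>P\<^esub>" using c.hom_one by simp
    then show "cls 0 \<in> generate P (presented_gen S R ` S)" by (simp only: generate.one)
  next
    fix c d assume "Poly_Mapping.keys c \<subseteq> S" "Poly_Mapping.keys d \<subseteq> S"
      and mem: "cls c \<in> generate P (presented_gen S R ` S)" "cls d \<in> generate P (presented_gen S R ` S)"
    then have e: "c - d = c \<otimes>\<^bsub>Fr\<^esub> inv\<^bsub>Fr\<^esub> d" and cd: "c \<in> carrier Fr" "d \<in> carrier Fr" by simp_all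
    have "cls (c - d) = cls c \<otimes>\<^bsub>P\<^esub> inv\<^bsub>P\<^esub> cls d"
      unfolding e using c.hom_mult[OF cd(1) Fr.inv_closed[OF cd(2)]] c.hom_inv[OF cd(2)] by simp
    moreover have "presented_gen S R ` S \<subseteq> carrier P" using gen_closed by blast
    ultimately show "cls (c - d) \<in> generate P (presented_gen S R ` S)"
      using mem P.generate_m_inv_closed generate.eng by metis
  next
    show "cls (frag_of a) \<in> generate P (presented_gen S R ` S)" if "a \<in> S" for a
      using generate.incl[OF imageI[OF that, of "presented_gen S R"], of P] unfolding gen_eq .
  qed
  then show "carrier P \<subseteq> generate P (presented_gen S R ` S)"
    unfolding carrier_P by auto
qed

lemma lift_cls:
  assumes K: "comm_group K" and f: "f \<in> S \<rightarrow> carrier K"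
    and rel: "\<And>c. c \<in> R \<Longrightarrow> frag_lift K f c = \<one>\<^bsub>K\<^esub>"
    and c: "c \<in> carrier Fr"
  shows "presented_lift K f (cls c) = frag_lift K f c"
proof -
  interpret K: comm_group K by fact
  interpret h: group_hom Fr K "frag_lift K f"
    using frag_lift_hom[OF K f] by (intro group_homI) (auto intro: K.is_group)
  \<comment> \<open>On the relators the extension agrees with the trivial homomorphism, hence also
    on the subgroup they generate. So it is constant on cosets, and \<open>the_elem\<close> picks
    its value.\<close>
  have H: "frag_lift K f d = \<one>\<^bsub>K\<^esub> \<and> d \<in> carrier Fr" if "d \<in> H" for d
  proof
    show "d \<in> carrier Fr" using that subgroup.mem_carrier[OF subgroup_H] by blast
    have "group_hom Fr K (\<lambda>_. \<one>\<^bsub>K\<^esub>)" by (intro group_homI homI) (auto intro: K.is_group)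
    then have "(\<lambda>_. \<one>\<^bsub>K\<^esub>) \<in> hom Fr K" by (auto simp: group_hom_def group_hom_axioms_def)
    then show "frag_lift K f d = \<one>\<^bsub>K\<^esub>"
      using hom_eq_on_generate[OF _ _ frag_lift_hom[OF K f] _ relators rel] that K.is_group
      unfolding relation_subgroup_def by fastforce
  qed
  have "frag_lift K f ` cls c = {frag_lift K f c}"
  proof -
    have "frag_lift K f d = frag_lift K f c" if "d \<in> cls c" for d
      using that H c h.hom_mult unfolding r_coset_def by fastforce
    moreover have "c \<in> cls c" using Fr.rcos_self[OF c subgroup_H] .
    ultimately show ?thesis by blast
  qed
  then show ?thesis by (simp add: presented_lift_def)
qed

lemma lift:
  assumes K: "comm_group K" and f: "f \<in> S \<rightarrow> carrier K"
    and rel: "\<And>c. c \<in> R \<Longrightarrow> frag_lift K f c = \<one>\<^bsub>K\<^esub>"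
  shows "presented_lift K f \<in> hom P K"
    and "s \<in> S \<Longrightarrow> presented_lift K f (presented_gen S R s) = f s"
proof -
  interpret h: group_hom Fr K "frag_lift K f"
    using frag_lift_hom[OF K f] K by (intro group_homI) (auto simp: comm_group_def)
  note lc = lift_cls[OF assms]
  show "presented_lift K f \<in> hom P K"
  proof (rule homI)
    show "presented_lift K f x \<in> carrier K" if "x \<in> carrier P" for x
      using that lc unfolding carrier_P by auto
    fix x y assume "x \<in> carrier P" "y \<in> carrier P"
    then obtain c d where cd: "c \<in> carrier Fr" "d \<in> carrier Fr" "x = cls c" "y = cls d"
      unfolding carrier_P by blast
    then have "x \<otimes>\<^bsub>P\<^esub> y = cls (c \<otimes>\<^bsub>Fr\<^esub> d)" using hom_mult[OF cls_hom] by simp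
    then show "presented_lift K f (x \<otimes>\<^bsub>P\<^esub> y) = presented_lift K f x \<otimes>\<^bsub>K\<^esub> presented_lift K f y"
      using cd lc[of c] lc[of d] lc[of "c \<otimes>\<^bsub>Fr\<^esub> d"] h.hom_mult[OF cd(1,2)] Fr.m_closed[OF cd(1,2)] by simp
  qed
  show "presented_lift K f (presented_gen S R s) = f s" if "s \<in> S"
  proof -
    have "f s \<in> carrier K" using f that by blast
    then show ?thesis using lc[of "frag_of s"] that frag_lift_of[OF K] unfolding gen_eq by simp
  qed
qed

end

section \<open>Tensor products\<close>

definition biadditive :: "'a monoid \<Rightarrow> 'b monoid \<Rightarrow> 'c monoid \<Rightarrow> ('a \<Rightarrow> 'b \<Rightarrow> 'c) \<Rightarrow> bool" where
  "biadditive G H K b \<longleftrightarrow>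
     (\<forall>y\<in>carrier H. (\<lambda>x. b x y) \<in> hom G K) \<and> (\<forall>x\<in>carrier G. b x \<in> hom H K)"

lemma biadditiveI:
  assumes "\<And>y. y \<in> carrier H \<Longrightarrow> (\<lambda>x. b x y) \<in> hom G K" "\<And>x. x \<in> carrier G \<Longrightarrow> b x \<in> hom H K"
  shows "biadditive G H K b"
  using assms by (simp add: biadditive_def)

locale tensor = G: comm_group G + H: comm_group H
  for G :: "'a monoid" and H :: "'b monoid"
begin

abbreviation "T \<equiv> tensor_product G H"
abbreviation "pt \<equiv> pure_tensor G H"

sublocale pr: presentation "carrier G \<times> carrier H" "tensor_relators G H"
proof
  have "Poly_Mapping.keys (a - b - c) \<subseteq> S" if "Poly_Mapping.keys a \<subseteq> S" "Poly_Mapping.keys b \<subseteq> S" "Poly_Mapping.keys c \<subseteq> S"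
    for a b c :: "'a \<times> 'b \<Rightarrow>\<^sub>0 int" and S
    using that keys_diff[of "a - b" c] keys_diff[of a b] by blast
  then show "tensor_relators G H \<subseteq> carrier (free_Abelian_group (carrier G \<times> carrier H))"
    by (auto simp: tensor_relators_def)
qed

sublocale T: comm_group T
  unfolding tensor_product_def by (rule pr.P.comm_group_axioms)

lemma pt_closed [simp]: "x \<in> carrier G \<Longrightarrow> y \<in> carrier H \<Longrightarrow> pt x y \<in> carrier T"
  unfolding pure_tensor_def tensor_product_def by (rule pr.gen_closed) simp

lemma cls_diff:
  assumes "Poly_Mapping.keys c \<subseteq> carrier G \<times> carrier H" "Poly_Mapping.keys d \<subseteq> carrier G \<times> carrier H"
  shows "pr.cls (c - d) = pr.cls c \<otimes>\<^bsub>T\<^esub> inv\<^bsub>T\<^esub> pr.cls d"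
proof -
  interpret c: group_hom pr.Fr T pr.cls
    using pr.cls_hom T.is_group by (intro group_homI) (auto simp: tensor_product_def)
  have e: "c - d = c \<otimes>\<^bsub>pr.Fr\<^esub> inv\<^bsub>pr.Fr\<^esub> d" and cd: "c \<in> carrier pr.Fr" "d \<in> carrier pr.Fr"
    using assms by simp_all
  show ?thesis
    unfolding e using c.hom_mult[OF cd(1) pr.Fr.inv_closed[OF cd(2)]] c.hom_inv[OF cd(2)] by simp
qed

lemma pt_relator:
  assumes "frag_of p - frag_of q - frag_of r \<in> tensor_relators G H"
    and "p \<in> carrier G \<times> carrier H" "q \<in> carrier G \<times> carrier H" "r \<in> carrier G \<times> carrier H"
  shows "case_prod pt p = case_prod pt q \<otimes>\<^bsub>T\<^esub> case_prod pt r"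
proof -
  have k: "Poly_Mapping.keys (frag_of p) \<subseteq> carrier G \<times> carrier H" "Poly_Mapping.keys (frag_of q) \<subseteq> carrier G \<times> carrier H"
    "Poly_Mapping.keys (frag_of r) \<subseteq> carrier G \<times> carrier H" using assms by auto
  have pt: "case_prod pt x = pr.cls (frag_of x)" for x
    by (cases x) (simp add: pure_tensor_def pr.gen_eq)
  have cl: "case_prod pt p \<in> carrier T" "case_prod pt q \<in> carrier T" "case_prod pt r \<in> carrier T"
    using assms by auto
  have "Poly_Mapping.keys (frag_of p - frag_of q) \<subseteq> carrier G \<times> carrier H"
    using keys_diff[of "frag_of p" "frag_of q"] k by blast
  then have "\<one>\<^bsub>T\<^esub> = (case_prod pt p \<otimes>\<^bsub>T\<^esub> inv\<^bsub>T\<^esub> case_prod pt q) \<otimes>\<^bsub>T\<^esub> inv\<^bsub>T\<^esub> case_prod pt r"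
    using pr.cls_relator[OF assms(1)] cls_diff k unfolding pt tensor_product_def by simp
  with T.mult_inv_inv_eq_one_iff[OF cl] show ?thesis by simp
qed

lemma pt_hom_left: "y \<in> carrier H \<Longrightarrow> (\<lambda>x. pt x y) \<in> hom G T"
proof (rule homI)
  fix x x' assume xy: "y \<in> carrier H" "x \<in> carrier G" "x' \<in> carrier G"
  then have "frag_of (x \<otimes>\<^bsub>G\<^esub> x', y) - frag_of (x, y) - frag_of (x', y) \<in> tensor_relators G H"
    unfolding tensor_relators_def by blast
  with xy show "pt (x \<otimes>\<^bsub>G\<^esub> x') y = pt x y \<otimes>\<^bsub>T\<^esub> pt x' y"
    using pt_relator[of "(x \<otimes>\<^bsub>G\<^esub> x', y)" "(x, y)" "(x', y)"] by auto
qed simp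

lemma pt_hom_right: "x \<in> carrier G \<Longrightarrow> pt x \<in> hom H T"
proof (rule homI)
  fix y y' assume xy: "x \<in> carrier G" "y \<in> carrier H" "y' \<in> carrier H"
  then have "frag_of (x, y \<otimes>\<^bsub>H\<^esub> y') - frag_of (x, y) - frag_of (x, y') \<in> tensor_relators G H"
    unfolding tensor_relators_def by blast
  with xy show "pt x (y \<otimes>\<^bsub>H\<^esub> y') = pt x y \<otimes>\<^bsub>T\<^esub> pt x y'"
    using pt_relator[of "(x, y \<otimes>\<^bsub>H\<^esub> y')" "(x, y)" "(x, y')"] by auto
qed simp

lemma tensor_hom_eqI:
  assumes "group K" "f \<in> hom T K" "g \<in> hom T K"
    and "\<And>x y. x \<in> carrier G \<Longrightarrow> y \<in> carrier H \<Longrightarrow> f (pt x y) = g (pt x y)"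
    and "t \<in> carrier T"
  shows "f t = g t"
  using pr.hom_eqI[of K f g t] assms unfolding tensor_product_def pure_tensor_def by auto

text \<open>The universal property: additivity in the first and in the second argument makes the
  extension vanish on the first and on the second kind of relators.\<close>

lemma tensor_lift:
  assumes K: "comm_group K" and b: "biadditive G H K b"
  shows "tensor_lift K b \<in> hom T K"
    and "x \<in> carrier G \<Longrightarrow> y \<in> carrier H \<Longrightarrow> tensor_lift K b (pt x y) = b x y"
proof -
  interpret K: comm_group K by fact
  let ?f = "\<lambda>(x, y). b x y"
  have l: "b (x \<otimes>\<^bsub>G\<^esub> x') y = b x y \<otimes>\<^bsub>K\<^esub> b x' y" if "x \<in> carrier G" "x' \<in> carrier G" "y \<in> carrier H" for x x' y
    using hom_mult[of "\<lambda>x. b x y" G K x x'] b that unfolding biadditive_def by blast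
  have r: "b x (y \<otimes>\<^bsub>H\<^esub> y') = b x y \<otimes>\<^bsub>K\<^esub> b x y'" if "x \<in> carrier G" "y \<in> carrier H" "y' \<in> carrier H" for x y y'
    using hom_mult[of "b x" H K y y'] b that unfolding biadditive_def by blast
  have c: "b x y \<in> carrier K" if "x \<in> carrier G" "y \<in> carrier H" for x y
    using hom_in_carrier[of "b x" H K y] b that unfolding biadditive_def by blast
  have f: "?f \<in> carrier G \<times> carrier H \<rightarrow> carrier K" using c by auto
  have diff: "frag_lift K ?f (frag_of p - frag_of q - frag_of s) = \<one>\<^bsub>K\<^esub>"
    if "?f p = ?f q \<otimes>\<^bsub>K\<^esub> ?f s" and m: "p \<in> carrier G \<times> carrier H" "q \<in> carrier G \<times> carrier H" "s \<in> carrier G \<times> carrier H"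
    for p q s
  proof -
    have "Poly_Mapping.keys (frag_of p - frag_of q) \<subseteq> carrier G \<times> carrier H"
      using keys_diff[of "frag_of p" "frag_of q"] m by auto
    moreover have cl: "?f p \<in> carrier K" "?f q \<in> carrier K" "?f s \<in> carrier K" using Pi_mem[OF f m(1)] Pi_mem[OF f m(2)] Pi_mem[OF f m(3)] by blast+
    ultimately have "frag_lift K ?f (frag_of p - frag_of q - frag_of s)
        = (?f p \<otimes>\<^bsub>K\<^esub> inv\<^bsub>K\<^esub> ?f q) \<otimes>\<^bsub>K\<^esub> inv\<^bsub>K\<^esub> ?f s"
      using m by (simp add: frag_lift_diff[OF K f] frag_lift_of[OF K])
    also have "\<dots> = \<one>\<^bsub>K\<^esub>" using K.mult_inv_inv_eq_one_iff[OF cl] that(1) by blast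
    finally show ?thesis .
  qed
  have rel: "frag_lift K ?f c = \<one>\<^bsub>K\<^esub>" if "c \<in> tensor_relators G H" for c
    using that unfolding tensor_relators_def
  proof (elim UnE CollectE exE conjE)
    fix x x' y assume c: "c = frag_of (x \<otimes>\<^bsub>G\<^esub> x', y) - frag_of (x, y) - frag_of (x', y)"
      "x \<in> carrier G" "x' \<in> carrier G" "y \<in> carrier H"
    show ?thesis unfolding c(1) by (rule diff) (use c l in auto)
  next
    fix x y y' assume c: "c = frag_of (x, y \<otimes>\<^bsub>H\<^esub> y') - frag_of (x, y) - frag_of (x, y')"
      "x \<in> carrier G" "y \<in> carrier H" "y' \<in> carrier H"
    show ?thesis unfolding c(1) by (rule diff) (use c r in auto)
  qed
  have e: "tensor_lift K b = presented_lift K ?f"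
    by (simp add: tensor_lift_def presented_lift_def frag_lift_def fun_eq_iff case_prod_unfold)
  show "tensor_lift K b \<in> hom T K"
    unfolding e tensor_product_def by (rule pr.lift(1)[OF K f rel])
  show "tensor_lift K b (pt x y) = b x y" if "x \<in> carrier G" "y \<in> carrier H"
    unfolding e pure_tensor_def using pr.lift(2)[OF K f rel, of "(x, y)"] that by simp
qed

end

section \<open>Functoriality, associativity and unit of tensor products\<close>

lemma tensor_map:
  assumes "comm_group G" "comm_group H" "comm_group G'" "comm_group H'" "f \<in> hom G G'" "g \<in> hom H H'"
  shows "tensor_map G' H' f g \<in> hom (tensor_product G H) (tensor_product G' H')"
    and "x \<in> carrier G \<Longrightarrow> y \<in> carrier H \<Longrightarrow>
      tensor_map G' H' f g (pure_tensor G H x y) = pure_tensor G' H' (f x) (g y)"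
proof -
  interpret s: tensor G H using assms by (simp add: tensor_def)
  interpret t: tensor G' H' using assms by (simp add: tensor_def)
  have "biadditive G H t.T (\<lambda>x y. t.pt (f x) (g y))"
  proof (rule biadditiveI)
    show "(\<lambda>x. t.pt (f x) (g y)) \<in> hom G t.T" if "y \<in> carrier H" for y
      using hom_compose[OF assms(5) t.pt_hom_left[of "g y"]] hom_in_carrier[OF assms(6) that] by (simp add: comp_def)
    show "(\<lambda>y. t.pt (f x) (g y)) \<in> hom H t.T" if "x \<in> carrier G" for x
      using hom_compose[OF assms(6) t.pt_hom_right[of "f x"]] hom_in_carrier[OF assms(5) that] by (simp add: comp_def)
  qed
  note l = s.tensor_lift[OF t.T.comm_group_axioms this]
  show "tensor_map G' H' f g \<in> hom (tensor_product G H) (tensor_product G' H')"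
    unfolding tensor_map_def by (rule l(1))
  show "x \<in> carrier G \<Longrightarrow> y \<in> carrier H \<Longrightarrow>
      tensor_map G' H' f g (pure_tensor G H x y) = pure_tensor G' H' (f x) (g y)"
    unfolding tensor_map_def by (rule l(2))
qed

text \<open>The inner lift is formed for a fixed \<open>z\<close>, so additivity in \<open>z\<close>
  is not part of its construction. It is an equality of homomorphisms in \<open>t\<close> and is
  checked on pure tensors.\<close>

lemma tensor_assoc:
  assumes "comm_group G" "comm_group H" "comm_group K"
  shows "tensor_assoc G H K \<in> hom (tensor_product (tensor_product G H) K) (tensor_product G (tensor_product H K))"
    and "x \<in> carrier G \<Longrightarrow> y \<in> carrier H \<Longrightarrow> z \<in> carrier K \<Longrightarrow>
      tensor_assoc G H K (pure_tensor (tensor_product G H) K (pure_tensor G H x y) z)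
        = pure_tensor G (tensor_product H K) x (pure_tensor H K y z)"
proof -
  interpret GH: tensor G H using assms by (simp add: tensor_def)
  interpret HK: tensor H K using assms by (simp add: tensor_def)
  interpret L: tensor GH.T K using assms GH.T.comm_group_axioms by (simp add: tensor_def)
  interpret R: tensor G HK.T using assms HK.T.comm_group_axioms by (simp add: tensor_def)
  define b where "b z = (\<lambda>x y. R.pt x (HK.pt y z))" for z
  have b: "biadditive G H R.T (b z)" if "z \<in> carrier K" for z
  proof (rule biadditiveI)
    show "(\<lambda>x. b z x y) \<in> hom G R.T" if "y \<in> carrier H" for y
      unfolding b_def using that \<open>z \<in> carrier K\<close> by (intro R.pt_hom_left) simp
    show "b z x \<in> hom H R.T" if "x \<in> carrier G" for x
      unfolding b_def using hom_compose[OF HK.pt_hom_left[OF \<open>z \<in> carrier K\<close>] R.pt_hom_right[OF that]]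
      by (simp add: comp_def)
  qed
  note l = GH.tensor_lift[OF R.T.comm_group_axioms b]
  have bz: "(\<lambda>z. b z x y) \<in> hom K R.T" if "x \<in> carrier G" "y \<in> carrier H" for x y
    unfolding b_def using hom_compose[OF HK.pt_hom_right[OF that(2)] R.pt_hom_right[OF that(1)]]
    by (simp add: comp_def)
  have "biadditive GH.T K R.T (\<lambda>t z. tensor_lift R.T (b z) t)"
  proof (rule biadditiveI)
    show "(\<lambda>t. tensor_lift R.T (b z) t) \<in> hom GH.T R.T" if "z \<in> carrier K" for z
      using l(1)[OF that] .
    fix t assume t: "t \<in> carrier GH.T"
    show "(\<lambda>z. tensor_lift R.T (b z) t) \<in> hom K R.T"
    proof (rule homI)
      show "tensor_lift R.T (b z) t \<in> carrier R.T" if "z \<in> carrier K" for z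
        using hom_in_carrier[OF l(1)[OF that] t] .
      fix z z' assume z: "z \<in> carrier K" "z' \<in> carrier K"
      have zz: "z \<otimes>\<^bsub>K\<^esub> z' \<in> carrier K" using z HK.H.m_closed by blast
      have "(\<lambda>t. tensor_lift R.T (b z) t \<otimes>\<^bsub>R.T\<^esub> tensor_lift R.T (b z') t) \<in> hom GH.T R.T"
        using l(1)[OF z(1)] l(1)[OF z(2)]
        by (intro homI) (auto simp: hom_mult hom_in_carrier R.T.m_ac)
      from GH.tensor_hom_eqI[OF R.T.is_group l(1)[OF zz] this _ t]
      show "tensor_lift R.T (b (z \<otimes>\<^bsub>K\<^esub> z')) t = tensor_lift R.T (b z) t \<otimes>\<^bsub>R.T\<^esub> tensor_lift R.T (b z') t"
        using l(2)[OF zz] l(2)[OF z(1)] l(2)[OF z(2)] hom_mult[OF bz] z by simp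
    qed
  qed
  note m = L.tensor_lift[OF R.T.comm_group_axioms this]
  have e: "tensor_assoc G H K = tensor_lift R.T (\<lambda>t z. tensor_lift R.T (b z) t)"
    by (simp add: tensor_assoc_def b_def)
  show "tensor_assoc G H K \<in> hom (tensor_product (tensor_product G H) K) (tensor_product G (tensor_product H K))"
    unfolding e by (rule m(1))
  show "tensor_assoc G H K (pure_tensor (tensor_product G H) K (pure_tensor G H x y) z)
        = pure_tensor G (tensor_product H K) x (pure_tensor H K y z)"
    if "x \<in> carrier G" "y \<in> carrier H" "z \<in> carrier K"
    unfolding e using m(2)[of "GH.pt x y" z] l(2)[OF that(3)] that by (simp add: b_def)
qed

lemma (in tensor) pt_int_pow:
  assumes "x \<in> carrier G" "y \<in> carrier H"
  shows "pt (x [^]\<^bsub>G\<^esub> (m :: int)) (y [^]\<^bsub>H\<^esub> (n :: int)) = pt x y [^]\<^bsub>T\<^esub> (m * n)"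
proof -
  have "pt (x [^]\<^bsub>G\<^esub> m) (y [^]\<^bsub>H\<^esub> n) = pt x (y [^]\<^bsub>H\<^esub> n) [^]\<^bsub>T\<^esub> m"
    using hom_int_pow[OF G.is_group T.is_group pt_hom_left[of "y [^]\<^bsub>H\<^esub> n"]] assms by simp
  also have "pt x (y [^]\<^bsub>H\<^esub> n) = pt x y [^]\<^bsub>T\<^esub> n"
    using hom_int_pow[OF H.is_group T.is_group pt_hom_right] assms by simp
  finally show ?thesis using assms by (simp add: T.int_pow_pow mult.commute)
qed

lemma (in tensor) pt_finprod:
  assumes "finite A" "finite B" "f \<in> A \<rightarrow> carrier G" "g \<in> B \<rightarrow> carrier H"
  shows "pt (finprod G f A) (finprod H g B) = finprod T (\<lambda>(a, b). pt (f a) (g b)) (A \<times> B)"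
proof -
  have gB: "finprod H g B \<in> carrier H" using assms by (intro H.finprod_closed)
  have "pt (finprod G f A) (finprod H g B) = finprod T (\<lambda>a. pt (f a) (finprod H g B)) A"
    by (rule hom_finprod[OF G.comm_group_axioms T.comm_group_axioms pt_hom_left[OF gB] assms(3)])
  also have "\<dots> = finprod T (\<lambda>a. finprod T (\<lambda>b. pt (f a) (g b)) B) A"
  proof (rule T.finprod_cong')
    show "pt (f a) (finprod H g B) = finprod T (\<lambda>b. pt (f a) (g b)) B" if "a \<in> A" for a
      using hom_finprod[OF H.comm_group_axioms T.comm_group_axioms pt_hom_right assms(4), of "f a"] assms(3) that
      by auto
  qed (use assms(3,4) in \<open>auto intro!: T.finprod_closed pt_closed\<close>)
  also have "\<dots> = finprod T (\<lambda>(a, b). pt (f a) (g b)) (A \<times> B)"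
    by (rule T.finprod_Sigma) (use assms in \<open>auto simp: Pi_iff\<close>)
  finally show ?thesis .
qed

lemma comm_group_integer_group: "comm_group integer_group"
  by (rule group.group_comm_groupI[OF group_integer_group]) simp

lemma int_pow_hom_exponent:
  assumes "group G" "x \<in> carrier G" shows "(\<lambda>n :: int. x [^]\<^bsub>G\<^esub> n) \<in> hom integer_group G"
  using assms by (intro homI) (auto simp: group.int_pow_mult group.int_pow_closed)

lemma tensor_unit:
  assumes G: "comm_group G"
  shows "tensor_unit_left G \<in> hom (tensor_product integer_group G) G"
    and "x \<in> carrier G \<Longrightarrow> tensor_unit_left G (pure_tensor integer_group G n x) = x [^]\<^bsub>G\<^esub> n"
    and "tensor_unit_right G \<in> hom (tensor_product G integer_group) G"
    and "x \<in> carrier G \<Longrightarrow> tensor_unit_right G (pure_tensor G integer_group x n) = x [^]\<^bsub>G\<^esub> n"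
proof -
  interpret G: comm_group G by fact
  interpret l: tensor integer_group G using G comm_group_integer_group by (simp add: tensor_def)
  interpret r: tensor G integer_group using G comm_group_integer_group by (simp add: tensor_def)
  have p: "(\<lambda>x. x [^]\<^bsub>G\<^esub> n) \<in> hom G G" for n :: int by (rule G.int_pow_hom) (auto intro: homI)
  have "biadditive integer_group G G (\<lambda>n x. x [^]\<^bsub>G\<^esub> n)"
    by (intro biadditiveI int_pow_hom_exponent p) (auto intro: G.is_group)
  note L = l.tensor_lift[OF G this]
  have "biadditive G integer_group G (\<lambda>x n. x [^]\<^bsub>G\<^esub> n)"
    by (intro biadditiveI int_pow_hom_exponent p) (auto intro: G.is_group)
  note R = r.tensor_lift[OF G this]
  show "tensor_unit_left G \<in> hom (tensor_product integer_group G) G"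
    and "x \<in> carrier G \<Longrightarrow> tensor_unit_left G (pure_tensor integer_group G n x) = x [^]\<^bsub>G\<^esub> n"
    and "tensor_unit_right G \<in> hom (tensor_product G integer_group) G"
    and "x \<in> carrier G \<Longrightarrow> tensor_unit_right G (pure_tensor G integer_group x n) = x [^]\<^bsub>G\<^esub> n"
    unfolding tensor_unit_left_def tensor_unit_right_def using L R by simp_all
qed

section \<open>Gradings given by projections\<close>

text \<open>The grading is presented by its projections, trivial outside the finite set
  \<open>D\<close> of degrees. Homogeneous components, defined by a description, thereby become
  values of homomorphisms.\<close>

locale projections = comm_group G for G :: "'a monoid" (structure) +
  fixes A :: "int \<Rightarrow> 'a set" and \<pi> :: "int \<Rightarrow> 'a \<Rightarrow> 'a" and D :: "int set"
  assumes subgroup_A: "subgroup (A n) G"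
    and proj_hom: "\<pi> n \<in> hom G G"
    and proj_in: "x \<in> carrier G \<Longrightarrow> \<pi> n x \<in> A n"
    and proj_homogeneous: "x \<in> A m \<Longrightarrow> \<pi> n x = (if n = m then x else \<one>)"
    and finite_D: "finite D"
    and sum_proj: "x \<in> carrier G \<Longrightarrow> finprod G (\<lambda>n. \<pi> n x) D = x"
begin

lemma A_carrier: "x \<in> A n \<Longrightarrow> x \<in> carrier G"
  using subgroup.mem_carrier[OF subgroup_A] .

lemma proj_closed [simp]: "x \<in> carrier G \<Longrightarrow> \<pi> n x \<in> carrier G"
  using proj_in A_carrier by blast

lemma proj_finprod:
  assumes "finite S" "\<And>m. m \<in> S \<Longrightarrow> c m \<in> A m"
  shows "\<pi> n (finprod G c S) = (if n \<in> S then c n else \<one>)"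
proof -
  have c: "c \<in> S \<rightarrow> carrier G" using assms A_carrier by auto
  have "\<pi> n (finprod G c S) = finprod G (\<lambda>m. \<pi> n (c m)) S"
    using hom_finprod[OF _ _ proj_hom c] comm_group_axioms by blast
  also have "\<dots> = finprod G (\<lambda>m. if n = m then c m else \<one>) S"
    using c proj_homogeneous[OF assms(2)] by (intro finprod_cong') auto
  also have "\<dots> = (if n \<in> S then c n else \<one>)"
    using finprod_singleton[of n S c] assms(1) c by (auto intro: finprod_one_eqI)
  finally show ?thesis .
qed

lemma proj_outside: "x \<in> carrier G \<Longrightarrow> n \<notin> D \<Longrightarrow> \<pi> n x = \<one>"
  using proj_finprod[OF finite_D, of "\<lambda>m. \<pi> m x" n] sum_proj[of x] proj_in by simp

text \<open>A projection applied to a decomposition isolates one component, which gives uniqueness;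
  the projections of \<open>x\<close> themselves give existence.\<close>

lemma homogeneous_decomposition_iff:
  assumes x: "x \<in> carrier G"
  shows "homogeneous_decomposition G A x c \<longleftrightarrow> c = (\<lambda>n. \<pi> n x)"
proof
  assume "homogeneous_decomposition G A x c"
  then have c: "\<And>n. c n \<in> A n" "finite {n. c n \<noteq> \<one>}" "x = finprod G c {n. c n \<noteq> \<one>}"
    by (auto simp: homogeneous_decomposition_def)
  show "c = (\<lambda>n. \<pi> n x)"
    unfolding c(3) by (rule ext) (simp add: proj_finprod[OF c(2) c(1)])
next
  assume c: "c = (\<lambda>n. \<pi> n x)"
  have sub: "{n. \<pi> n x \<noteq> \<one>} \<subseteq> D" using proj_outside[OF x] by blast
  have "finprod G (\<lambda>n. \<pi> n x) {n. \<pi> n x \<noteq> \<one>} = finprod G (\<lambda>n. \<pi> n x) D"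
    by (rule finprod_mono_neutral_cong_left) (use finite_D sub x in auto)
  then show "homogeneous_decomposition G A x c"
    unfolding homogeneous_decomposition_def c
    using sub finite_D proj_in x sum_proj[OF x] by (auto intro: finite_subset)
qed

lemma graded_abelian_group: "graded_abelian_group G A"
  by (intro graded_abelian_group.intro graded_abelian_group_axioms.intro subgroup_A comm_group_axioms)
    (simp add: homogeneous_decomposition_iff)

lemma homogeneous_component_eq: "x \<in> carrier G \<Longrightarrow> homogeneous_component G A x = (\<lambda>n. \<pi> n x)"
  by (simp add: homogeneous_component_def homogeneous_decomposition_iff)

text \<open>The defining sum runs over the degrees of the nonzero components of \<open>u\<close> and
  \<open>v\<close>, a set that varies with them. Extended by trivial summands to the fixed set
  \<open>D \<times> D\<close>, it is additive term by term.\<close>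

lemma koszul_twist:
  shows "koszul_twist G A \<in> hom (tensor_product G G) (tensor_product G G)"
    and "u \<in> A p \<Longrightarrow> v \<in> A q \<Longrightarrow> koszul_twist G A (pure_tensor G G u v)
      = pure_tensor G G v u [^]\<^bsub>tensor_product G G\<^esub> (if even (p * q) then 1 else - 1 :: int)"
proof -
  interpret t: tensor G G using comm_group_axioms by (simp add: tensor_def)
  define e where "e p q = (if even (p * q) then 1 else - 1 :: int)" for p q :: int
  define b where "b u v = (let cu = homogeneous_component G A u; cv = homogeneous_component G A v in
          finprod t.T (\<lambda>(p, q). t.pt (cv q) (cu p) [^]\<^bsub>t.T\<^esub> e p q)
            ({p. cu p \<noteq> \<one>} \<times> {q. cv q \<noteq> \<one>}))" for u v
  define b' where "b' u v = finprod t.T (\<lambda>(p, q). t.pt (\<pi> q v) (\<pi> p u) [^]\<^bsub>t.T\<^esub> e p q) (D \<times> D)" for u v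
  have one: "t.pt x \<one> = \<one>\<^bsub>t.T\<^esub>" "t.pt \<one> x = \<one>\<^bsub>t.T\<^esub>" if "x \<in> carrier G" for x
    using hom_one[OF t.pt_hom_right[OF that]] hom_one[OF t.pt_hom_left[OF that]] is_group t.T.is_group by auto
  have bb': "b u v = b' u v" if "u \<in> carrier G" "v \<in> carrier G" for u v
    unfolding b_def b'_def homogeneous_component_eq[OF that(1)] homogeneous_component_eq[OF that(2)] Let_def
    by (rule t.T.finprod_mono_neutral_cong_left)
      (use that finite_D proj_outside in \<open>auto simp: one\<close>)
  have left: "(\<lambda>u. t.pt (\<pi> q v) (\<pi> p u) [^]\<^bsub>t.T\<^esub> e p q) \<in> hom G t.T" if "v \<in> carrier G" for v p q
    using Group.hom_compose[OF proj_hom t.pt_hom_right[of "\<pi> q v"], of p] that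
    by (intro t.T.int_pow_hom) (simp add: comp_def)
  have right: "(\<lambda>v. t.pt (\<pi> q v) (\<pi> p u) [^]\<^bsub>t.T\<^esub> e p q) \<in> hom G t.T" if "u \<in> carrier G" for u p q
    using Group.hom_compose[OF proj_hom t.pt_hom_left[of "\<pi> p u"], of q] that
    by (intro t.T.int_pow_hom) (simp add: comp_def)
  have "biadditive G G t.T b"
  proof (rule biadditiveI)
    show "(\<lambda>u. b u v) \<in> hom G t.T" if "v \<in> carrier G" for v
    proof (rule hom_cong[OF is_group])
      show "(\<lambda>u. b' u v) \<in> hom G t.T"
        unfolding b'_def case_prod_unfold by (rule t.T.finprod_hom_mult) (rule left[OF that])
    qed (use that bb' in simp)
    show "b u \<in> hom G t.T" if "u \<in> carrier G" for u
    proof (rule hom_cong[OF is_group])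
      show "b' u \<in> hom G t.T"
        unfolding b'_def case_prod_unfold by (rule t.T.finprod_hom_mult) (rule right[OF that])
    qed (use that bb' in simp)
  qed
  note l = t.tensor_lift[OF t.T.comm_group_axioms this]
  have k: "koszul_twist G A = tensor_lift t.T b"
    unfolding koszul_twist_def b_def e_def ..
  show "koszul_twist G A \<in> hom (tensor_product G G) (tensor_product G G)"
    unfolding k by (rule l(1))
  show "koszul_twist G A (t.pt u v) = t.pt v u [^]\<^bsub>t.T\<^esub> (if even (p * q) then 1 else - 1 :: int)"
    if uv: "u \<in> A p" "v \<in> A q"
  proof -
    have c: "u \<in> carrier G" "v \<in> carrier G" using uv A_carrier by auto
    have u1: "\<pi> n u = (if n = p then u else \<one>)" and v1: "\<pi> n v = (if n = q then v else \<one>)" for n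
      using proj_homogeneous uv by auto
    have "koszul_twist G A (t.pt u v) = b' u v" unfolding k using l(2)[OF c] bb'[OF c] by simp
    also have "\<dots> = finprod t.T (\<lambda>(p, q). t.pt (\<pi> q v) (\<pi> p u) [^]\<^bsub>t.T\<^esub> e p q) {(p, q)}"
      unfolding b'_def
    \<comment> \<open>The index \<open>(p, q)\<close> need not lie in \<open>D \<times> D\<close>.
      If it does not, then \<open>u\<close> or \<open>v\<close> is neutral and both sides are
      trivial.\<close>
    proof (rule t.T.finprod_mono_neutral_cong)
      have one': "t.pt (\<pi> b v) (\<pi> a u) [^]\<^bsub>t.T\<^esub> e a b = \<one>\<^bsub>t.T\<^esub>" if "a \<noteq> p \<or> b \<noteq> q \<or> a \<notin> D \<or> b \<notin> D" for a b
      proof -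
        have "\<pi> a u = \<one> \<or> \<pi> b v = \<one>" using that u1 v1 proj_outside c by metis
        then show ?thesis using c by (auto simp: one)
      qed
      show "(case i of (p, q) \<Rightarrow> t.pt (\<pi> q v) (\<pi> p u) [^]\<^bsub>t.T\<^esub> e p q) = \<one>\<^bsub>t.T\<^esub>" if "i \<in> {(p, q)} - D \<times> D" for i
        using that one' by auto
      show "(case i of (p, q) \<Rightarrow> t.pt (\<pi> q v) (\<pi> p u) [^]\<^bsub>t.T\<^esub> e p q) = \<one>\<^bsub>t.T\<^esub>" if "i \<in> D \<times> D - {(p, q)}" for i
        using that one' by auto
    qed (use finite_D c in auto)
    also have "\<dots> = t.pt v u [^]\<^bsub>t.T\<^esub> e p q" using c by (simp add: u1 v1)
    finally show ?thesis by (simp add: e_def)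
  qed
qed

end

section \<open>The basis of forests\<close>

definition forest_basis :: "'a set \<Rightarrow> 'a forest \<Rightarrow> 'a forest_element" where
  "forest_basis I F = forest_gen I (enum_orientation 1 (nodes I F)) F"

definition gamma :: "'a set \<Rightarrow> 'a forest \<Rightarrow> 'a set \<Rightarrow> 'a forest_element" where
  "gamma I F N = finprod (forest_group I) (forest_basis I) (gamma_terms I F N)"

definition splits :: "'a set \<Rightarrow> ('a set \<times> 'a set) set" where
  "splits N = {(M1, M2). M1 \<union> M2 = N \<and> M1 \<inter> M2 = {}}"

lemma finite_splits: "finite N \<Longrightarrow> finite (splits N)"
  by (rule finite_subset[of _ "Pow N \<times> Pow N"]) (auto simp: splits_def)

locale finite_forests =
  fixes I :: "'a set"
  assumes finite_I: "finite I"
begin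

abbreviation "G \<equiv> forest_group I"
abbreviation "bas \<equiv> forest_basis I"
abbreviation "gam \<equiv> gamma I"

lemma finite_nodes [simp]: "finite (nodes I F)"
  using finite_I by (simp add: nodes_def)

lemma oriented_forests_iff:
  "(ori, F) \<in> oriented_forests I \<longleftrightarrow>
    forest_on I F \<and> (\<exists>s\<in>{1, -1}. ori = enum_orientation s (nodes I F))"
  using orientations_eq[OF finite_nodes[of F]] by (auto simp: oriented_forests_def)

lemma neg_oriented_forest: "(ori, F) \<in> oriented_forests I \<Longrightarrow> (neg_orientation ori, F) \<in> oriented_forests I"
  by (auto simp: oriented_forests_iff)

sublocale pr: presentation "oriented_forests I" "forest_relators I"
proof
  have "Poly_Mapping.keys (frag_of p - - frag_of q) \<subseteq> {p, q}" for p q :: "'a orientation \<times> 'a forest"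
    using keys_diff[of "frag_of p" "- frag_of q"] by auto
  then show "forest_relators I \<subseteq> carrier (free_Abelian_group (oriented_forests I))"
    using neg_oriented_forest by (fastforce simp: forest_relators_def)
qed

sublocale G: comm_group G
  unfolding forest_group_def by (rule pr.P.comm_group_axioms)

sublocale T: tensor G G
  by unfold_locales

lemma forest_gen_closed: "(ori, F) \<in> oriented_forests I \<Longrightarrow> forest_gen I ori F \<in> carrier G"
  unfolding forest_gen_def forest_group_def by (rule pr.gen_closed)

lemma bas_closed [simp]: "forest_on I F \<Longrightarrow> bas F \<in> carrier G"
  unfolding forest_basis_def by (rule forest_gen_closed) (auto simp: oriented_forests_iff)

lemma forest_gen_neg:
  assumes "(ori, F) \<in> oriented_forests I"
  shows "forest_gen I (neg_orientation ori) F = inv\<^bsub>G\<^esub> forest_gen I ori F"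
proof -
  let ?p = "(neg_orientation ori, F)" and ?q = "(ori, F)"
  note pq = neg_oriented_forest[OF assms] assms
  have "frag_of ?p - - frag_of ?q \<in> forest_relators I"
    using assms by (auto simp: forest_relators_def)
  from pr.cls_relator[OF this] have "pr.cls (frag_of ?p + frag_of ?q) = \<one>\<^bsub>G\<^esub>"
    by (simp add: forest_group_def)
  then have "forest_gen I (neg_orientation ori) F \<otimes>\<^bsub>G\<^esub> forest_gen I ori F = \<one>\<^bsub>G\<^esub>"
    using hom_mult[OF pr.cls_hom, of "frag_of ?p" "frag_of ?q"] pq
    by (simp add: forest_gen_def pr.gen_eq forest_group_def)
  then show ?thesis using forest_gen_closed pq by (metis G.inv_equality)
qed

lemma forest_gen_eq:
  assumes "forest_on I F" "s \<in> {1, -1}"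
  shows "forest_gen I (enum_orientation s (nodes I F)) F = bas F [^]\<^bsub>G\<^esub> s"
proof (cases "s = 1")
  case True
  then show ?thesis using assms by (simp add: forest_basis_def flip: forest_basis_def)
next
  case False
  then have s: "s = -1" using assms by simp
  have "forest_gen I (neg_orientation (enum_orientation 1 (nodes I F))) F = inv\<^bsub>G\<^esub> bas F"
    unfolding forest_basis_def using assms(1) by (intro forest_gen_neg) (auto simp: oriented_forests_iff)
  then show ?thesis using assms(1) s by (simp add: G.int_pow_neg)
qed

lemma hom_eq_on_basis:
  assumes K: "group K" and f: "f \<in> hom G K" and g: "g \<in> hom G K"
    and eq: "\<And>F. forest_on I F \<Longrightarrow> f (bas F) = g (bas F)" and x: "x \<in> carrier G"
  shows "f x = g x"
proof (rule pr.hom_eqI[OF K f[unfolded forest_group_def] g[unfolded forest_group_def] _ x[unfolded forest_group_def]])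
  fix s assume "s \<in> oriented_forests I"
  then obtain F t where F: "forest_on I F" "t \<in> {1, -1}" "s = (enum_orientation t (nodes I F), F)"
    by (cases s) (auto simp: oriented_forests_iff)
  have "presented_gen (oriented_forests I) (forest_relators I) s = bas F [^]\<^bsub>G\<^esub> t"
    using forest_gen_eq[OF F(1,2)] F(3) by (simp add: forest_gen_def)
  then show "f (presented_gen (oriented_forests I) (forest_relators I) s)
      = g (presented_gen (oriented_forests I) (forest_relators I) s)"
    using hom_int_pow[OF G.is_group K f] hom_int_pow[OF G.is_group K g] eq F(1) by simp
qed

text \<open>Freeness on forests. The opposite orientation is sent to the inverse; this is well
  defined because an orientation differs from its negative, so the relations never force a forest to
  have order two.\<close>

lemma ex_hom_on_basis:
  fixes K :: "'c monoid"
  assumes K: "comm_group K" and f: "\<And>F. forest_on I F \<Longrightarrow> f F \<in> carrier K"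
  shows "\<exists>h\<in>hom G K. \<forall>F. forest_on I F \<longrightarrow> h (bas F) = f F"
proof -
  interpret K: comm_group K by fact
  define g where "g = (\<lambda>(ori, F). if ori = enum_orientation 1 (nodes I F) then f F else inv\<^bsub>K\<^esub> f F)"
  have g: "g \<in> oriented_forests I \<rightarrow> carrier K" using f by (auto simp: g_def oriented_forests_iff)
  have gs: "g (enum_orientation s (nodes I F), F) = f F [^]\<^bsub>K\<^esub> s" if "forest_on I F" "s \<in> {1, -1}" for s F
    using that f enum_orientation_neq[OF finite_nodes[of F]] by (auto simp: g_def K.int_pow_neg)
  have rel: "frag_lift K g c = \<one>\<^bsub>K\<^esub>" if "c \<in> forest_relators I" for c
  proof -
    obtain ori F where c: "c = frag_of (neg_orientation ori, F) - - frag_of (ori, F)" "(ori, F) \<in> oriented_forests I"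
      using \<open>c \<in> forest_relators I\<close> unfolding forest_relators_def by blast
    then obtain s where s: "forest_on I F" "s \<in> {1, -1}" "ori = enum_orientation s (nodes I F)"
      by (auto simp: oriented_forests_iff)
    have m: "(neg_orientation ori, F) \<in> oriented_forests I" using neg_oriented_forest c(2) .
    have "frag_lift K g c = frag_lift K g (frag_of (neg_orientation ori, F)) \<otimes>\<^bsub>K\<^esub> frag_lift K g (frag_of (ori, F))"
      using hom_mult[OF frag_lift_hom[OF K g], of "frag_of (neg_orientation ori, F)" "frag_of (ori, F)"] c m by simp
    also have "\<dots> = g (neg_orientation ori, F) \<otimes>\<^bsub>K\<^esub> g (ori, F)"
      using frag_lift_of[OF K] Pi_mem[OF g] c(2) m by metis
    also have "\<dots> = f F [^]\<^bsub>K\<^esub> (- s) \<otimes>\<^bsub>K\<^esub> f F [^]\<^bsub>K\<^esub> s"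
      using gs[of F s] gs[of F "- s"] s by auto
    also have "\<dots> = \<one>\<^bsub>K\<^esub>" using f[OF s(1)] by (simp flip: K.int_pow_mult)
    finally show ?thesis .
  qed
  note l = pr.lift[OF K g rel]
  have "presented_lift K g (bas F) = f F" if "forest_on I F" for F
    using l(2)[of "(enum_orientation 1 (nodes I F), F)"] gs[OF that, of 1] that f
    by (simp add: oriented_forests_iff forest_basis_def forest_gen_def)
  then show ?thesis using l(1) unfolding forest_group_def by blast
qed

lemma gamma_terms_forest: "F' \<in> gamma_terms I F M \<Longrightarrow> forest_on I F' \<and> nodes I F' = M"
  by (simp add: gamma_terms_def)

lemma gam_closed [simp]: "gam F M \<in> carrier G"
  unfolding gamma_def using gamma_terms_forest by (intro G.finprod_closed) auto

text \<open>All terms of \<open>\<gamma>(F,M)\<close> have the node set \<open>M\<close>, so one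
  sign is common to the whole sum.\<close>

lemma oriented_gamma_eq:
  assumes "s \<in> {1, -1}"
  shows "oriented_gamma I (enum_orientation s M) F M = gam F M [^]\<^bsub>G\<^esub> s"
proof -
  have "oriented_gamma I (enum_orientation s M) F M = finprod G (\<lambda>F'. bas F' [^]\<^bsub>G\<^esub> s) (gamma_terms I F M)"
    unfolding oriented_gamma_def
    using forest_gen_eq[OF _ assms] gamma_terms_forest by (intro G.finprod_cong') fastforce+
  also have "\<dots> = gam F M [^]\<^bsub>G\<^esub> s"
    unfolding gamma_def using gamma_terms_forest by (intro G.finprod_int_pow[symmetric]) auto
  finally show ?thesis .
qed

section \<open>The coproduct\<close>

text \<open>The prescribed formula with signs in normal form. The set \<open>N\<close> is separate
  from \<open>F\<close> so that the same expression can describe the coproduct of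
  \<open>\<gamma>(F,N)\<close>.\<close>

definition coproduct_sum :: "'a forest \<Rightarrow> 'a set \<Rightarrow> ('a forest_element \<times> 'a forest_element \<Rightarrow>\<^sub>0 int) set" where
  "coproduct_sum F N =
     finprod T.T (\<lambda>(M1, M2). T.pt (gam F M1) (gam F M2) [^]\<^bsub>T.T\<^esub> shuffle_sign M1 M2) (splits N)"

lemma coproduct_sum_closed [simp]: "coproduct_sum F N \<in> carrier T.T"
  unfolding coproduct_sum_def by (intro T.T.finprod_closed) auto

text \<open>A tensor depends only on the product of the signs of its factors, and compatibility
  fixes that product. So every admissible choice gives the same sum, with \<open>s\<close> in
  front.\<close>

lemma forest_coproduct_summand:
  assumes s: "s \<in> {1, -1}" and F: "forest_on I F" and O: "\<And>M1 M2. (M1, M2) \<in> splits (nodes I F) \<Longrightarrow>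
      O1 (M1, M2) \<in> orientations M1 \<and> O2 (M1, M2) \<in> orientations M2 \<and>
      compatible_orientations (enum_orientation s (nodes I F)) (O1 (M1, M2)) (O2 (M1, M2))"
  shows "finprod T.T (\<lambda>(N1, N2). T.pt (oriented_gamma I (O1 (N1, N2)) F N1) (oriented_gamma I (O2 (N1, N2)) F N2))
      (splits (nodes I F)) = coproduct_sum F (nodes I F) [^]\<^bsub>T.T\<^esub> s"
proof -
  have summand: "T.pt (oriented_gamma I (O1 (M1, M2)) F M1) (oriented_gamma I (O2 (M1, M2)) F M2)
      = (T.pt (gam F M1) (gam F M2) [^]\<^bsub>T.T\<^esub> shuffle_sign M1 M2) [^]\<^bsub>T.T\<^esub> s"
    if M: "(M1, M2) \<in> splits (nodes I F)" for M1 M2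
  proof -
    have fin: "finite M1" "finite M2" "M1 \<inter> M2 = {}" "nodes I F = M1 \<union> M2"
      using M finite_nodes[of F] by (auto simp: splits_def intro: finite_subset)
    have ex: "\<exists>s\<in>{1, -1}. ori = enum_orientation s M" if "ori \<in> orientations M" "finite M" for ori and M :: "'a set"
      using that(1) orientations_eq[OF that(2)] by simp
    obtain s1 where o1: "s1 \<in> {1, -1}" "O1 (M1, M2) = enum_orientation s1 M1"
      using ex[OF conjunct1[OF O[OF M]] fin(1)] by (elim bexE)
    obtain s2 where o2: "s2 \<in> {1, -1}" "O2 (M1, M2) = enum_orientation s2 M2"
      using ex[OF conjunct1[OF conjunct2[OF O[OF M]]] fin(2)] by (elim bexE)
    note o = o1(1) o2(1) o1(2) o2(2)
    have "s = shuffle_sign M1 M2 * (s1 * s2)"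
      using O[OF M] compatible_enum_orientations_iff[OF fin(1-3) s o(1,2)] o(3,4) fin(4) by simp
    then have "s1 * s2 = shuffle_sign M1 M2 * s" using shuffle_sign_cases[of M1 M2] by auto
    moreover have "T.pt (oriented_gamma I (O1 (M1, M2)) F M1) (oriented_gamma I (O2 (M1, M2)) F M2)
        = T.pt (gam F M1) (gam F M2) [^]\<^bsub>T.T\<^esub> (s1 * s2)"
      unfolding o(3,4) oriented_gamma_eq[OF o(1)] oriented_gamma_eq[OF o(2)] by (rule T.pt_int_pow) simp_all
    ultimately show ?thesis by (simp add: T.T.int_pow_pow)
  qed
  let ?t = "\<lambda>(M1, M2). T.pt (gam F M1) (gam F M2) [^]\<^bsub>T.T\<^esub> shuffle_sign M1 M2"
  have "coproduct_sum F (nodes I F) [^]\<^bsub>T.T\<^esub> s = finprod T.T (\<lambda>p. ?t p [^]\<^bsub>T.T\<^esub> s) (splits (nodes I F))"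
    unfolding coproduct_sum_def by (rule T.T.finprod_int_pow) auto
  also have "\<dots> = finprod T.T (\<lambda>(N1, N2). T.pt (oriented_gamma I (O1 (N1, N2)) F N1) (oriented_gamma I (O2 (N1, N2)) F N2))
      (splits (nodes I F))"
  proof (rule T.T.finprod_cong'[OF refl])
    fix p assume "p \<in> splits (nodes I F)"
    then show "?t p [^]\<^bsub>T.T\<^esub> s = (case p of (N1, N2) \<Rightarrow>
        T.pt (oriented_gamma I (O1 (N1, N2)) F N1) (oriented_gamma I (O2 (N1, N2)) F N2))"
      by (cases p) (simp add: summand)
  qed (auto simp: summand)
  finally show ?thesis by (rule sym)
qed

lemma forest_coproduct_iff:
  "forest_coproduct I \<Delta> \<longleftrightarrow> \<Delta> \<in> hom G T.T \<and> (\<forall>F. forest_on I F \<longrightarrow> \<Delta> (bas F) = coproduct_sum F (nodes I F))"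
    (is "_ \<longleftrightarrow> ?R")
proof
  assume co: "forest_coproduct I \<Delta>"
  have "\<Delta> (bas F) = coproduct_sum F (nodes I F)" if F: "forest_on I F" for F
  proof -
    \<comment> \<open>The formula is conditional on an admissible choice, so one must be exhibited
      to read off the value: the first orientation takes the whole shuffle sign.\<close>
    define O1 :: "'a set \<times> 'a set \<Rightarrow> 'a orientation" where "O1 = (\<lambda>(M1, M2). enum_orientation (shuffle_sign M1 M2) M1)"
    define O2 :: "'a set \<times> 'a set \<Rightarrow> 'a orientation" where "O2 = (\<lambda>(M1, M2). enum_orientation 1 M2)"
    have O: "O1 (M1, M2) \<in> orientations M1 \<and> O2 (M1, M2) \<in> orientations M2 \<and>
        compatible_orientations (enum_orientation 1 (nodes I F)) (O1 (M1, M2)) (O2 (M1, M2))"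
      if M: "(M1, M2) \<in> splits (nodes I F)" for M1 M2
    proof -
      have fin: "finite M1" "finite M2" "M1 \<inter> M2 = {}" "nodes I F = M1 \<union> M2"
        using M finite_nodes[of F] by (auto simp: splits_def intro: finite_subset)
      show ?thesis
        using orientations_eq[OF fin(1)] orientations_eq[OF fin(2)] shuffle_sign_cases[of M1 M2]
          compatible_enum_orientations_iff[OF fin(1-3), of 1 "shuffle_sign M1 M2" 1] fin(4)
        by (auto simp: O1_def O2_def)
    qed
    have "\<Delta> (forest_gen I (enum_orientation 1 (nodes I F)) F) =
        finprod T.T (\<lambda>(N1, N2). T.pt (oriented_gamma I (O1 (N1, N2)) F N1) (oriented_gamma I (O2 (N1, N2)) F N2))
          (splits (nodes I F))"
      using co F O unfolding forest_coproduct_def splits_def by (auto simp: oriented_forests_iff)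
    also have "\<dots> = coproduct_sum F (nodes I F) [^]\<^bsub>T.T\<^esub> (1 :: int)"
      by (rule forest_coproduct_summand[OF _ F O]) simp
    finally show ?thesis by (simp add: forest_basis_def)
  qed
  then show ?R using co by (auto simp: forest_coproduct_def)
next
  assume R: ?R
  then have hom: "\<Delta> \<in> hom G T.T" and eq: "\<And>F. forest_on I F \<Longrightarrow> \<Delta> (bas F) = coproduct_sum F (nodes I F)" by auto
  show "forest_coproduct I \<Delta>"
    unfolding forest_coproduct_def
  proof (intro conjI hom allI impI)
    fix ori F and O1 O2 :: "'a set \<times> 'a set \<Rightarrow> 'a orientation"
    assume a: "(ori, F) \<in> oriented_forests I \<and>
        (\<forall>N1 N2. N1 \<union> N2 = nodes I F \<and> N1 \<inter> N2 = {} \<longrightarrow>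
           O1 (N1, N2) \<in> orientations N1 \<and> O2 (N1, N2) \<in> orientations N2 \<and>
           compatible_orientations ori (O1 (N1, N2)) (O2 (N1, N2)))"
    then obtain s where s: "forest_on I F" "s \<in> {1, -1}" "ori = enum_orientation s (nodes I F)"
      by (auto simp: oriented_forests_iff)
    have "\<Delta> (forest_gen I ori F) = coproduct_sum F (nodes I F) [^]\<^bsub>T.T\<^esub> s"
      using forest_gen_eq[OF s(1,2)] s(3) hom_int_pow[OF G.is_group T.T.is_group hom bas_closed[OF s(1)]] eq[OF s(1)]
      by simp
    also have "\<dots> = finprod T.T (\<lambda>(N1, N2). T.pt (oriented_gamma I (O1 (N1, N2)) F N1) (oriented_gamma I (O2 (N1, N2)) F N2))
          (splits (nodes I F))"
      using a unfolding s(3) by (intro forest_coproduct_summand[OF s(2,1), symmetric]) (auto simp: splits_def)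
    finally show "\<Delta> (forest_gen I ori F) = finprod T.T
        (\<lambda>(N1, N2). T.pt (oriented_gamma I (O1 (N1, N2)) F N1) (oriented_gamma I (O2 (N1, N2)) F N2))
        {(N1, N2). N1 \<union> N2 = nodes I F \<and> N1 \<inter> N2 = {}}"
      by (simp add: splits_def)
  qed
qed

text \<open>Freeness gives existence, and agreement on forests gives uniqueness on the carrier;
  extensionality pins down the function outside it.\<close>

lemma ex1_forest_coproduct: "\<exists>!\<Delta>. \<Delta> \<in> extensional (carrier G) \<and> forest_coproduct I \<Delta>"
proof -
  obtain h where h: "h \<in> hom G T.T" "\<And>F. forest_on I F \<Longrightarrow> h (bas F) = coproduct_sum F (nodes I F)"
    using ex_hom_on_basis[OF T.T.comm_group_axioms, of "\<lambda>F. coproduct_sum F (nodes I F)"] by auto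
  show ?thesis
  proof (intro ex1I conjI)
    show "restrict h (carrier G) \<in> extensional (carrier G)" by simp
    have "restrict h (carrier G) \<in> hom G T.T" by (rule hom_cong[OF G.is_group h(1)]) simp
    then show "forest_coproduct I (restrict h (carrier G))"
      using h(2) by (simp add: forest_coproduct_iff)
  next
    fix \<Delta> assume d: "\<Delta> \<in> extensional (carrier G) \<and> forest_coproduct I \<Delta>"
    show "\<Delta> = restrict h (carrier G)"
    proof (rule extensionalityI[of _ "carrier G"])
      show "\<Delta> x = restrict h (carrier G) x" if "x \<in> carrier G" for x
        using hom_eq_on_basis[OF T.T.is_group _ h(1) _ that, of \<Delta>] d h(2) that by (simp add: forest_coproduct_iff)
    qed (use d in auto)
  qed
qed

text \<open>The bijection of \<open>ex1_gamma_join\<close> turns a sum over chains \<open>F1, F2 \<subseteq> F' \<subseteq> F\<close> into a product.\<close>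

lemma gamma_join:
  assumes F: "forest_on I F" and dis: "M1 \<inter> M2 = {}"
  shows "finprod T.T (\<lambda>F'. T.pt (gam F' M1) (gam F' M2)) (gamma_terms I F (M1 \<union> M2)) = T.pt (gam F M1) (gam F M2)"
proof -
  let ?g = "gamma_terms I"
  let ?f = "\<lambda>(F1, F2). T.pt (bas F1) (bas F2)"
  have pt: "T.pt (gam F' M1) (gam F' M2) = finprod T.T ?f (?g F' M1 \<times> ?g F' M2)" for F'
    unfolding gamma_def using finite_gamma_terms[OF finite_I] gamma_terms_forest by (intro T.pt_finprod) auto
  have closed: "?f p \<in> carrier T.T" if "p \<in> ?g F1 M1 \<times> ?g F2 M2" for p F1 F2
    using that gamma_terms_forest by (cases p) auto
  have "finprod T.T (\<lambda>F'. finprod T.T ?f (?g F' M1 \<times> ?g F' M2)) (?g F (M1 \<union> M2))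
      = finprod T.T (\<lambda>(F', p). ?f p) (SIGMA F':?g F (M1 \<union> M2). ?g F' M1 \<times> ?g F' M2)"
    by (rule T.T.finprod_Sigma) (use finite_gamma_terms[OF finite_I] closed in auto)
  also have "\<dots> = finprod T.T ?f (?g F M1 \<times> ?g F M2)"
  proof (rule T.T.finprod_bij[of snd])
    \<comment> \<open>Injectivity is the uniqueness of the join and surjectivity its existence; that
      the pairs lie in the right set is transitivity of inclusion.\<close>
    show "bij_betw snd (SIGMA F':?g F (M1 \<union> M2). ?g F' M1 \<times> ?g F' M2) (?g F M1 \<times> ?g F M2)"
      unfolding bij_betw_def
    proof
      show "inj_on snd (SIGMA F':?g F (M1 \<union> M2). ?g F' M1 \<times> ?g F' M2)"
      proof (rule inj_onI, clarsimp)
        fix F' F'' F1 F2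
        assume F': "F' \<in> ?g F (M1 \<union> M2)" "F1 \<in> ?g F' M1" "F2 \<in> ?g F' M2"
          and F'': "F'' \<in> ?g F (M1 \<union> M2)" "F1 \<in> ?g F'' M1" "F2 \<in> ?g F'' M2"
        have "F1 \<in> ?g F M1" "F2 \<in> ?g F M2" using F' gamma_terms_trans by blast+
        from ex1_gamma_join[OF finite_I F dis this] show "F' = F''" using F' F'' by blast
      qed
      show "snd ` (SIGMA F':?g F (M1 \<union> M2). ?g F' M1 \<times> ?g F' M2) = ?g F M1 \<times> ?g F M2"
      proof (intro equalityI subsetI)
        fix p assume "p \<in> snd ` (SIGMA F':?g F (M1 \<union> M2). ?g F' M1 \<times> ?g F' M2)"
        then show "p \<in> ?g F M1 \<times> ?g F M2" using gamma_terms_trans by fastforce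
      next
        fix p assume "p \<in> ?g F M1 \<times> ?g F M2"
        then obtain F1 F2 where p: "p = (F1, F2)" "F1 \<in> ?g F M1" "F2 \<in> ?g F M2" by auto
        from ex1_implies_ex[OF ex1_gamma_join[OF finite_I F dis p(2,3)]]
        obtain F' where "F' \<in> ?g F (M1 \<union> M2)" "F1 \<in> ?g F' M1" "F2 \<in> ?g F' M2" by blast
        then have "(F', p) \<in> (SIGMA F':?g F (M1 \<union> M2). ?g F' M1 \<times> ?g F' M2)" using p(1) by simp
        then show "p \<in> snd ` (SIGMA F':?g F (M1 \<union> M2). ?g F' M1 \<times> ?g F' M2)"
          using image_eqI[of p snd "(F', p)"] by simp
      qed
    qed
  qed (use closed in auto)
  finally show ?thesis unfolding pt .
qed

section \<open>The coproduct on \<open>\<gamma>(F,N)\<close> and coassociativity\<close>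

context
  fixes \<Delta>
  assumes coproduct: "forest_coproduct I \<Delta>"
begin

lemma coproduct_hom: "\<Delta> \<in> hom G T.T"
  and coproduct_basis: "forest_on I F \<Longrightarrow> \<Delta> (bas F) = coproduct_sum F (nodes I F)"
  using coproduct by (auto simp: forest_coproduct_iff)

text \<open>All terms \<open>F'\<close> have the node set \<open>M\<close>, so their coproducts
  share the splits and the signs. After exchanging the two sums, \<open>gamma_join\<close> collapses
  the sum over \<open>F'\<close> for each split.\<close>

lemma coproduct_gamma:
  assumes F: "forest_on I F" and fin: "finite M"
  shows "\<Delta> (gam F M) = coproduct_sum F M"
proof -
  let ?t = "\<lambda>F' (M1, M2). T.pt (gam F' M1) (gam F' M2) [^]\<^bsub>T.T\<^esub> shuffle_sign M1 M2"
  have "\<Delta> (gam F M) = finprod T.T (\<lambda>F'. \<Delta> (bas F')) (gamma_terms I F M)"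
    unfolding gamma_def using gamma_terms_forest
    by (intro hom_finprod[OF G.comm_group_axioms T.T.comm_group_axioms coproduct_hom]) auto
  also have "\<dots> = finprod T.T (\<lambda>F'. finprod T.T (?t F') (splits M)) (gamma_terms I F M)"
    using coproduct_basis gamma_terms_forest
    by (intro T.T.finprod_cong') (auto simp: coproduct_sum_def intro!: T.T.finprod_closed)
  also have "\<dots> = finprod T.T (\<lambda>p. finprod T.T (\<lambda>F'. ?t F' p) (gamma_terms I F M)) (splits M)"
    using finite_gamma_terms[OF finite_I] finite_splits[OF fin] by (intro T.T.finprod_swap) auto
  also have "\<dots> = coproduct_sum F M"
    unfolding coproduct_sum_def
  proof (rule T.T.finprod_cong')
    fix p assume "p \<in> splits M"
    then obtain M1 M2 where p: "p = (M1, M2)" "M = M1 \<union> M2" "M1 \<inter> M2 = {}" by (auto simp: splits_def)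
    have "finprod T.T (\<lambda>F'. ?t F' p) (gamma_terms I F M)
        = finprod T.T (\<lambda>F'. T.pt (gam F' M1) (gam F' M2)) (gamma_terms I F M) [^]\<^bsub>T.T\<^esub> shuffle_sign M1 M2"
      unfolding p(1) by (simp add: T.T.finprod_int_pow)
    then show "finprod T.T (\<lambda>F'. ?t F' p) (gamma_terms I F M) = ?t F p"
      unfolding p using gamma_join[OF F p(3)] by simp
  qed auto
  finally show ?thesis .
qed

lemma hom_coproduct_sum:
  assumes K: "comm_group K" and h: "h \<in> hom T.T K"
  shows "h (coproduct_sum F N)
    = finprod K (\<lambda>(M1, M2). h (T.pt (gam F M1) (gam F M2)) [^]\<^bsub>K\<^esub> shuffle_sign M1 M2) (splits N)"
proof -
  interpret K: comm_group K by fact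
  have "h (coproduct_sum F N)
      = finprod K (\<lambda>p. h (case p of (M1, M2) \<Rightarrow> T.pt (gam F M1) (gam F M2) [^]\<^bsub>T.T\<^esub> shuffle_sign M1 M2)) (splits N)"
    unfolding coproduct_sum_def by (rule hom_finprod[OF T.T.comm_group_axioms K h]) auto
  also have "\<dots> = finprod K (\<lambda>(M1, M2). h (T.pt (gam F M1) (gam F M2)) [^]\<^bsub>K\<^esub> shuffle_sign M1 M2) (splits N)"
    using hom_in_carrier[OF h]
    by (intro K.finprod_cong') (auto simp: hom_int_pow[OF T.T.is_group K.is_group h])
  finally show ?thesis .
qed

lemma coproduct_coassociative:
  assumes x: "x \<in> carrier G"
  shows "tensor_assoc G G G (tensor_map T.T G \<Delta> id (\<Delta> x)) = tensor_map G T.T id \<Delta> (\<Delta> x)"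
proof -
  interpret L: tensor T.T G by unfold_locales
  interpret R: tensor G T.T by unfold_locales
  note comm = G.comm_group_axioms T.T.comm_group_axioms
  have id: "id \<in> hom G G" by (auto intro: homI)
  note mapL = tensor_map[OF comm(1) comm(1) comm(2) comm(1) coproduct_hom id]
  note mapR = tensor_map[OF comm(1) comm(1) comm(1) comm(2) id coproduct_hom]
  note ass = tensor_assoc[OF comm(1) comm(1) comm(1)]
  let ?l = "\<lambda>t. tensor_assoc G G G (tensor_map T.T G \<Delta> id t)" and ?r = "tensor_map G T.T id \<Delta>"
  have l: "?l \<in> hom T.T R.T" using hom_compose[OF mapL(1) ass(1)] by (simp add: comp_def)
  have "?l (\<Delta> (bas F)) = ?r (\<Delta> (bas F))" if F: "forest_on I F" for F
  proof -
    let ?N = "nodes I F" and ?s = shuffle_sign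
    define t where "t M1 M2 M3 = R.pt (gam F M1) (T.pt (gam F M2) (gam F M3))" for M1 M2 M3
    have t [simp]: "t M1 M2 M3 \<in> carrier R.T" for M1 M2 M3 by (simp add: t_def)
    have fin: "finite M1" "finite M2" if "(M1, M2) \<in> splits ?N" for M1 M2
      using that finite_nodes[of F] by (auto simp: splits_def intro: finite_subset)
    have "?l (\<Delta> (bas F)) = finprod R.T (\<lambda>(M, M3). ?l (T.pt (gam F M) (gam F M3)) [^]\<^bsub>R.T\<^esub> ?s M M3) (splits ?N)"
      unfolding coproduct_basis[OF F] by (rule hom_coproduct_sum[OF R.T.comm_group_axioms l])
    also have "\<dots> = finprod R.T (\<lambda>p. finprod R.T (\<lambda>q. t (fst q) (snd q) (snd p) [^]\<^bsub>R.T\<^esub>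
        (?s (fst q) (snd q) * ?s (fst p) (snd p))) (splits (fst p))) (splits ?N)"
    proof (rule R.T.finprod_cong')
      fix p assume p: "p \<in> splits ?N"
      obtain M M3 where pM: "p = (M, M3)" by fastforce
      have a: "(\<lambda>x. tensor_assoc G G G (L.pt x (gam F M3))) \<in> hom T.T R.T"
        using hom_compose[OF L.pt_hom_left[OF gam_closed] ass(1)] by (simp add: comp_def)
      have "?l (T.pt (gam F M) (gam F M3)) = tensor_assoc G G G (L.pt (coproduct_sum F M) (gam F M3))"
        using coproduct_gamma[OF F] fin p pM by (simp add: mapL(2))
      also have "\<dots> = finprod R.T (\<lambda>(M1, M2). t M1 M2 M3 [^]\<^bsub>R.T\<^esub> ?s M1 M2) (splits M)"
        unfolding hom_coproduct_sum[OF R.T.comm_group_axioms a] by (simp add: ass(2) t_def)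
      finally show "(case p of (M, M3) \<Rightarrow> ?l (T.pt (gam F M) (gam F M3)) [^]\<^bsub>R.T\<^esub> ?s M M3)
          = finprod R.T (\<lambda>q. t (fst q) (snd q) (snd p) [^]\<^bsub>R.T\<^esub> (?s (fst q) (snd q) * ?s (fst p) (snd p))) (splits (fst p))"
        by (simp add: pM case_prod_unfold R.T.finprod_int_pow R.T.int_pow_pow)
    qed (auto intro!: R.T.finprod_closed)
    also have "\<dots> = finprod R.T (\<lambda>(p, q). t (fst q) (snd q) (snd p) [^]\<^bsub>R.T\<^esub>
        (?s (fst q) (snd q) * ?s (fst p) (snd p))) (SIGMA p:splits ?N. splits (fst p))"
    proof (rule R.T.finprod_Sigma)
      show "finite (splits (fst p))" if "p \<in> splits ?N" for p
        using that fin[of "fst p" "snd p"] by (intro finite_splits) simp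
    qed (auto intro: finite_splits)
    also have "\<dots> = finprod R.T (\<lambda>(p, q). t (fst p) (fst q) (snd q) [^]\<^bsub>R.T\<^esub>
        (?s (fst q) (snd q) * ?s (fst p) (snd p))) (SIGMA p:splits ?N. splits (snd p))"
    \<comment> \<open>Both index sets encode ordered triples of disjoint sets:
      \<open>((M1 \<union> M2, M3), (M1, M2))\<close> goes to
      \<open>((M1, M2 \<union> M3), (M2, M3))\<close>.\<close>
    proof (rule R.T.finprod_bij[of "\<lambda>(p, q). ((fst q, snd q \<union> snd p), (snd q, snd p))"])
      show "bij_betw (\<lambda>(p, q). ((fst q, snd q \<union> snd p), (snd q, snd p)))
          (SIGMA p:splits ?N. splits (fst p)) (SIGMA p:splits ?N. splits (snd p))"
        by (rule bij_betw_byWitness[where f' = "\<lambda>(p, q). ((fst p \<union> fst q, snd q), (fst p, fst q))"])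
          (auto simp: splits_def)
      fix z assume z: "z \<in> (SIGMA p:splits ?N. splits (fst p))"
      then obtain M1 M2 M3 where M: "z = ((M1 \<union> M2, M3), (M1, M2))" "M1 \<union> M2 \<union> M3 = ?N"
          "M1 \<inter> M2 = {}" "M1 \<inter> M3 = {}" "M2 \<inter> M3 = {}"
        by (cases z) (auto simp: splits_def Int_Un_distrib2)
      have "finite M1" "finite M2" "finite M3" using finite_nodes[of F] unfolding M(2)[symmetric] by auto
      from shuffle_sign_assoc[OF this M(3-5)]
      show "(case z of (p, q) \<Rightarrow> t (fst q) (snd q) (snd p) [^]\<^bsub>R.T\<^esub> (?s (fst q) (snd q) * ?s (fst p) (snd p)))
          = (case (case z of (p, q) \<Rightarrow> ((fst q, snd q \<union> snd p), (snd q, snd p))) of (p, q) \<Rightarrow>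
              t (fst p) (fst q) (snd q) [^]\<^bsub>R.T\<^esub> (?s (fst q) (snd q) * ?s (fst p) (snd p)))"
        by (simp add: M(1))
    qed auto
    also have "\<dots> = finprod R.T (\<lambda>p. finprod R.T (\<lambda>q. t (fst p) (fst q) (snd q) [^]\<^bsub>R.T\<^esub>
        (?s (fst q) (snd q) * ?s (fst p) (snd p))) (splits (snd p))) (splits ?N)"
    proof (rule R.T.finprod_Sigma[symmetric])
      show "finite (splits (snd p))" if "p \<in> splits ?N" for p
        using that fin[of "fst p" "snd p"] by (intro finite_splits) simp
    qed (auto intro: finite_splits)
    also have "\<dots> = finprod R.T (\<lambda>(M1, M). ?r (T.pt (gam F M1) (gam F M)) [^]\<^bsub>R.T\<^esub> ?s M1 M) (splits ?N)"
    proof (rule R.T.finprod_cong')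
      fix p assume p: "p \<in> splits ?N"
      obtain M1 M where pM: "p = (M1, M)" by fastforce
      have a: "R.pt (gam F M1) \<in> hom T.T R.T" by (rule R.pt_hom_right) simp
      have "?r (T.pt (gam F M1) (gam F M)) = R.pt (gam F M1) (coproduct_sum F M)"
        using coproduct_gamma[OF F] fin p pM by (simp add: mapR(2))
      also have "\<dots> = finprod R.T (\<lambda>(M2, M3). t M1 M2 M3 [^]\<^bsub>R.T\<^esub> ?s M2 M3) (splits M)"
        unfolding hom_coproduct_sum[OF R.T.comm_group_axioms a] by (simp add: t_def)
      finally show "finprod R.T (\<lambda>q. t (fst p) (fst q) (snd q) [^]\<^bsub>R.T\<^esub> (?s (fst q) (snd q) * ?s (fst p) (snd p))) (splits (snd p))
          = (case p of (M1, M) \<Rightarrow> ?r (T.pt (gam F M1) (gam F M)) [^]\<^bsub>R.T\<^esub> ?s M1 M)"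
        by (simp add: pM case_prod_unfold R.T.finprod_int_pow R.T.int_pow_pow)
    qed (use hom_in_carrier[OF mapR(1)] in auto)
    also have "\<dots> = ?r (\<Delta> (bas F))"
      unfolding coproduct_basis[OF F] by (rule hom_coproduct_sum[OF R.T.comm_group_axioms mapR(1), symmetric])
    finally show ?thesis .
  qed
  then show ?thesis
    using hom_eq_on_basis[OF R.T.is_group hom_compose[OF coproduct_hom l] hom_compose[OF coproduct_hom mapR(1)] _ x]
    by simp
qed

section \<open>The counit\<close>

text \<open>This reads off the coefficient of the discrete forest, the only forest without
  nodes.\<close>

lemma ex_counit:
  "\<exists>\<epsilon>\<in>hom G integer_group. \<forall>F. forest_on I F \<longrightarrow> \<epsilon> (bas F) = (if nodes I F = {} then 1 else 0)"
  using ex_hom_on_basis[OF comm_group_integer_group] by simp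

context
  fixes \<epsilon>
  assumes counit_hom: "\<epsilon> \<in> hom G integer_group"
    and counit_basis: "\<And>F. forest_on I F \<Longrightarrow> \<epsilon> (bas F) = (if nodes I F = {} then 1 else 0)"
begin

lemma counit_gamma:
  assumes F: "forest_on I F" shows "\<epsilon> (gam F M) = (if M = {} then 1 else 0)"
proof (cases "M = {}")
  case True
  then show ?thesis
    using gamma_terms_empty[OF finite_I F] counit_basis[OF forest_on_discrete(1)]
    by (simp add: gamma_def forest_on_discrete)
next
  case False
  interpret Z: comm_group integer_group by (rule comm_group_integer_group)
  have "\<epsilon> (gam F M) = finprod integer_group (\<lambda>F'. \<epsilon> (bas F')) (gamma_terms I F M)"
    unfolding gamma_def using gamma_terms_forest
    by (intro hom_finprod[OF G.comm_group_axioms comm_group_integer_group counit_hom]) auto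
  also have "\<dots> = \<one>\<^bsub>integer_group\<^esub>"
    using False counit_basis gamma_terms_forest by (intro Z.finprod_one_eqI) auto
  finally show ?thesis using False by simp
qed

lemma gamma_nodes: "forest_on I F \<Longrightarrow> gam F (nodes I F) = bas F"
  by (simp add: gamma_def gamma_terms_nodes)

lemma coproduct_counital:
  assumes x: "x \<in> carrier G"
  shows "tensor_unit_left G (tensor_map integer_group G \<epsilon> id (\<Delta> x)) = x"
    and "tensor_unit_right G (tensor_map G integer_group id \<epsilon> (\<Delta> x)) = x"
proof -
  note comm = G.comm_group_axioms comm_group_integer_group
  have id: "id \<in> hom G G" by (auto intro: homI)
  note mapL = tensor_map[OF comm(1) comm(1) comm(2) comm(1) counit_hom id]
  note mapR = tensor_map[OF comm(1) comm(1) comm(1) comm(2) id counit_hom]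
  note unit = tensor_unit[OF comm(1)]
  let ?l = "\<lambda>t. tensor_unit_left G (tensor_map integer_group G \<epsilon> id t)"
  let ?r = "\<lambda>t. tensor_unit_right G (tensor_map G integer_group id \<epsilon> t)"
  have l: "?l \<in> hom T.T G" using hom_compose[OF mapL(1) unit(1)] by (simp add: comp_def)
  have r: "?r \<in> hom T.T G" using hom_compose[OF mapR(1) unit(3)] by (simp add: comp_def)
  \<comment> \<open>Only the split whose evaluated half is empty survives the counit, and its other
    half is all of \<open>N(F)\<close>, whose \<open>\<gamma>\<close> is \<open>F\<close>
    itself.\<close>
  have single: "finprod G f (splits (nodes I F)) = bas F"
    if F: "forest_on I F" and f: "f p = bas F" "p \<in> splits (nodes I F)"
      "\<And>q. q \<in> splits (nodes I F) \<Longrightarrow> q \<noteq> p \<Longrightarrow> f q = \<one>\<^bsub>G\<^esub>" for F f p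
  proof -
    have "f q \<in> carrier G" if "q \<in> splits (nodes I F)" for q
      using F f(1) f(3)[OF that] by (cases "q = p") auto
    then have "finprod G f (splits (nodes I F)) = finprod G f {p}"
      using f(2,3) finite_splits[OF finite_nodes[of F]] by (intro G.finprod_mono_neutral_cong_right) auto
    then show ?thesis using F f(1) by simp
  qed
  have "?l (\<Delta> (bas F)) = bas F \<and> ?r (\<Delta> (bas F)) = bas F" if F: "forest_on I F" for F
  proof
    note eps = counit_gamma[OF F]
    have "?l (\<Delta> (bas F)) = finprod G (\<lambda>(M1, M2). ?l (T.pt (gam F M1) (gam F M2)) [^]\<^bsub>G\<^esub> shuffle_sign M1 M2) (splits (nodes I F))"
      unfolding coproduct_basis[OF F] by (rule hom_coproduct_sum[OF comm(1) l])
    also have "\<dots> = bas F"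
    proof (rule single[OF F, of _ "({}, nodes I F)"])
      fix q assume "q \<in> splits (nodes I F)" "q \<noteq> ({}, nodes I F)"
      then obtain M1 M2 where "q = (M1, M2)" "M1 \<noteq> {}" by (auto simp: splits_def)
      then show "(case q of (M1, M2) \<Rightarrow> ?l (T.pt (gam F M1) (gam F M2)) [^]\<^bsub>G\<^esub> shuffle_sign M1 M2) = \<one>\<^bsub>G\<^esub>"
        by (simp add: mapL(2) unit(2) eps)
    qed (auto simp: splits_def mapL(2) unit(2) eps gamma_nodes F)
    finally show "?l (\<Delta> (bas F)) = bas F" .
    have "?r (\<Delta> (bas F)) = finprod G (\<lambda>(M1, M2). ?r (T.pt (gam F M1) (gam F M2)) [^]\<^bsub>G\<^esub> shuffle_sign M1 M2) (splits (nodes I F))"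
      unfolding coproduct_basis[OF F] by (rule hom_coproduct_sum[OF comm(1) r])
    also have "\<dots> = bas F"
    proof (rule single[OF F, of _ "(nodes I F, {})"])
      fix q assume "q \<in> splits (nodes I F)" "q \<noteq> (nodes I F, {})"
      then obtain M1 M2 where "q = (M1, M2)" "M2 \<noteq> {}" by (auto simp: splits_def)
      then show "(case q of (M1, M2) \<Rightarrow> ?r (T.pt (gam F M1) (gam F M2)) [^]\<^bsub>G\<^esub> shuffle_sign M1 M2) = \<one>\<^bsub>G\<^esub>"
        by (simp add: mapR(2) unit(4) eps)
    qed (auto simp: splits_def mapR(2) unit(4) eps gamma_nodes F)
    finally show "?r (\<Delta> (bas F)) = bas F" .
  qed
  then show "?l (\<Delta> x) = x" "?r (\<Delta> x) = x"
    using hom_eq_on_basis[OF G.is_group hom_compose[OF coproduct_hom l] id _ x]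
      hom_eq_on_basis[OF G.is_group hom_compose[OF coproduct_hom r] id _ x] by simp_all
qed

end

end

section \<open>The grading\<close>

abbreviation "A \<equiv> forest_grading I"

lemma forest_grading_eq:
  "A n = generate G {bas F | F. forest_on I F \<and> int (card (nodes I F)) = n}" (is "_ = generate G ?S")
proof
  have S: "?S \<subseteq> carrier G" by auto
  show "generate G ?S \<subseteq> A n"
    unfolding forest_grading_def
    by (rule G.mono_generate) (auto simp: forest_basis_def oriented_forests_iff)
  show "A n \<subseteq> generate G ?S"
    unfolding forest_grading_def
  proof (rule G.generate_subgroup_incl[OF _ G.generate_is_subgroup[OF S]], clarify)
    fix ori F assume F: "(ori, F) \<in> oriented_forests I" "n = int (card (nodes I F))"
    then obtain s where s: "forest_on I F" "s \<in> {1, -1}" "ori = enum_orientation s (nodes I F)"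
      by (auto simp: oriented_forests_iff)
    have "bas F \<in> generate G ?S" using s F by (blast intro: generate.incl)
    then show "forest_gen I ori F \<in> generate G {bas F' | F'. forest_on I F' \<and> int (card (nodes I F')) = int (card (nodes I F))}"
      using forest_gen_eq[OF s(1,2)] s(3) G.subgroup_int_pow_closed[OF G.generate_is_subgroup[OF S]] F(2) by simp
  qed
qed

lemma grading_generators: "{bas F | F. forest_on I F \<and> int (card (nodes I F)) = n} \<subseteq> carrier G"
  by auto

lemma subgroup_grading: "subgroup (A n) G"
  unfolding forest_grading_eq by (rule G.generate_is_subgroup[OF grading_generators])

lemma bas_in_grading: "forest_on I F \<Longrightarrow> bas F \<in> A (int (card (nodes I F)))"
  unfolding forest_grading_eq by (rule generate.incl) blast

lemma gam_in_grading: "gam F M \<in> A (int (card M))"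
  unfolding gamma_def
proof (rule G.finprod_in_subgroup[OF subgroup_grading])
  fix F' assume "F' \<in> gamma_terms I F M"
  then show "bas F' \<in> A (int (card M))" using gamma_terms_forest[of F' F M] bas_in_grading[of F'] by auto
qed

lemma generate_basis: "carrier G = generate G {bas F | F. forest_on I F}" (is "_ = generate G ?S")
proof
  have S: "?S \<subseteq> carrier G" by auto
  show "generate G ?S \<subseteq> carrier G" by (rule G.generate_incl[OF S])
  have "presented_gen (oriented_forests I) (forest_relators I) ` oriented_forests I \<subseteq> generate G ?S"
  proof clarify
    fix ori F assume "(ori, F) \<in> oriented_forests I"
    then obtain s where s: "forest_on I F" "s \<in> {1, -1}" "ori = enum_orientation s (nodes I F)"
      by (auto simp: oriented_forests_iff)
    have "bas F \<in> generate G ?S" using s by (blast intro: generate.incl)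
    then show "presented_gen (oriented_forests I) (forest_relators I) (ori, F) \<in> generate G ?S"
      using forest_gen_eq[OF s(1,2)] s(3) G.subgroup_int_pow_closed[OF G.generate_is_subgroup[OF S]]
      by (simp add: forest_gen_def)
  qed
  then show "carrier G \<subseteq> generate G ?S"
    using G.generate_subgroup_incl[OF _ G.generate_is_subgroup[OF S]] pr.generate_gens
    unfolding forest_group_def by simp
qed

text \<open>Freeness on forests allows keeping those with a given number of nodes and killing the
  others. That number is at most \<open>card I\<close>, which bounds the degrees.\<close>

lemma ex_projections: "\<exists>\<pi>. projections G A \<pi> (int ` {0..card I})"
proof -
  have "\<exists>h\<in>hom G G. \<forall>F. forest_on I F \<longrightarrow> h (bas F) = (if int (card (nodes I F)) = n then bas F else \<one>\<^bsub>G\<^esub>)" for n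
    by (rule ex_hom_on_basis[OF G.comm_group_axioms]) simp
  then obtain \<pi> where hom: "\<And>n. \<pi> n \<in> hom G G" and
    basis: "\<And>n F. forest_on I F \<Longrightarrow> \<pi> n (bas F) = (if int (card (nodes I F)) = n then bas F else \<one>\<^bsub>G\<^esub>)"
    by metis
  let ?D = "int ` {0..card I}"
  have one_hom: "(\<lambda>_. \<one>\<^bsub>G\<^esub>) \<in> hom G G" and id_hom: "(\<lambda>x. x) \<in> hom G G" by (auto intro: homI)
  have "projections G A \<pi> ?D"
  proof (intro projections.intro projections_axioms.intro G.comm_group_axioms subgroup_grading hom)
    show "\<pi> n x \<in> A n" if "x \<in> carrier G" for x n
    proof (rule hom_generate_in_subgroup[OF G.is_group G.is_group hom subgroup_grading _ _ that[unfolded generate_basis]])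
      show "\<pi> n s \<in> A n" if "s \<in> {bas F |F. forest_on I F}" for s
        using that basis bas_in_grading subgroup.one_closed[OF subgroup_grading] by auto
    qed auto
    show "\<pi> n x = (if n = m then x else \<one>\<^bsub>G\<^esub>)" if "x \<in> A m" for x m n
    proof (cases "n = m")
      case True
      then have "\<pi> n x = x"
        by (intro hom_eq_on_generate[OF G.is_group G.is_group hom id_hom grading_generators _
            that[unfolded forest_grading_eq]]) (auto simp: basis)
      with True show ?thesis by simp
    next
      case False
      then have "\<pi> n x = \<one>\<^bsub>G\<^esub>"
        by (intro hom_eq_on_generate[OF G.is_group G.is_group hom one_hom grading_generators _
            that[unfolded forest_grading_eq]]) (auto simp: basis)
      with False show ?thesis by simp
    qed
    show "finprod G (\<lambda>n. \<pi> n x) ?D = x" if x: "x \<in> carrier G" for x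
    proof (rule hom_eq_on_basis[OF G.is_group _ id_hom _ x])
      show "(\<lambda>x. finprod G (\<lambda>n. \<pi> n x) ?D) \<in> hom G G" by (rule G.finprod_hom_mult) (rule hom)
      fix F assume F: "forest_on I F"
      have "card (nodes I F) \<le> card I" using finite_I by (intro card_mono) (auto simp: nodes_def)
      then have D: "int (card (nodes I F)) \<in> ?D" by auto
      have "finprod G (\<lambda>n. \<pi> n (bas F)) ?D = finprod G (\<lambda>n. if int (card (nodes I F)) = n then bas F else \<one>\<^bsub>G\<^esub>) ?D"
        using F by (intro G.finprod_cong') (auto simp: basis)
      also have "\<dots> = bas F" using D F by (intro G.finprod_singleton) auto
      finally show "finprod G (\<lambda>n. \<pi> n (bas F)) ?D = bas F" .
    qed
  qed simp
  then show ?thesis by blast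
qed

section \<open>Homogeneity and cocommutativity of the coproduct\<close>

lemma subgroup_tensor_grading: "subgroup (tensor_grading G A G A n) T.T"
  unfolding tensor_grading_def
  by (rule T.T.generate_is_subgroup) (use subgroup.mem_carrier[OF subgroup_grading] in auto)

lemma coproduct_sum_in_grading:
  assumes "finite N" shows "coproduct_sum F N \<in> tensor_grading G A G A (int (card N))"
  unfolding coproduct_sum_def
proof (rule T.T.finprod_in_subgroup[OF subgroup_tensor_grading])
  fix p assume "p \<in> splits N"
  then obtain M1 M2 where p: "p = (M1, M2)" "M1 \<union> M2 = N" "M1 \<inter> M2 = {}" by (auto simp: splits_def)
  have "finite M1" "finite M2" using assms p(2) by auto
  then have "int (card M1) + int (card M2) = int (card N)"
    using card_Un_disjoint[of M1 M2] p by simp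
  then have "T.pt (gam F M1) (gam F M2) \<in> tensor_grading G A G A (int (card N))"
    unfolding tensor_grading_def using gam_in_grading by (blast intro: generate.incl)
  then show "(case p of (M1, M2) \<Rightarrow> T.pt (gam F M1) (gam F M2) [^]\<^bsub>T.T\<^esub> shuffle_sign M1 M2)
      \<in> tensor_grading G A G A (int (card N))"
    using T.T.subgroup_int_pow_closed[OF subgroup_tensor_grading] p(1) by simp
qed

text \<open>The twist carries the summand of \<open>(M1, M2)\<close> to that of
  \<open>(M2, M1)\<close>. As \<open>\<gamma>(F,M)\<close> is homogeneous of degree
  \<open>card M\<close>, its Koszul sign is the one in \<open>shuffle_sign_commute\<close>.\<close>

lemma coproduct_cocommutative:
  assumes co: "forest_coproduct I \<Delta>" and x: "x \<in> carrier G"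
  shows "koszul_twist G A (\<Delta> x) = \<Delta> x"
proof -
  obtain \<pi> where "projections G A \<pi> (int ` {0..card I})" using ex_projections by blast
  then interpret pj: projections G A \<pi> "int ` {0..card I}" .
  note k = pj.koszul_twist
  have "koszul_twist G A (\<Delta> (bas F)) = \<Delta> (bas F)" if F: "forest_on I F" for F
  proof -
    let ?N = "nodes I F"
    have "koszul_twist G A (coproduct_sum F ?N)
        = finprod T.T (\<lambda>(M1, M2). koszul_twist G A (T.pt (gam F M1) (gam F M2)) [^]\<^bsub>T.T\<^esub> shuffle_sign M1 M2) (splits ?N)"
      by (rule hom_coproduct_sum[OF co T.T.comm_group_axioms k(1)])
    also have "\<dots> = coproduct_sum F ?N"
      unfolding coproduct_sum_def
    proof (rule T.T.finprod_bij[of prod.swap])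
      show "bij_betw prod.swap (splits ?N) (splits ?N)"
        by (rule bij_betw_byWitness[where f' = prod.swap]) (auto simp: splits_def)
      fix p assume "p \<in> splits ?N"
      then obtain M1 M2 where p: "p = (M1, M2)" "M1 \<union> M2 = ?N" "M1 \<inter> M2 = {}" by (auto simp: splits_def)
      have fin: "finite M1" "finite M2" using finite_nodes[of F] unfolding p(2)[symmetric] by auto
      have "(if even (int (card M1) * int (card M2)) then 1 else - 1) * shuffle_sign M1 M2 = shuffle_sign M2 M1"
        using shuffle_sign_commute[OF fin p(3)] shuffle_sign_commute[OF fin(2,1)] p(3)
        by (auto simp: uminus_power_if)
      then show "(case p of (M1, M2) \<Rightarrow> koszul_twist G A (T.pt (gam F M1) (gam F M2)) [^]\<^bsub>T.T\<^esub> shuffle_sign M1 M2)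
          = (case prod.swap p of (M1, M2) \<Rightarrow> T.pt (gam F M1) (gam F M2) [^]\<^bsub>T.T\<^esub> shuffle_sign M1 M2)"
        using k(2)[OF gam_in_grading gam_in_grading, of F M1 F M2] p(1) by (simp add: T.T.int_pow_pow)
    qed auto
    finally show ?thesis using coproduct_basis[OF co F] by simp
  qed
  then show ?thesis
    using hom_eq_on_basis[OF T.T.is_group hom_compose[OF coproduct_hom[OF co] k(1)] coproduct_hom[OF co] _ x] by simp
qed

lemma forest_coalgebra:
  assumes co: "forest_coproduct I \<Delta>"
  shows "\<exists>\<epsilon>. cocommutative_graded_coalgebra G A \<Delta> \<epsilon>"
proof -
  obtain \<pi> where "projections G A \<pi> (int ` {0..card I})" using ex_projections by blast
  then interpret pj: projections G A \<pi> "int ` {0..card I}" .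
  obtain \<epsilon> where e: "\<epsilon> \<in> hom G integer_group"
    "\<And>F. forest_on I F \<Longrightarrow> \<epsilon> (bas F) = (if nodes I F = {} then 1 else 0)"
    using ex_counit[OF co] by blast
  have zero: "(\<lambda>_. 0) \<in> hom G integer_group" by (auto intro: homI)
  have "cocommutative_graded_coalgebra G A \<Delta> \<epsilon>"
  proof (intro cocommutative_graded_coalgebra.intro cocommutative_graded_coalgebra_axioms.intro
      pj.graded_abelian_group coproduct_hom[OF co] e(1) coproduct_coassociative[OF co]
      coproduct_counital[OF co e] coproduct_cocommutative[OF co])
    show "\<Delta> x \<in> tensor_grading G A G A n" if "x \<in> A n" for x n
    proof (rule hom_generate_in_subgroup[OF G.is_group T.T.is_group coproduct_hom[OF co] subgroup_tensor_grading
          grading_generators _ that[unfolded forest_grading_eq]])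
      fix s assume "s \<in> {bas F |F. forest_on I F \<and> int (card (nodes I F)) = n}"
      then show "\<Delta> s \<in> tensor_grading G A G A n"
        using coproduct_basis[OF co] coproduct_sum_in_grading[OF finite_nodes] by auto
    qed
    show "\<epsilon> x = 0" if "x \<in> A n" "n \<noteq> 0" for x n
      using that e(2)
      by (intro hom_eq_on_generate[OF G.is_group group_integer_group e(1) zero grading_generators _
            that(1)[unfolded forest_grading_eq]]) auto
  qed
  then show ?thesis by blast
qed

end

text \<open>The formula by itself is a condition on \<open>\<Delta>\<close>. Its unique solvability
  contains the independence of the chosen orientations and keeps the coalgebra claim from being
  vacuous.\<close>

theorem proposition12:
  fixes I :: "'a set"
  assumes "finite I"
  shows "(\<exists>!\<Delta>. \<Delta> \<in> extensional (carrier (forest_group I)) \<and> forest_coproduct I \<Delta>) \<and>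
    (\<forall>\<Delta>. forest_coproduct I \<Delta> \<longrightarrow>
       (\<exists>\<epsilon>. cocommutative_graded_coalgebra (forest_group I) (forest_grading I) \<Delta> \<epsilon>))"
proof -
  interpret finite_forests I by unfold_locales fact
  show ?thesis using ex1_forest_coproduct forest_coalgebra by blast
qed

end
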